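(* Let $d\ge 1$ and let $\gamma_d$ be the standard Gaussian measure on $\mathbb{R}^d$. Let $V,W:\mathbb{R}^d\to\mathbb{R}\cup\{+\infty\}$ be convex functions such that $\mu(dx)=e^{V(x)}\gamma_d(dx)$ and $\nu(dx)=e^{-W(x)}\gamma_d(dx)$ are probability measures, where $\mu$ has a finite second moment and $\nu$ is compactly supported. Assume additionally that $V$ is bounded from below. If $\eta$ is a probability measure on $\mathbb{R}^d$ with $\eta\leq_c\nu$, then for all $\varepsilon>0$ \[ \mathcal{T}_H^\varepsilon(\mu,\eta)\ \geq\ \mathcal{T}_H^\varepsilon(\mu,\nu). \]
   Context: Convex functions are allowed to take the value $+\infty$ (with $e^{-\infty}=0$). Convex order: for Borel probability measures $\eta_1,\eta_2$ on $\mathbb{R}^d$ with finite first moments, $\eta_1\leq_c\eta_2$ means $\int f\,d\eta_1\le\int f\,d\eta_2$ for every convex $f:\mathbb{R}^d\to\mathbb{R}$ (in particular, writing $\eta\le_c\nu$ presupposes that $\eta$ has a finite first moment). Reference measure: for $\varepsilon>0$, $R^\varepsilon$ is the probability measure on $\mathbb{R}^d\times\mathbb{R}^d$ given by $R^\varepsilon=\mathrm{Law}\left(X,\,e^{-\varepsilon/2}X+\sqrt{1-e^{-\varepsilon}}\,Y\right)$ with $X,Y$ independent standard Gaussian vectors on $\mathbb{R}^d$; equivalently $R^\varepsilon(dxdy)=\gamma_d(dx)\,r_x^\varepsilon(dy)$ with $r_x^\varepsilon=\mathcal{N}(e^{-\varepsilon/2}x,(1-e^{-\varepsilon})I_d)$.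 Relative entropy: $H(\alpha|\beta)=\int\log\left(\frac{d\alpha}{d\beta}\right)d\alpha$ if $\alpha$ is absolutely continuous with respect to $\beta$, and $H(\alpha|\beta)=+\infty$ otherwise. Entropic transport cost: for probability measures $\mu,\nu$ on $\mathbb{R}^d$, $\mathcal{T}_H^\varepsilon(\mu,\nu)=\inf_{\pi\in C(\mu,\nu)}H(\pi|R^\varepsilon)\in[0,+\infty]$, where $C(\mu,\nu)$ is the set of couplings of $\mu$ and $\nu$, i.e. probability measures on $\mathbb{R}^d\times\mathbb{R}^d$ with first marginal $\mu$ and second marginal $\nu$. *)

theory Defs
  imports "HOL-Probability.Probability"
begin

(* Such an f may fail to be Borel on the frontier of its effective domain. That frontier lies in a
   closed Lebesgue-null set, so a density of the form exp o f against a Gaussian measure is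
   nevertheless meaningful without a measurability assumption. *)
definition econvex :: "('a::real_vector \<Rightarrow> ereal) \<Rightarrow> bool" where
  "econvex f \<longleftrightarrow> (\<forall>x. f x \<noteq> -\<infinity>) \<and>
     (\<forall>x y. \<forall>u\<ge>0. \<forall>v\<ge>0. u + v = 1 \<longrightarrow>
        f (u *\<^sub>R x + v *\<^sub>R y) \<le> ereal u * f x + ereal v * f y)"

definition eexp :: "ereal \<Rightarrow> ennreal" where
  "eexp z = (case z of ereal r \<Rightarrow> ennreal (exp r) | PInfty \<Rightarrow> \<infinity> | MInfty \<Rightarrow> 0)"

definition std_gaussian :: "'a::euclidean_space measure" where
  "std_gaussian = density lborel (\<lambda>x. ennreal (\<Prod>b\<in>Basis. std_normal_density (x \<bullet> b)))"

(* Lebesgue integral with values in [-oo, +oo]; the Bochner integral is 0 on non-integrable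
   functions. Below, the negative part always has a finite integral, so the case
   \<infinity> - \<infinity> does not occur. *)
definition eintegral :: "'a measure \<Rightarrow> ('a \<Rightarrow> real) \<Rightarrow> ereal" where
  "eintegral M f = enn2ereal (\<integral>\<^sup>+x. ennreal (f x) \<partial>M) - enn2ereal (\<integral>\<^sup>+x. ennreal (- f x) \<partial>M)"

definition borel_prob :: "'a::topological_space measure \<Rightarrow> bool" where
  "borel_prob M \<longleftrightarrow> prob_space M \<and> sets M = sets borel"

definition convex_order :: "'a::euclidean_space measure \<Rightarrow> 'a measure \<Rightarrow> bool"
    (infix "\<le>\<^sub>c" 50) where
  "\<eta>1 \<le>\<^sub>c \<eta>2 \<longleftrightarrow>
     borel_prob \<eta>1 \<and> integrable \<eta>1 norm \<and> borel_prob \<eta>2 \<and> integrable \<eta>2 norm \<and>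
     (\<forall>f. convex_on UNIV f \<longrightarrow> eintegral \<eta>1 f \<le> eintegral \<eta>2 f)"

definition ref_measure :: "real \<Rightarrow> ('a::euclidean_space \<times> 'a) measure" where
  "ref_measure \<epsilon> = distr (std_gaussian \<Otimes>\<^sub>M std_gaussian) borel
     (\<lambda>(x, y). (x, exp (- \<epsilon> / 2) *\<^sub>R x + sqrt (1 - exp (- \<epsilon>)) *\<^sub>R y))"

(* Unlike KL_divergence, this is \<infinity> when absolute continuity or integrability fails. *)
definition rel_entropy :: "'a measure \<Rightarrow> 'a measure \<Rightarrow> ereal" where
  "rel_entropy \<alpha> \<beta> =
     (if absolutely_continuous \<beta> \<alpha> then eintegral \<alpha> (entropy_density (exp 1) \<beta> \<alpha>) else \<infinity>)"

definition couplings ::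
    "'a::euclidean_space measure \<Rightarrow> 'a measure \<Rightarrow> ('a \<times> 'a) measure set" where
  "couplings \<mu> \<nu> = {\<pi>. borel_prob \<pi> \<and> distr \<pi> borel fst = \<mu> \<and> distr \<pi> borel snd = \<nu>}"

definition entropic_cost :: "real \<Rightarrow> 'a::euclidean_space measure \<Rightarrow> 'a measure \<Rightarrow> ereal" where
  "entropic_cost \<epsilon> \<mu> \<nu> = (INF \<pi>\<in>couplings \<mu> \<nu>. rel_entropy \<pi> (ref_measure \<epsilon>))"

end

theory Submission
  imports Defs "HOL-Complex_Analysis.Great_Picard"
begin

text \<open>Write \<open>\<mu> = exp V \<gamma>\<close>, \<open>\<nu> = exp (- W) \<gamma>\<close> and let \<open>R\<close> be the reference measure. For every \<open>u \<ge> 0\<close> with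
\<open>\<integral> u dR \<le> 1\<close> one has \<open>H(\<rho>|R) \<ge> \<integral> ln u d\<rho>\<close>, with equality if \<open>\<rho> = u R\<close>. Suppose that some coupling
\<open>\<pi>\<close> of \<open>\<mu>\<close> and \<open>\<nu>\<close> has the form \<open>\<pi>(dx dy) = exp (F x) v(y) R(dx dy)\<close> with \<open>v\<close> log-concave. Then, for
every coupling \<open>\<rho>\<close> of \<open>\<mu>\<close> and \<open>\<eta>\<close>,

  \<open>H(\<rho>|R) \<ge> \<integral> F d\<mu> + \<integral> ln v d\<eta> \<ge> \<integral> F d\<mu> + \<integral> ln v d\<nu> = H(\<pi>|R)\<close>,

where the second inequality is the convex order tested on the convex function \<open>- ln v\<close>. This is
\<open>log_concave_product_coupling_minimal\<close>; the inequality for \<open>u\<close> is \<open>gibbs_inequality\<close>.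

The coupling \<open>\<pi>\<close> comes from the dual problem. Its density with respect to \<open>\<mu> \<Otimes> \<nu>\<close> is sought as
\<open>exp (a (x \<bullet> y) - \<phi> x) g y\<close>, and one Sinkhorn step replaces \<open>\<phi>\<close> by the potential that restores the
first marginal after \<open>g\<close> has been chosen to restore the second one. A Sinkhorn step preserves the class
of potentials for which the corresponding factor of the density with respect to \<open>R\<close> is log-convex
in \<open>x\<close>: Gaussian averages of log-convex functions are log-convex by the Hoelder inequality, those of
log-concave functions are log-concave by the Prekopa-Leindler inequality
(\<open>prekopa_leindler\<close>), and \<open>V\<close> and \<open>W\<close> are convex. Since \<open>\<nu>\<close> lives on a ball, all these potentials share a
Lipschitz constant, so that the class is sequentially compact for pointwise convergence, and the
dual cost is lower semicontinuous by Fatou's lemma; hence it has a minimizer inside the class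
(\<open>dual_cost_minimizer\<close>). A Sinkhorn step lowers the dual cost strictly unless the potential is
already \<open>\<mu>\<close>-almost everywhere a fixed point (\<open>minimizer_fixed_point\<close>), and a fixed point satisfies both marginal
constraints (\<open>schroedinger_system\<close>). Minimizing within the class in this way avoids any
convergence analysis of the Sinkhorn iteration.

The function \<open>- ln v\<close> may be infinite and badly behaved on the frontier of its effective domain,
whereas the convex order only concerns real-valued functions. The regularizations \<open>sup_conv\<close>
replace it by an increasing sequence of real-valued convex functions that converges almost
everywhere (\<open>log_concave_regularization\<close>). The same approximation shows that \<open>exp (- W)\<close> agrees almost everywhere with
a Borel measurable log-concave function.\<close>

section \<open>The Prekopa-Leindler inequality\<close>

text \<open>Powers \<open>x\<^sup>t\<close> with exponent \<open>t > 0\<close> on \<open>[0,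
\<infinity>]\<close>. Extended values are unavoidable here: marginals of integrable functions can be
infinite at single points.\<close>

definition epow :: "ennreal \<Rightarrow> real \<Rightarrow> ennreal" where
  "epow x t = (if x = \<infinity> then \<infinity> else ennreal (enn2real x powr t))"

lemma epow_ennreal [simp]: "0 \<le> a \<Longrightarrow> epow (ennreal a) t = ennreal (a powr t)"
  by (simp add: epow_def)

lemma epow_top [simp]: "epow \<infinity> t = \<infinity>" "epow top t = \<infinity>"
  by (simp_all add: epow_def)

lemma epow_0 [simp]: "epow 0 t = 0"
  by (simp add: epow_def)

lemma epow_mono: "0 < t \<Longrightarrow> a \<le> b \<Longrightarrow> epow a t \<le> epow b t"
  by (cases a; cases b) (auto simp: top_unique powr_mono2)

lemma epow_mult: "0 < t \<Longrightarrow> epow (a * b) t = epow a t * epow b t"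
  by (cases a; cases b) (auto simp: ennreal_mult[symmetric] powr_mult ennreal_mult_top ennreal_top_mult)

lemma epow_inverse: "0 < t \<Longrightarrow> epow (epow x t) (1 / t) = x"
  by (cases x) (auto simp: powr_powr)

lemma epow_le_iff: "0 < t \<Longrightarrow> epow x t \<le> c \<longleftrightarrow> x \<le> epow c (1 / t)"
  using epow_mono[of "1/t" "epow x t" c] epow_mono[of t x "epow c (1/t)"]
    epow_inverse[of t x] epow_inverse[of "1/t" c] by auto

lemma epow_SUP: "0 < t \<Longrightarrow> epow (SUP i. A i) t = (SUP i. epow (A i) t)"
proof (rule antisym)
  assume t: "0 < t"
  have "A i \<le> epow (SUP i. epow (A i) t) (1 / t)" for i
    using t by (subst epow_le_iff[symmetric]) (auto intro: SUP_upper)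
  then show "epow (SUP i. A i) t \<le> (SUP i. epow (A i) t)"
    using t by (subst epow_le_iff) (auto intro: SUP_least)
  show "(SUP i. epow (A i) t) \<le> epow (SUP i. A i) t"
    using t by (intro SUP_least epow_mono SUP_upper) auto
qed

lemma epow_arith_geo:
  assumes "0 < t" "0 < u" "t + u = 1"
  shows "epow a t * epow b u \<le> ennreal t * a + ennreal u * b"
proof (cases "a = \<infinity> \<or> b = \<infinity>")
  case True
  then show ?thesis using assms by (auto simp: ennreal_mult_top)
next
  case False
  then obtain x y where xy: "a = ennreal x" "b = ennreal y" "0 \<le> x" "0 \<le> y"
    by (cases a; cases b) auto
  have "x powr t * y powr u \<le> t * x + u * y"
    using Youngs_inequality_0[of t u x y] assms xy by (cases "x = 0 \<or> y = 0") auto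
  with xy assms show ?thesis
    by (simp add: ennreal_mult[symmetric] ennreal_plus[symmetric] ennreal_leI del: ennreal_plus)
qed

text \<open>Geometric means pass to increasing limits. This removes boundedness assumptions by truncation.\<close>

lemma epow_geo_SUP_le:
  assumes tu: "0 < t" "0 < u" and inc: "incseq A" "incseq B"
    and le: "\<And>n::nat. epow (A n) t * epow (B n) u \<le> S"
  shows "epow (SUP n. A n) t * epow (SUP n. B n) u \<le> S"
proof -
  have mn: "epow (A m) t * epow (B n) u \<le> S" for m n
  proof -
    have "epow (A m) t * epow (B n) u \<le> epow (A (max m n)) t * epow (B (max m n)) u"
      using inc tu by (intro mult_mono epow_mono) (auto simp: incseq_def)
    then show ?thesis using le order_trans by blast
  qed
  have "epow (A m) t * (SUP n. epow (B n) u) \<le> S" for m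
    by (subst SUP_mult_left_ennreal) (auto intro!: SUP_least mn)
  then have "(SUP m. epow (A m) t) * (SUP n. epow (B n) u) \<le> S"
    by (subst SUP_mult_right_ennreal) (auto intro!: SUP_least)
  then show ?thesis by (simp add: epow_SUP tu)
qed

lemma emeasure_lborel_affine_le:
  fixes X Z :: "real set"
  assumes [measurable]: "X \<in> sets borel" "Z \<in> sets borel" and c: "0 < c"
    and sub: "\<And>x. x \<in> X \<Longrightarrow> a + c * x \<in> Z"
  shows "ennreal c * emeasure lborel X \<le> emeasure lborel Z"
proof -
  have "emeasure lborel Z = (\<integral>\<^sup>+x. indicator Z x \<partial>lborel)" by simp
  also have "\<dots> = c * (\<integral>\<^sup>+x. indicator Z (a + c * x) \<partial>lborel)"
    using c by (subst nn_integral_real_affine[where c = c and t = a]) auto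
  also have "\<dots> \<ge> c * (\<integral>\<^sup>+x. indicator X x \<partial>lborel)"
    using sub by (intro mult_left_mono nn_integral_mono) (auto simp: indicator_def)
  finally show ?thesis by simp
qed

text \<open>Let \<open>x \<in> X\<close> be almost the supremum of \<open>X\<close> and \<open>y \<in> Y\<close>
almost the infimum of \<open>Y\<close>. The affine copies \<open>t X + u y\<close> of (almost all
of) \<open>X\<close> and \<open>t x + u Y\<close> of (almost all of) \<open>Y\<close> both lie in
\<open>Z\<close> and are separated by the point \<open>t x + u y\<close>.\<close>

lemma brunn_minkowski_real_bounded:
  fixes X Y Z :: "real set"
  assumes [measurable]: "X \<in> sets borel" "Y \<in> sets borel" "Z \<in> sets borel"
    and ne: "X \<noteq> {}" "Y \<noteq> {}" and bdd: "bdd_above X" "bdd_below Y"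
    and tu: "0 < t" "0 < u" "t + u = 1"
    and sub: "\<And>x y. x \<in> X \<Longrightarrow> y \<in> Y \<Longrightarrow> t * x + u * y \<in> Z"
  shows "ennreal t * emeasure lborel X + ennreal u * emeasure lborel Y \<le> emeasure lborel Z"
proof (rule ennreal_le_epsilon)
  fix e :: real assume e: "0 < e"
  obtain x where x: "x \<in> X" "Sup X - e < x"
    using less_cSupD[of X "Sup X - e"] ne e by auto
  obtain y where y: "y \<in> Y" "y < Inf Y + e"
    using cInf_lessD[of Y "Inf Y + e"] ne e by auto
  have "emeasure lborel X \<le> emeasure lborel ((X \<inter> {..x}) \<union> {x..x+e})"
    using x cSup_upper[OF _ bdd(1)] by (intro emeasure_mono) force+
  also have "\<dots> \<le> emeasure lborel (X \<inter> {..x}) + emeasure lborel {x..x+e}"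
    by (rule emeasure_subadditive) auto
  finally have X: "emeasure lborel X \<le> emeasure lborel (X \<inter> {..x}) + e"
    using e by simp
  have "emeasure lborel Y \<le> emeasure lborel ((Y \<inter> {y<..}) \<union> {y-e..y})"
    using y cInf_lower[OF _ bdd(2)] by (intro emeasure_mono) force+
  also have "\<dots> \<le> emeasure lborel (Y \<inter> {y<..}) + emeasure lborel {y-e..y}"
    by (rule emeasure_subadditive) auto
  finally have Y: "emeasure lborel Y \<le> emeasure lborel (Y \<inter> {y<..}) + e"
    using e by simp
  let ?m = "t * x + u * y"
  have "ennreal t * emeasure lborel (X \<inter> {..x}) \<le> emeasure lborel (Z \<inter> {..?m})"
    using tu y sub by (intro emeasure_lborel_affine_le[where a = "u * y"]) (auto simp: add.commute)
  moreover have "ennreal u * emeasure lborel (Y \<inter> {y<..}) \<le> emeasure lborel (Z \<inter> {?m<..})"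
    using tu x sub by (intro emeasure_lborel_affine_le[where a = "t * x"]) auto
  moreover have "emeasure lborel Z = emeasure lborel (Z \<inter> {..?m}) + emeasure lborel (Z \<inter> {?m<..})"
    by (subst plus_emeasure) (auto intro!: arg_cong[where f = "emeasure lborel"])
  ultimately have *: "ennreal t * emeasure lborel (X \<inter> {..x}) + ennreal u * emeasure lborel (Y \<inter> {y<..})
      \<le> emeasure lborel Z" by (auto intro: add_mono)
  have "ennreal t * emeasure lborel X + ennreal u * emeasure lborel Y \<le>
     ennreal t * (emeasure lborel (X \<inter> {..x}) + e) + ennreal u * (emeasure lborel (Y \<inter> {y<..}) + e)"
    using X Y by (intro add_mono mult_left_mono) auto
  also have "\<dots> = ennreal t * emeasure lborel (X \<inter> {..x}) + ennreal u * emeasure lborel (Y \<inter> {y<..})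
     + (ennreal t + ennreal u) * e"
    by (simp add: distrib_left distrib_right ac_simps)
  also have "(ennreal t + ennreal u) * e = ennreal e"
    using tu e by (simp add: ennreal_plus[symmetric] del: ennreal_plus)
  finally show "ennreal t * emeasure lborel X + ennreal u * emeasure lborel Y \<le> emeasure lborel Z + ennreal e"
    using * by (meson add_right_mono order_trans)
qed

lemma brunn_minkowski_real:
  fixes X Y Z :: "real set"
  assumes [measurable]: "X \<in> sets borel" "Y \<in> sets borel" "Z \<in> sets borel"
    and ne: "X \<noteq> {}" "Y \<noteq> {}"
    and tu: "0 < t" "0 < u" "t + u = 1"
    and sub: "\<And>x y. x \<in> X \<Longrightarrow> y \<in> Y \<Longrightarrow> t * x + u * y \<in> Z"
  shows "ennreal t * emeasure lborel X + ennreal u * emeasure lborel Y \<le> emeasure lborel Z"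
proof -
  obtain x0 y0 where 0: "x0 \<in> X" "y0 \<in> Y" using ne by auto
  define X' where "X' n = X \<inter> {..x0 + real n}" for n
  define Y' where "Y' n = Y \<inter> {y0 - real n..}" for n
  have [measurable]: "X' n \<in> sets borel" "Y' n \<in> sets borel" for n
    by (auto simp: X'_def Y'_def)
  have UX: "(\<Union>n. X' n) = X"
    by (auto simp: X'_def) (metis add.commute diff_le_eq real_arch_simple)
  have UY: "(\<Union>n. Y' n) = Y"
    by (auto simp: Y'_def) (metis diff_le_eq add.commute real_arch_simple)
  have inc: "incseq X'" "incseq Y'" by (auto simp: X'_def Y'_def incseq_def)
  have eX: "emeasure lborel X = (SUP n. emeasure lborel (X' n))"
    using SUP_emeasure_incseq[of X' lborel] inc UX by (simp add: image_subset_iff)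
  have eY: "emeasure lborel Y = (SUP n. emeasure lborel (Y' n))"
    using SUP_emeasure_incseq[of Y' lborel] inc UY by (simp add: image_subset_iff)
  have "ennreal t * emeasure lborel X + ennreal u * emeasure lborel Y
      = (SUP n. ennreal t * emeasure lborel (X' n)) + (SUP n. ennreal u * emeasure lborel (Y' n))"
    by (simp add: eX eY SUP_mult_left_ennreal)
  also have "\<dots> = (SUP n. ennreal t * emeasure lborel (X' n) + ennreal u * emeasure lborel (Y' n))"
    using inc by (intro ennreal_SUP_add[symmetric])
       (fastforce simp: incseq_def intro!: mult_left_mono emeasure_mono)+
  also have "\<dots> \<le> emeasure lborel Z"
  proof (rule SUP_least)
    fix n
    have "x0 \<in> X' n" "y0 \<in> Y' n" using 0 by (auto simp: X'_def Y'_def)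
    then show "ennreal t * emeasure lborel (X' n) + ennreal u * emeasure lborel (Y' n) \<le> emeasure lborel Z"
      using tu sub by (intro brunn_minkowski_real_bounded) (auto simp: X'_def Y'_def)
  qed
  finally show ?thesis .
qed

text \<open>Only the levels \<open>s < 1\<close> are counted, since these are the ones at which the superlevel
sets of a function with supremum 1 are nonempty.\<close>

lemma layer_cake_min_1:
  fixes f :: "real \<Rightarrow> ennreal"
  assumes [measurable]: "f \<in> borel_measurable borel"
  shows "(\<integral>\<^sup>+s. indicator {0..<1} s * emeasure lborel {x. ennreal s < f x} \<partial>lborel)
     = (\<integral>\<^sup>+x. min (f x) 1 \<partial>lborel)"
proof -
  have "(\<integral>\<^sup>+s. indicator {0..<1} s * emeasure lborel {x. ennreal s < f x} \<partial>lborel)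
     = (\<integral>\<^sup>+s. (\<integral>\<^sup>+x. indicator {0..<1} s * indicator {x. ennreal s < f x} x \<partial>lborel) \<partial>lborel)"
    by (simp add: nn_integral_cmult)
  also have "\<dots> = (\<integral>\<^sup>+x. (\<integral>\<^sup>+s. indicator {0..<1} s * indicator {x. ennreal s < f x} x \<partial>lborel) \<partial>lborel)"
    by (rule lborel_pair.Fubini') (simp add: indicator_def)
  also have "\<dots> = (\<integral>\<^sup>+x. min (f x) 1 \<partial>lborel)"
  proof (rule nn_integral_cong)
    fix x
    obtain c where c: "min (f x) 1 = ennreal c" "0 \<le> c" "c \<le> 1"
      using that[of "enn2real (min (f x) 1)"] enn2real_mono[of "min (f x) 1" 1]
      by (auto simp: min_less_iff_disj)
    have "indicator {0..<1} s * indicator {x. ennreal s < f x} x = (indicator {0..<c} s :: ennreal)" for s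
    proof -
      have "ennreal s < f x \<and> s < 1 \<longleftrightarrow> ennreal s < min (f x) 1" if "0 \<le> s"
        using that by (auto simp: ennreal_1[symmetric] ennreal_less_iff simp del: ennreal_1)
      then show ?thesis using c by (auto simp: indicator_def ennreal_less_iff)
    qed
    then show "(\<integral>\<^sup>+s. indicator {0..<1} s * indicator {x. ennreal s < f x} x \<partial>lborel) = min (f x) 1"
      using c by simp
  qed
  finally show ?thesis .
qed

text \<open>At each level \<open>s < 1\<close> the superlevel sets of \<open>f\<close> and \<open>g\<close> are
nonempty, and their weighted Minkowski sum is contained in the superlevel set of \<open>h\<close>.
Integrating the Brunn-Minkowski inequality over the levels gives a bound by the arithmetic mean,
which is stronger than the geometric mean.\<close>

lemma prekopa_leindler_real_normalized:
  fixes f g h :: "real \<Rightarrow> ennreal"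
  assumes [measurable]: "f \<in> borel_measurable borel" "g \<in> borel_measurable borel" "h \<in> borel_measurable borel"
    and tu: "0 < t" "0 < u" "t + u = 1"
    and sup: "(SUP x. f x) = 1" "(SUP x. g x) = 1"
    and le: "\<And>x y. epow (f x) t * epow (g y) u \<le> h (t * x + u * y)"
  shows "ennreal t * (\<integral>\<^sup>+x. f x \<partial>lborel) + ennreal u * (\<integral>\<^sup>+x. g x \<partial>lborel) \<le> (\<integral>\<^sup>+x. h x \<partial>lborel)"
proof -
  let ?L = "\<lambda>f::real \<Rightarrow> ennreal. (\<integral>\<^sup>+s. indicator {0..<1} s * emeasure lborel {x. ennreal s < f x} \<partial>lborel)"
  have f1: "min (f x) 1 = f x" "min (g x) 1 = g x" for x
    using sup by (metis SUP_upper UNIV_I min.absorb1)+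
  have [measurable]: "(\<lambda>s. emeasure lborel {x. ennreal s < p x}) \<in> borel_measurable borel"
    if [measurable]: "p \<in> borel_measurable borel" for p :: "real \<Rightarrow> ennreal"
  proof -
    have "(\<lambda>s. emeasure lborel (Pair s -` {z \<in> space (borel \<Otimes>\<^sub>M borel). ennreal (fst z) < p (snd z)})) \<in> borel_measurable borel"
      by (rule lborel.measurable_emeasure_Pair) measurable
    then show ?thesis by (simp add: space_pair_measure vimage_def)
  qed
  have "ennreal t * ?L f + ennreal u * ?L g =
     (\<integral>\<^sup>+s. ennreal t * (indicator {0..<1} s * emeasure lborel {x. ennreal s < f x}) +
        ennreal u * (indicator {0..<1} s * emeasure lborel {x. ennreal s < g x}) \<partial>lborel)"
    by (simp add: nn_integral_add nn_integral_cmult)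
  also have "\<dots> \<le> ?L h"
  proof (rule nn_integral_mono)
    fix s :: real
    show "ennreal t * (indicator {0..<1} s * emeasure lborel {x. ennreal s < f x}) +
        ennreal u * (indicator {0..<1} s * emeasure lborel {x. ennreal s < g x})
        \<le> indicator {0..<1} s * emeasure lborel {x. ennreal s < h x}"
    proof (cases "s \<in> {0..<1}")
      case True
      then have "ennreal s < 1" by (simp add: ennreal_less_one_iff)
      then obtain x y where xy: "ennreal s < f x" "ennreal s < g y"
        using sup by (metis less_SUP_iff)
      have "ennreal s < h (t * x + u * y)" if xy: "ennreal s < f x" "ennreal s < g y" for x y
      proof -
        define m where "m = min (f x) (g y)"
        have "m < top" using f1[of x] by (auto simp: m_def min_less_iff_disj)
          (metis ennreal_less_top ennreal_1 min.strict_coboundedI2 order.strict_trans2 linorder_not_le min.cobounded2 top.not_eq_extremum neq_top_trans)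
        then obtain r where r: "m = ennreal r" "0 \<le> r" by (cases m) auto
        have sr: "s < r" "0 < r" using xy r True by (auto simp: m_def min_def ennreal_less_iff split: if_splits)
        have "epow m t * epow m u = ennreal (r powr t * r powr u)" using r by (simp add: ennreal_mult)
        also have "r powr t * r powr u = r" using sr tu by (simp add: powr_add[symmetric])
        finally have "ennreal s < epow m t * epow m u" using sr True by (simp add: ennreal_less_iff)
        also have "\<dots> \<le> epow (f x) t * epow (g y) u"
          using tu by (intro mult_mono epow_mono) (auto simp: m_def)
        also have "\<dots> \<le> h (t * x + u * y)" by (rule le)
        finally show ?thesis .
      qed
      with xy tu True show ?thesis
        by (auto intro!: brunn_minkowski_real)
    qed simp
  qed
  also have "?L h \<le> (\<integral>\<^sup>+x. h x \<partial>lborel)"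
    by (simp add: layer_cake_min_1 nn_integral_mono)
  finally show ?thesis by (simp add: layer_cake_min_1 f1)
qed

lemma prekopa_leindler_real_bounded:
  fixes f g h :: "real \<Rightarrow> ennreal"
  assumes [measurable]: "f \<in> borel_measurable borel" "g \<in> borel_measurable borel" "h \<in> borel_measurable borel"
    and tu: "0 < t" "0 < u" "t + u = 1"
    and bdd: "(SUP x. f x) < \<infinity>" "(SUP x. g x) < \<infinity>"
    and le: "\<And>x y. epow (f x) t * epow (g y) u \<le> h (t * x + u * y)"
  shows "epow (\<integral>\<^sup>+x. f x \<partial>lborel) t * epow (\<integral>\<^sup>+x. g x \<partial>lborel) u \<le> (\<integral>\<^sup>+x. h x \<partial>lborel)"
proof (cases "(SUP x. f x) = 0 \<or> (SUP x. g x) = 0")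
  case True
  then have "(\<forall>x. f x = 0) \<or> (\<forall>x. g x = 0)" by (auto simp: SUP_eq_iff bot_ennreal[symmetric] SUP_bot_conv simp del: bot_ennreal)
  then show ?thesis by auto
next
  case False
  obtain A B where AB: "(SUP x. f x) = ennreal A" "(SUP x. g x) = ennreal B" "0 < A" "0 < B"
    using bdd False by (cases "SUP x. f x"; cases "SUP x. g x") (auto simp: less_le)
  define c where "c = A powr t * B powr u"
  have c: "0 < c" using AB by (simp add: c_def)
  define f1 g1 h1 where "f1 = (\<lambda>x. ennreal (1/A) * f x)" "g1 = (\<lambda>x. ennreal (1/B) * g x)"
    "h1 = (\<lambda>x. ennreal (1/c) * h x)"
  note d = this
  have [measurable]: "f1 \<in> borel_measurable borel" "g1 \<in> borel_measurable borel" "h1 \<in> borel_measurable borel"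
    by (auto simp: d)
  have s: "(SUP x. f1 x) = 1" "(SUP x. g1 x) = 1"
    unfolding d using AB by (simp_all add: SUP_mult_left_ennreal[symmetric] ennreal_mult[symmetric])
  have "epow (f1 x) t * epow (g1 y) u \<le> h1 (t * x + u * y)" for x y
  proof -
    have "epow (f1 x) t * epow (g1 y) u = ennreal ((1/A) powr t) * ennreal ((1/B) powr u) * (epow (f x) t * epow (g y) u)"
      using tu AB by (simp add: d epow_mult ac_simps)
    also have "ennreal ((1/A) powr t) * ennreal ((1/B) powr u) = ennreal (1/c)"
      using AB by (simp add: c_def ennreal_mult[symmetric] powr_divide)
    also have "ennreal (1/c) * (epow (f x) t * epow (g y) u) \<le> h1 (t * x + u * y)"
      by (auto simp: d intro!: mult_left_mono le)
    finally show ?thesis .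
  qed
  from prekopa_leindler_real_normalized[OF _ _ _ tu s this]
  have "ennreal t * (\<integral>\<^sup>+x. f1 x \<partial>lborel) + ennreal u * (\<integral>\<^sup>+x. g1 x \<partial>lborel) \<le> (\<integral>\<^sup>+x. h1 x \<partial>lborel)"
    by simp
  then have "epow (\<integral>\<^sup>+x. f1 x \<partial>lborel) t * epow (\<integral>\<^sup>+x. g1 x \<partial>lborel) u \<le> (\<integral>\<^sup>+x. h1 x \<partial>lborel)"
    using epow_arith_geo[OF tu] order_trans by blast
  then have "ennreal c * (epow (\<integral>\<^sup>+x. f1 x \<partial>lborel) t * epow (\<integral>\<^sup>+x. g1 x \<partial>lborel) u) \<le> ennreal c * (\<integral>\<^sup>+x. h1 x \<partial>lborel)"
    by (rule mult_left_mono) simp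
  also have "ennreal c * (\<integral>\<^sup>+x. h1 x \<partial>lborel) = (\<integral>\<^sup>+x. h x \<partial>lborel)"
    using c by (simp add: d nn_integral_cmult mult.assoc[symmetric] ennreal_mult[symmetric])
  also have "ennreal c * (epow (\<integral>\<^sup>+x. f1 x \<partial>lborel) t * epow (\<integral>\<^sup>+x. g1 x \<partial>lborel) u)
     = epow (ennreal A * (\<integral>\<^sup>+x. f1 x \<partial>lborel)) t * epow (ennreal B * (\<integral>\<^sup>+x. g1 x \<partial>lborel)) u"
    using tu AB by (simp add: epow_mult c_def ennreal_mult ac_simps)
  also have "ennreal A * (\<integral>\<^sup>+x. f1 x \<partial>lborel) = (\<integral>\<^sup>+x. f x \<partial>lborel)"
    using AB by (simp add: d nn_integral_cmult mult.assoc[symmetric] ennreal_mult[symmetric])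
  also have "ennreal B * (\<integral>\<^sup>+x. g1 x \<partial>lborel) = (\<integral>\<^sup>+x. g x \<partial>lborel)"
    using AB by (simp add: d nn_integral_cmult mult.assoc[symmetric] ennreal_mult[symmetric])
  finally show ?thesis .
qed

lemma SUP_min_of_nat_ennreal: "(SUP n::nat. min (x::ennreal) (of_nat n)) = x"
proof (rule antisym)
  show "x \<le> (SUP n::nat. min x (of_nat n))"
  proof (cases "x = \<infinity>")
    case True
    then show ?thesis using ennreal_SUP_of_nat_eq_top by (simp add: min_def top_unique)
  next
    case False
    then obtain n :: nat where "x \<le> of_nat n"
      using ennreal_Ex_less_of_nat[of x] by (auto simp: less_top intro: less_imp_le)
    then show ?thesis by (intro SUP_upper2[of n]) auto
  qed
qed (auto intro: SUP_least)

lemma prekopa_leindler_real: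
  fixes f g h :: "real \<Rightarrow> ennreal"
  assumes [measurable]: "f \<in> borel_measurable borel" "g \<in> borel_measurable borel" "h \<in> borel_measurable borel"
    and tu: "0 < t" "0 < u" "t + u = 1"
    and le: "\<And>x y. epow (f x) t * epow (g y) u \<le> h (t * x + u * y)"
  shows "epow (\<integral>\<^sup>+x. f x \<partial>lborel) t * epow (\<integral>\<^sup>+x. g x \<partial>lborel) u \<le> (\<integral>\<^sup>+x. h x \<partial>lborel)"
proof -
  have int: "(\<integral>\<^sup>+x. p x \<partial>lborel) = (SUP n. \<integral>\<^sup>+x. min (p x) (of_nat n) \<partial>lborel)"
    if [measurable]: "p \<in> borel_measurable borel" for p :: "real \<Rightarrow> ennreal"
  proof -
    have "(SUP n. \<integral>\<^sup>+x. min (p x) (of_nat n) \<partial>lborel) = (\<integral>\<^sup>+x. (SUP n. min (p x) (of_nat n)) \<partial>lborel)"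
      by (intro nn_integral_monotone_convergence_SUP[symmetric])
         (auto simp: incseq_def le_fun_def simp del: min.bounded_iff intro!: min.mono)
    then show ?thesis by (simp add: SUP_min_of_nat_ennreal)
  qed
  show ?thesis
    unfolding int[OF assms(1)] int[OF assms(2)]
  proof (rule epow_geo_SUP_le[OF tu(1,2)])
    fix n :: nat
    have fin: "(SUP x. min (p x) (of_nat n :: ennreal)) < \<infinity>" for p :: "real \<Rightarrow> ennreal"
    proof -
      have "(SUP x. min (p x) (of_nat n :: ennreal)) \<le> of_nat n" by (rule SUP_least) simp
      then show ?thesis by (metis infinity_ennreal_def of_nat_less_top order_le_less_trans)
    qed
    show "epow (\<integral>\<^sup>+x. min (f x) (of_nat n) \<partial>lborel) t * epow (\<integral>\<^sup>+x. min (g x) (of_nat n) \<partial>lborel) u \<le> (\<integral>\<^sup>+x. h x \<partial>lborel)"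
    proof (rule prekopa_leindler_real_bounded[OF _ _ _ tu fin fin])
      fix x y
      have "epow (min (f x) (of_nat n)) t * epow (min (g y) (of_nat n)) u \<le> epow (f x) t * epow (g y) u"
        using tu by (intro mult_mono epow_mono) auto
      then show "epow (min (f x) (of_nat n)) t * epow (min (g y) (of_nat n)) u \<le> h (t * x + u * y)"
        using le order_trans by blast
    qed auto
  qed (auto simp: incseq_def simp del: min.bounded_iff intro!: nn_integral_mono min.mono)
qed

text \<open>Integrating out one coordinate turns \<open>f\<close>, \<open>g\<close>, \<open>h\<close> into
functions that satisfy the hypothesis again, by the one-dimensional inequality; so the dimension can
be raised one coordinate at a time.\<close>

lemma prekopa_leindler_PiM:
  fixes f g h :: "('i \<Rightarrow> real) \<Rightarrow> ennreal"
  assumes "finite I"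
    and "f \<in> borel_measurable (PiM I (\<lambda>_. lborel))" "g \<in> borel_measurable (PiM I (\<lambda>_. lborel))"
      "h \<in> borel_measurable (PiM I (\<lambda>_. lborel))"
    and tu: "0 < t" "0 < u" "t + u = 1"
    and "\<And>x y. x \<in> extensional I \<Longrightarrow> y \<in> extensional I \<Longrightarrow>
        epow (f x) t * epow (g y) u \<le> h (\<lambda>i\<in>I. t * x i + u * y i)"
  shows "epow (integral\<^sup>N (PiM I (\<lambda>_. lborel)) f) t * epow (integral\<^sup>N (PiM I (\<lambda>_. lborel)) g) u
    \<le> integral\<^sup>N (PiM I (\<lambda>_. lborel)) h"
  using assms(1,2,3,4,8)
proof (induction I arbitrary: f g h rule: finite_induct)
  case empty
  interpret product_sigma_finite "\<lambda>_. lborel :: real measure" ..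
  have "(\<lambda>i\<in>{}. c i) = (\<lambda>_. undefined)" for c :: "'i \<Rightarrow> real" by auto
  then show ?case using empty(4)[of "\<lambda>_. undefined" "\<lambda>_. undefined"]
    by (simp add: nn_integral_empty)
next
  case (insert i I)
  interpret product_sigma_finite "\<lambda>_. lborel :: real measure" ..
  note [measurable] = insert.prems(1-3)
  let ?M = "PiM I (\<lambda>_. lborel :: real measure)"
  have upd [measurable]: "(\<lambda>(x, y). p (x(i := y))) \<in> borel_measurable (?M \<Otimes>\<^sub>M lborel)"
    if [measurable]: "p \<in> borel_measurable (PiM (insert i I) (\<lambda>_. lborel))" for p :: "('i \<Rightarrow> real) \<Rightarrow> ennreal"
    by measurable
  have 1: "p \<in> borel_measurable (PiM (insert i I) (\<lambda>_. lborel)) \<Longrightarrow>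
     (\<lambda>x. \<integral>\<^sup>+y. p (x(i := y)) \<partial>lborel) \<in> borel_measurable ?M" for p :: "('i \<Rightarrow> real) \<Rightarrow> ennreal"
    using lborel.borel_measurable_nn_integral_fst[OF upd[of p]] by simp
  have 2: "p \<in> borel_measurable (PiM (insert i I) (\<lambda>_. lborel)) \<Longrightarrow> x \<in> extensional I \<Longrightarrow>
     (\<lambda>y. p (x(i := y))) \<in> borel_measurable borel" for p :: "('i \<Rightarrow> real) \<Rightarrow> ennreal" and x
  proof -
    assume p: "p \<in> borel_measurable (PiM (insert i I) (\<lambda>_. lborel))" and x: "x \<in> extensional I"
    have "x \<in> space ?M" using x by (simp add: space_PiM PiE_def)
    from measurable_Pair2[OF upd[OF p] this] show ?thesis by simp
  qed
  have "epow (\<integral>\<^sup>+x. (\<integral>\<^sup>+y. f (x(i := y)) \<partial>lborel) \<partial>?M) t * epow (\<integral>\<^sup>+x. (\<integral>\<^sup>+y. g (x(i := y)) \<partial>lborel) \<partial>?M) u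
     \<le> (\<integral>\<^sup>+x. (\<integral>\<^sup>+y. h (x(i := y)) \<partial>lborel) \<partial>?M)"
  proof (rule insert.IH)
    fix x y :: "'i \<Rightarrow> real" assume xy: "x \<in> extensional I" "y \<in> extensional I"
    let ?z = "\<lambda>j\<in>I. t * x j + u * y j"
    show "epow (\<integral>\<^sup>+a. f (x(i := a)) \<partial>lborel) t * epow (\<integral>\<^sup>+a. g (y(i := a)) \<partial>lborel) u
        \<le> (\<integral>\<^sup>+a. h (?z(i := a)) \<partial>lborel)"
    proof (rule prekopa_leindler_real[OF 2 2 2 tu])
      fix a b :: real
      have "?z(i := t * a + u * b) = (\<lambda>j\<in>insert i I. t * (x(i := a)) j + u * (y(i := b)) j)"
        using insert.hyps by (auto simp: fun_eq_iff restrict_def)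
      moreover have "x(i := a) \<in> extensional (insert i I)" "y(i := b) \<in> extensional (insert i I)"
        using xy by (auto simp: extensional_def)
      ultimately show "epow (f (x(i := a))) t * epow (g (y(i := b))) u \<le> h (?z(i := t * a + u * b))"
        using insert.prems(4)[of "x(i := a)" "y(i := b)"] by (simp only:)
    qed (use insert.prems xy in \<open>auto simp: extensional_def\<close>)
  qed (fact 1[OF insert.prems(1)] 1[OF insert.prems(2)] 1[OF insert.prems(3)])+
  then show ?case
    using insert.hyps insert.prems by (simp add: product_nn_integral_insert)
qed

theorem prekopa_leindler:
  fixes f g h :: "'a::euclidean_space \<Rightarrow> ennreal"
  assumes [measurable]: "f \<in> borel_measurable borel" "g \<in> borel_measurable borel" "h \<in> borel_measurable borel"
    and tu: "0 < t" "0 < u" "t + u = 1"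
    and le: "\<And>x y. epow (f x) t * epow (g y) u \<le> h (t *\<^sub>R x + u *\<^sub>R y)"
  shows "epow (\<integral>\<^sup>+x. f x \<partial>lborel) t * epow (\<integral>\<^sup>+x. g x \<partial>lborel) u \<le> (\<integral>\<^sup>+x. h x \<partial>lborel)"
proof -
  let ?M = "\<Pi>\<^sub>M b\<in>(Basis :: 'a set). (lborel :: real measure)"
  let ?S = "\<lambda>x. \<Sum>b\<in>Basis. x b *\<^sub>R b :: 'a"
  have [measurable]: "?S \<in> measurable ?M borel" by measurable
  have int: "(\<integral>\<^sup>+x. p x \<partial>lborel) = (\<integral>\<^sup>+x. p (?S x) \<partial>?M)"
    if [measurable]: "p \<in> borel_measurable borel" for p :: "'a \<Rightarrow> ennreal"
    by (subst lborel_eq) (simp add: nn_integral_distr)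
  show ?thesis
    unfolding int[OF assms(1)] int[OF assms(2)] int[OF assms(3)]
  proof (rule prekopa_leindler_PiM[OF _ _ _ _ tu])
    fix x y :: "'a \<Rightarrow> real"
    have "?S (\<lambda>i\<in>Basis. t * x i + u * y i) = t *\<^sub>R ?S x + u *\<^sub>R ?S y"
      by (simp add: scaleR_sum_right sum.distrib scaleR_add_left)
    with le[of "?S x" "?S y"] show "epow (f (?S x)) t * epow (g (?S y)) u \<le> h (?S (\<lambda>i\<in>Basis. t * x i + u * y i))"
      by simp
  qed measurable
qed

section \<open>Log-concave functions and their Lipschitz regularization\<close>

text \<open>Log-concavity of a nonnegative function, that is, convexity of \<open>- ln w\<close> with values in
\<open>(-\<infinity>, \<infinity>]\<close>. Nothing is required when one of the two values vanishes,
because \<open>0 powr t = 0\<close>.\<close>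

definition log_concave :: "('a::real_vector \<Rightarrow> real) \<Rightarrow> bool" where
  "log_concave w \<longleftrightarrow> (\<forall>x. 0 \<le> w x) \<and>
     (\<forall>x y t u. 0 < t \<longrightarrow> 0 < u \<longrightarrow> t + u = 1 \<longrightarrow> w x powr t * w y powr u \<le> w (t *\<^sub>R x + u *\<^sub>R y))"

lemma log_concaveI:
  fixes w :: "'a::real_vector \<Rightarrow> real"
  assumes "\<And>x. 0 \<le> w x"
    and "\<And>x y t u. 0 < t \<Longrightarrow> 0 < u \<Longrightarrow> t + u = 1 \<Longrightarrow> 0 < w x \<Longrightarrow> 0 < w y \<Longrightarrow>
      w x powr t * w y powr u \<le> w (t *\<^sub>R x + u *\<^sub>R y)"
  shows "log_concave w"
  unfolding log_concave_def
proof (intro conjI allI impI)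
  fix x y :: 'a and t u :: real assume "0 < t" "0 < u" "t + u = 1"
  then show "w x powr t * w y powr u \<le> w (t *\<^sub>R x + u *\<^sub>R y)"
    using assms(1)[of x] assms(1)[of y] assms(1)[of "t *\<^sub>R x + u *\<^sub>R y"] assms(2)[of t u x y]
    by (cases "0 < w x"; cases "0 < w y") (auto simp: less_le)
qed (fact assms(1))

lemma log_concave_nonneg: "log_concave w \<Longrightarrow> 0 \<le> w x"
  by (simp add: log_concave_def)

lemma log_concaveD:
  "log_concave w \<Longrightarrow> 0 < t \<Longrightarrow> 0 < u \<Longrightarrow> t + u = 1 \<Longrightarrow> w x powr t * w y powr u \<le> w (t *\<^sub>R x + u *\<^sub>R y)"
  by (simp add: log_concave_def)

lemma log_concave_pos:
  assumes "log_concave w" "0 < t" "0 < u" "t + u = 1" "0 < w x" "0 < w y"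
  shows "0 < w (t *\<^sub>R x + u *\<^sub>R y)"
proof -
  have "0 < w x powr t * w y powr u" using assms by simp
  also have "\<dots> \<le> w (t *\<^sub>R x + u *\<^sub>R y)" using assms by (intro log_concaveD)
  finally show ?thesis .
qed

lemma log_concave_support_convex:
  assumes "log_concave w" shows "convex {x. 0 < w x}"
proof (rule convexI)
  fix x y and u v :: real
  assume "x \<in> {x. 0 < w x}" "y \<in> {x. 0 < w x}" "0 \<le> u" "0 \<le> v" "u + v = 1"
  then show "u *\<^sub>R x + v *\<^sub>R y \<in> {x. 0 < w x}"
    using log_concave_pos[OF assms, of u v x y] by (cases "u = 0"; cases "v = 0") auto
qed

lemma log_concave_imp_convex_on:
  assumes w: "log_concave w" and S: "convex S" "\<And>x. x \<in> S \<Longrightarrow> 0 < w x"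
  shows "convex_on S (\<lambda>x. - ln (w x))"
proof (rule convex_onI)
  fix t :: real and x y assume t: "0 < t" "t < 1" and xy: "x \<in> S" "y \<in> S"
  let ?z = "(1 - t) *\<^sub>R x + t *\<^sub>R y"
  have p: "0 < w x" "0 < w y" using S xy by auto
  have z: "0 < w ?z" using t p by (intro log_concave_pos[OF w]) auto
  have "ln (w x powr (1 - t) * w y powr t) \<le> ln (w ?z)"
    using t p z by (subst ln_le_cancel_iff) (auto intro!: log_concaveD[OF w])
  then show "- ln (w ?z) \<le> (1 - t) * - ln (w x) + t * - ln (w y)"
    using p by (simp add: ln_mult ln_powr)
qed fact

lemma log_concave_exp_neg:
  fixes h :: "'a::real_vector \<Rightarrow> real"
  assumes "convex_on UNIV h" shows "log_concave (\<lambda>x. exp (- h x))"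
proof (rule log_concaveI)
  fix x y :: 'a and t u :: real assume tu: "0 < t" "0 < u" "t + u = 1"
  have "h (t *\<^sub>R x + u *\<^sub>R y) \<le> t * h x + u * h y"
    using assms tu by (auto simp: convex_on_def)
  then show "exp (- h x) powr t * exp (- h y) powr u \<le> exp (- h (t *\<^sub>R x + u *\<^sub>R y))"
    by (simp add: powr_def exp_add[symmetric])
qed simp

text \<open>Around an interior point \<open>y\<close> of the support there is a ball of radius \<open>r\<close>
on which \<open>w \<ge> w y / 2\<close>. The point \<open>y\<close> lies between any
\<open>z\<close> and the point \<open>y'\<close> of this ball opposite to \<open>z\<close>;
log-concavity along this segment bounds \<open>w z\<close> in terms of \<open>w y\<close> and
\<open>w y'\<close>, hence of \<open>w y\<close>.\<close>

lemma log_concave_growth: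
  fixes w :: "'a::euclidean_space \<Rightarrow> real"
  assumes w: "log_concave w" and y: "y \<in> interior {x. 0 < w x}"
  obtains K where "0 \<le> K" "\<And>z. w z \<le> w y * exp (K * norm (z - y))"
proof -
  let ?D = "interior {x. 0 < w x}"
  have pos: "0 < w x" if "x \<in> ?D" for x using that interior_subset by auto
  have "continuous_on ?D (\<lambda>x. - ln (w x))"
    by (intro convex_on_continuous log_concave_imp_convex_on w convex_interior
        log_concave_support_convex pos) auto
  then have "continuous_on ?D (\<lambda>x. exp (- (- ln (w x))))" by (rule continuous_on_exp[OF continuous_on_minus])
  moreover have "exp (- (- ln (w x))) = w x" if "x \<in> ?D" for x using pos[OF that] by simp
  ultimately have "continuous_on ?D w" by (rule continuous_on_eq)
  then have "isCont w y" using y by (simp add: continuous_on_eq_continuous_at)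
  then have "eventually (\<lambda>x. w y / 2 < w x) (at y)"
    using pos[OF y] by (intro order_tendstoD(1)[of w "w y"]) (auto simp: isCont_def)
  then obtain d where d: "0 < d" "\<And>x. x \<noteq> y \<Longrightarrow> dist x y < d \<Longrightarrow> w y / 2 < w x"
    by (auto simp: eventually_at)
  define r where "r = d / 2"
  have "0 < r" using d by (simp add: r_def)
  moreover have "w y / 2 \<le> w x" if "dist x y \<le> r" for x
    using d(1) d(2)[of x] that pos[OF y] by (cases "x = y") (auto simp: r_def)
  ultimately have r: "0 < r" "\<And>x. dist x y \<le> r \<Longrightarrow> w y / 2 \<le> w x" by auto
  show ?thesis
  proof (rule that[of "ln 2 / r"])
    fix z
    show "w z \<le> w y * exp (ln 2 / r * norm (z - y))"
    proof (cases "z = y \<or> w z \<le> 0")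
      case True
      then show ?thesis using pos[OF y] by (auto intro: order_trans)
    next
      case False
      define \<delta> where "\<delta> = norm (z - y)"
      have \<delta>: "0 < \<delta>" "0 < w z" using False by (auto simp: \<delta>_def)
      define l where "l = r / (r + \<delta>)"
      have l: "0 < l" "0 < 1 - l" "l + (1 - l) = 1" "1 - l = l * (\<delta> / r)"
      proof -
        have "0 < r + \<delta>" using r(1) \<delta>(1) by simp
        moreover from this have "1 - l = \<delta> / (r + \<delta>)" by (simp add: l_def field_simps)
        ultimately show "0 < l" "0 < 1 - l" "1 - l = l * (\<delta> / r)"
          using r(1) \<delta>(1) by (simp_all add: l_def)
      qed simp
      define y' where "y' = y - (r / \<delta>) *\<^sub>R (z - y)"
      have "dist y' y \<le> r" using \<delta> r by (simp add: y'_def dist_norm \<delta>_def)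
      then have y': "w y / 2 \<le> w y'" using r by auto
      have "(1 - l) * (r / \<delta>) = l" unfolding l(4) using r(1) \<delta>(1) by simp
      then have "(1 - l) *\<^sub>R (r / \<delta>) *\<^sub>R (z - y) = l *\<^sub>R (z - y)" by simp
      then have comb: "l *\<^sub>R z + (1 - l) *\<^sub>R y' = y"
        unfolding y'_def by (simp add: scaleR_diff_right algebra_simps)
      have "w z powr l * (w y / 2) powr (1 - l) \<le> w z powr l * w y' powr (1 - l)"
        using y' l pos[OF y] by (intro mult_left_mono powr_mono2) auto
      also have "\<dots> \<le> w y" using log_concaveD[OF w l(1-3), of z y'] comb by simp
      finally have "ln (w z powr l * (w y / 2) powr (1 - l)) \<le> ln (w y)"
        using \<delta> pos[OF y] by (subst ln_le_cancel_iff) auto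
      then have "l * ln (w z) + (1 - l) * (ln (w y) - ln 2) \<le> ln (w y)"
        using \<delta> pos[OF y] by (simp add: ln_mult ln_powr ln_div)
      then have "l * ln (w z) \<le> l * ln (w y) + (1 - l) * ln 2" by (simp add: algebra_simps)
      also have "\<dots> = l * (ln (w y) + (\<delta> / r) * ln 2)" unfolding l(4) by (simp add: algebra_simps)
      finally have "ln (w z) \<le> ln (w y) + (\<delta> / r) * ln 2" using l(1) by simp
      then have "exp (ln (w z)) \<le> exp (ln (w y) + (\<delta> / r) * ln 2)" by simp
      then show ?thesis using \<delta> pos[OF y] by (simp add: exp_add \<delta>_def[symmetric] mult.commute)
    qed
  qed (use r in auto)
qed

text \<open>The function \<open>- ln (sup_conv w k)\<close> is the infimal convolution of \<open>- ln w\<close>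
with \<open>k\<close> times the norm.\<close>

definition sup_conv :: "('a::real_normed_vector \<Rightarrow> real) \<Rightarrow> real \<Rightarrow> 'a \<Rightarrow> real" where
  "sup_conv w k y = (SUP z. w z * exp (- k * norm (y - z)))"

text \<open>The approximations are \<open>h n = - ln (sup_conv w (K + n))\<close>, where \<open>K\<close> is the
growth rate of \<open>w\<close> around one interior point, so that the suprema are finite. At an
interior point of the support the sequence is eventually constant by the growth bound there, and at
a positive distance from the support \<open>exp (- h n y)\<close> decays geometrically. Only the
frontier of the support remains, which is a null set because the support is convex.\<close>

lemma log_concave_regularization:
  fixes w :: "'a::euclidean_space \<Rightarrow> real"
  assumes w: "log_concave w" and ne: "interior {x. 0 < w x} \<noteq> {}"
  obtains h :: "nat \<Rightarrow> 'a \<Rightarrow> real" and A K where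
    "\<And>n. convex_on UNIV (h n)" "\<And>y. incseq (\<lambda>n. h n y)" "0 \<le> K"
    "\<And>n y. - A - K * norm y \<le> h n y" "\<And>n y. w y \<le> exp (- h n y)"
    "AE y in lborel. (\<lambda>n. exp (- h n y)) \<longlonglongrightarrow> w y"
proof -
  obtain y0 where y0: "y0 \<in> interior {x. 0 < w x}" using ne by auto
  then have wy0: "0 < w y0" using interior_subset by auto
  from log_concave_growth[OF w y0] obtain K where
    K: "0 \<le> K" "\<And>z. w z \<le> w y0 * exp (K * norm (z - y0))" by auto
  have nn: "0 \<le> w x" for x by (rule log_concave_nonneg[OF w])
  have bound: "w z * exp (- k * norm (y - z)) \<le> w y0 * exp (K * norm (y - y0)) * exp ((K - k) * norm (y - z))"
    for k y z
  proof -
    have "norm (z - y0) \<le> norm (y - y0) + norm (y - z)"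
      using norm_triangle_ineq4[of "y - y0" "y - z"] by simp
    then have "K * norm (z - y0) \<le> K * norm (y - y0) + K * norm (y - z)"
      using K(1) by (metis mult_left_mono distrib_left)
    then have "w y0 * exp (K * norm (z - y0)) \<le> w y0 * (exp (K * norm (y - y0)) * exp (K * norm (y - z)))"
      using wy0 by (intro mult_left_mono) (auto simp: exp_add[symmetric])
    with K(2)[of z] have "w z \<le> w y0 * (exp (K * norm (y - y0)) * exp (K * norm (y - z)))" by linarith
    then have "w z * exp (- k * norm (y - z)) \<le>
       w y0 * (exp (K * norm (y - y0)) * exp (K * norm (y - z))) * exp (- k * norm (y - z))"
      by (rule mult_right_mono) simp
    also have "\<dots> = w y0 * exp (K * norm (y - y0)) * exp ((K - k) * norm (y - z))"
      by (simp add: mult.assoc exp_add[symmetric] algebra_simps)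
    finally show ?thesis .
  qed
  define s where "s = sup_conv w"
  have bdd: "bdd_above (range (\<lambda>z. w z * exp (- k * norm (y - z))))" if "K \<le> k" for k y
  proof (rule bdd_aboveI2)
    fix z
    have "exp ((K - k) * norm (y - z)) \<le> 1" using that by (simp add: mult_nonpos_nonneg)
    then have "w y0 * exp (K * norm (y - y0)) * exp ((K - k) * norm (y - z)) \<le> w y0 * exp (K * norm (y - y0)) * 1"
      using wy0 by (intro mult_left_mono) auto
    then show "w z * exp (- k * norm (y - z)) \<le> w y0 * exp (K * norm (y - y0))"
      using bound[of z k y] by simp
  qed
  have upper: "w z * exp (- k * norm (y - z)) \<le> s k y" if "K \<le> k" for k y z
    unfolding s_def sup_conv_def by (rule cSUP_upper[OF _ bdd[OF that]]) simp
  have s_ge: "w y \<le> s k y" if "K \<le> k" for k y using upper[OF that, of y y] by simp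
  have s_pos: "0 < s k y" if "K \<le> k" for k y
    using upper[OF that, of y0 y] wy0 by (smt (verit) exp_gt_zero mult_pos_pos)
  have s_le: "s k y \<le> c" if "\<And>z. w z * exp (- k * norm (y - z)) \<le> c" for k y c
    unfolding s_def sup_conv_def by (rule cSUP_least) (use that in auto)
  have s_anti: "s k' y \<le> s k y" if "K \<le> k" "k \<le> k'" for k k' y
  proof (rule s_le)
    fix z
    have "w z * exp (- k' * norm (y - z)) \<le> w z * exp (- k * norm (y - z))"
      using that nn by (intro mult_left_mono) (auto simp: mult_right_mono)
    also have "\<dots> \<le> s k y" by (rule upper) fact
    finally show "w z * exp (- k' * norm (y - z)) \<le> s k y" .
  qed
  have s_lc: "log_concave (s k)" if k: "K \<le> k" "0 \<le> k" for k
  proof (rule log_concaveI)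
    show "0 \<le> s k x" for x using s_pos[OF k(1), of x] by simp
  next
    fix x y :: 'a and t u :: real assume tu: "0 < t" "0 < u" "t + u = 1"
    let ?m = "t *\<^sub>R x + u *\<^sub>R y"
    have "t * ln (s k x) + u * ln (s k y) \<le> ln (s k ?m)"
    proof (rule field_le_epsilon)
      fix e :: real assume e: "0 < e"
      have near: "\<exists>z. s k v * exp (-e) < w z * exp (- k * norm (v - z))" for v
      proof -
        have "s k v * exp (-e) < s k v" using s_pos[OF k(1), of v] e by simp
        then show ?thesis unfolding s_def sup_conv_def
          by (subst (asm) less_cSUP_iff) (use bdd[OF k(1)] in auto)
      qed
      obtain a b where a: "s k x * exp (-e) < w a * exp (- k * norm (x - a))"
        and b: "s k y * exp (-e) < w b * exp (- k * norm (y - b))" using near by metis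
      have "0 < s k x * exp (-e)" "0 < s k y * exp (-e)" using s_pos[OF k(1)] by auto
      with a b have "w a \<noteq> 0" "w b \<noteq> 0" by auto
      then have wab: "0 < w a" "0 < w b" using nn[of a] nn[of b] by linarith+
      let ?c = "t *\<^sub>R a + u *\<^sub>R b"
      have wc: "0 < w ?c" by (rule log_concave_pos[OF w tu wab])
      have "ln (w a powr t * w b powr u) \<le> ln (w ?c)"
        using wab wc log_concaveD[OF w tu, of a b] by (subst ln_le_cancel_iff) auto
      then have 1: "t * ln (w a) + u * ln (w b) \<le> ln (w ?c)"
        using wab by (simp add: ln_mult ln_powr)
      \<comment> \<open>\<open>a\<close> and \<open>b\<close> almost attain the suprema at \<open>x\<close> and \<open>y\<close>, so \<open>?c\<close> is a competitor at \<open>?m\<close>\<close>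
      have "?m - ?c = t *\<^sub>R (x - a) + u *\<^sub>R (y - b)" by (simp add: algebra_simps)
      then have "norm (?m - ?c) \<le> norm (t *\<^sub>R (x - a)) + norm (u *\<^sub>R (y - b))"
        using norm_triangle_ineq by metis
      then have "norm (?m - ?c) \<le> t * norm (x - a) + u * norm (y - b)"
        using tu by simp
      then have 2: "k * norm (?m - ?c) \<le> k * (t * norm (x - a) + u * norm (y - b))"
        using k by (intro mult_left_mono) auto
      have "ln (s k x * exp (-e)) \<le> ln (w a * exp (- k * norm (x - a)))"
        using a s_pos[OF k(1), of x] wab by (subst ln_le_cancel_iff) auto
      then have A: "ln (s k x) - e \<le> ln (w a) - k * norm (x - a)"
        using s_pos[OF k(1), of x] wab by (simp add: ln_mult)
      have "ln (s k y * exp (-e)) \<le> ln (w b * exp (- k * norm (y - b)))"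
        using b s_pos[OF k(1), of y] wab by (subst ln_le_cancel_iff) auto
      then have B: "ln (s k y) - e \<le> ln (w b) - k * norm (y - b)"
        using s_pos[OF k(1), of y] wab by (simp add: ln_mult)
      have "t * (ln (s k x) - e) + u * (ln (s k y) - e) \<le>
         t * (ln (w a) - k * norm (x - a)) + u * (ln (w b) - k * norm (y - b))"
        using A B tu by (intro add_mono mult_left_mono) auto
      also have "\<dots> \<le> ln (w ?c) - k * norm (?m - ?c)" using 1 2 by (simp add: algebra_simps)
      also have "\<dots> = ln (w ?c * exp (- k * norm (?m - ?c)))" using wc by (simp add: ln_mult)
      also have "\<dots> \<le> ln (s k ?m)"
        using upper[OF k(1), of ?c ?m] wc s_pos[OF k(1)] by (subst ln_le_cancel_iff) auto
      finally have "t * ln (s k x) + u * ln (s k y) - (t + u) * e \<le> ln (s k ?m)"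
        by (simp add: algebra_simps)
      then show "t * ln (s k x) + u * ln (s k y) \<le> ln (s k ?m) + e" using tu by simp
    qed
    then have "exp (t * ln (s k x) + u * ln (s k y)) \<le> exp (ln (s k ?m))" by simp
    then show "s k x powr t * s k y powr u \<le> s k ?m"
      using s_pos[OF k(1), of x] s_pos[OF k(1), of y] s_pos[OF k(1), of ?m] by (simp add: powr_def exp_add)
  qed
  define h where "h n y = - ln (s (K + real n) y)" for n y
  have exp_h: "exp (- h n y) = s (K + real n) y" for n y
    using s_pos[of "K + real n" y] by (simp add: h_def)
  show ?thesis
  proof (rule that[of h K "ln (w y0) + K * norm y0"])
    show "convex_on UNIV (h n)" for n
      unfolding h_def using K by (intro log_concave_imp_convex_on s_lc s_pos) auto
    show "incseq (\<lambda>n. h n y)" for y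
      unfolding h_def incseq_def using s_anti s_pos by simp
    show "0 \<le> K" by fact
    show "w y \<le> exp (- h n y)" for n y using s_ge by (simp add: exp_h)
    show "- (ln (w y0) + K * norm y0) - K * norm y \<le> h n y" for n y
    proof -
      have "s (K + real n) y \<le> w y0 * exp (K * norm (y - y0))"
      proof (rule s_le)
        fix z
        have "exp ((K - (K + real n)) * norm (y - z)) \<le> 1" by simp
        then have "w y0 * exp (K * norm (y - y0)) * exp ((K - (K + real n)) * norm (y - z)) \<le> w y0 * exp (K * norm (y - y0)) * 1"
          using wy0 by (intro mult_left_mono) auto
        then show "w z * exp (- (K + real n) * norm (y - z)) \<le> w y0 * exp (K * norm (y - y0))"
          using bound[of z "K + real n" y] by linarith
      qed
      then have "ln (s (K + real n) y) \<le> ln (w y0 * exp (K * norm (y - y0)))"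
        using s_pos[of "K + real n" y] wy0 by (subst ln_le_cancel_iff) auto
      also have "\<dots> = ln (w y0) + K * norm (y - y0)" using wy0 by (simp add: ln_mult)
      also have "K * norm (y - y0) \<le> K * (norm y + norm y0)"
        using K(1) by (intro mult_left_mono norm_triangle_ineq4)
      finally show ?thesis by (simp add: h_def algebra_simps)
    qed
    have N: "frontier {x. 0 < w x} \<in> null_sets lebesgue"
      using negligible_convex_frontier[OF log_concave_support_convex[OF w]] by (simp add: negligible_iff_null_sets)
    have "AE y in lebesgue. (\<lambda>n. exp (- h n y)) \<longlonglongrightarrow> w y"
    proof (rule AE_I'[OF N], rule subsetI, rule ccontr)
      fix y assume *: "y \<in> {y \<in> space lebesgue. \<not> (\<lambda>n. exp (- h n y)) \<longlonglongrightarrow> w y}" "y \<notin> frontier {x. 0 < w x}"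
      then consider "y \<in> interior {x. 0 < w x}" | "y \<notin> closure {x. 0 < w x}"
        by (auto simp: frontier_def)
      then have "(\<lambda>n. s (K + real n) y) \<longlonglongrightarrow> w y"
      proof cases
        case 1
        from log_concave_growth[OF w this] obtain K' where
          K': "0 \<le> K'" "\<And>z. w z \<le> w y * exp (K' * norm (z - y))" by auto
        have "w y > 0" using 1 interior_subset by auto
        have "eventually (\<lambda>n. s (K + real n) y = w y) sequentially"
          using eventually_ge_at_top[of "nat \<lceil>K'\<rceil>"]
        proof eventually_elim
          case (elim n)
          then have n: "K' \<le> real n" by linarith
          have "s (K + real n) y \<le> w y"
          proof (rule s_le)
            fix z
            have "w z * exp (- (K + real n) * norm (y - z)) \<le> (w y * exp (K' * norm (z - y))) * exp (- (K + real n) * norm (y - z))"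
              using K' by (intro mult_right_mono) auto
            also have "\<dots> = w y * exp ((K' - (K + real n)) * norm (y - z))"
              by (simp add: mult.assoc exp_add[symmetric] norm_minus_commute[of z y] algebra_simps)
            also have "\<dots> \<le> w y * 1"
              using K n \<open>w y > 0\<close> by (intro mult_left_mono) (auto simp: mult_nonpos_nonneg)
            finally show "w z * exp (- (K + real n) * norm (y - z)) \<le> w y" by simp
          qed
          then show ?case using s_ge[of "K + real n" y] by simp
        qed
        then show ?thesis by (rule tendsto_eventually)
      next
        case 2
        then have "open (- closure {x. 0 < w x})" "y \<in> - closure {x. 0 < w x}" by auto
        then obtain d where d: "0 < d" "ball y d \<subseteq> - closure {x. 0 < w x}"
          using open_contains_ball by metis
        have w0: "w z = 0" if "norm (y - z) < d" for z
        proof -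
          have "z \<in> ball y d" using that by (simp add: dist_norm)
          with d have "z \<notin> closure {x. 0 < w x}" by auto
          then have "\<not> 0 < w z" using subsetD[OF closure_subset, of z "{x. 0 < w x}"] by auto
          then show ?thesis using nn[of z] by simp
        qed
        have up: "s (K + real n) y \<le> w y0 * exp (K * norm (y - y0)) * exp (- d) ^ n" for n
        proof (rule s_le)
          fix z
          show "w z * exp (- (K + real n) * norm (y - z)) \<le> w y0 * exp (K * norm (y - y0)) * exp (- d) ^ n"
          proof (cases "norm (y - z) < d")
            case True
            then show ?thesis using w0 wy0 by simp
          next
            case False
            then have "exp ((K - (K + real n)) * norm (y - z)) \<le> exp (real n * (- d))"
              by (simp add: mult_left_mono)
            also have "\<dots> = exp (- d) ^ n" by (rule exp_of_nat_mult)
            finally have "w y0 * exp (K * norm (y - y0)) * exp ((K - (K + real n)) * norm (y - z)) \<le> w y0 * exp (K * norm (y - y0)) * exp (- d) ^ n"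
              using wy0 by (intro mult_left_mono) auto
            then show ?thesis using bound[of z "K + real n" y] by linarith
          qed
        qed
        have lim: "(\<lambda>n. w y0 * exp (K * norm (y - y0)) * exp (- d) ^ n) \<longlonglongrightarrow> w y0 * exp (K * norm (y - y0)) * 0"
          using d by (intro tendsto_mult LIMSEQ_realpow_zero tendsto_const) auto
        have "(\<lambda>n. s (K + real n) y) \<longlonglongrightarrow> 0"
        proof (rule tendsto_sandwich[OF _ _ tendsto_const])
          show "\<forall>\<^sub>F n in sequentially. 0 \<le> s (K + real n) y"
            using s_pos by (intro always_eventually allI less_imp_le) auto
          show "\<forall>\<^sub>F n in sequentially. s (K + real n) y \<le> w y0 * exp (K * norm (y - y0)) * exp (- d) ^ n"
            by (intro always_eventually allI up)
        qed (use lim in simp)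
        moreover have "w y = 0" using w0[of y] d by simp
        ultimately show ?thesis by simp
      qed
      then show False using * by (simp add: exp_h)
    qed
    then show "AE y in lborel. (\<lambda>n. exp (- h n y)) \<longlonglongrightarrow> w y"
      by (simp add: AE_completion_iff)
  qed
qed

lemma log_concave_interior_support:
  fixes w :: "'a::euclidean_space \<Rightarrow> real"
  assumes w: "log_concave w" and nz: "\<not> (AE x in lborel. w x = 0)"
  shows "interior {x. 0 < w x} \<noteq> {}"
proof
  assume e: "interior {x. 0 < w x} = {}"
  have "frontier {x. 0 < w x} \<in> null_sets lebesgue"
    using negligible_convex_frontier[OF log_concave_support_convex[OF w]] by (simp add: negligible_iff_null_sets)
  moreover have "{x \<in> space lebesgue. w x \<noteq> 0} \<subseteq> frontier {x. 0 < w x}"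
    using e closure_subset[of "{x. 0 < w x}"] log_concave_nonneg[OF w] by (auto simp: frontier_def less_le)
  ultimately have "AE x in lebesgue. w x = 0" by (rule AE_I')
  then show False using nz by (simp add: AE_completion_iff)
qed

lemma exp_neg_incseq_limit:
  fixes h :: "nat \<Rightarrow> 'a \<Rightarrow> real"
  assumes "\<And>y. incseq (\<lambda>n. h n y)"
  obtains v where "\<And>y. (\<lambda>n. exp (- h n y)) \<longlonglongrightarrow> v y"
proof -
  have "\<exists>l. (\<lambda>n. exp (- h n y)) \<longlonglongrightarrow> l" for y
  proof -
    have "decseq (\<lambda>n. exp (- h n y))" using assms[of y] by (auto simp: incseq_def decseq_def)
    then show ?thesis by (rule decseq_convergent[of _ 0]) auto
  qed
  then show ?thesis using that by metis
qed

text \<open>A log-concave function can be arbitrary, hence nonmeasurable, on the frontier of its support. The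
limit of the regularizations is a Borel version.\<close>

lemma log_concave_AE_eq_borel:
  fixes w :: "'a::euclidean_space \<Rightarrow> real"
  assumes w: "log_concave w" and nz: "\<not> (AE x in lborel. w x = 0)"
  obtains w' where "log_concave w'" "w' \<in> borel_measurable borel" "AE x in lborel. w x = w' x"
proof -
  obtain h :: "nat \<Rightarrow> 'a \<Rightarrow> real" and A K where
    h: "\<And>n. convex_on UNIV (h n)" "\<And>y. incseq (\<lambda>n. h n y)"
    "AE y in lborel. (\<lambda>n. exp (- h n y)) \<longlonglongrightarrow> w y"
    using log_concave_regularization[OF w log_concave_interior_support[OF w nz], of thesis] by blast
  have [measurable]: "h n \<in> borel_measurable borel" for n
    by (intro borel_measurable_continuous_onI convex_on_continuous h(1)) auto
  obtain w' where lim: "\<And>y. (\<lambda>n. exp (- h n y)) \<longlonglongrightarrow> w' y"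
    by (rule exp_neg_incseq_limit[of h]) (use h(2) in auto)
  show ?thesis
  proof (rule that[of w'])
    show "w' \<in> borel_measurable borel" by (rule borel_measurable_LIMSEQ_real[OF lim]) measurable
    show "AE x in lborel. w x = w' x"
      using h(3) by eventually_elim (metis lim LIMSEQ_unique)
    show "log_concave w'"
    proof (rule log_concaveI)
      show nn: "0 \<le> w' x" for x by (rule LIMSEQ_le_const[OF lim]) auto
      fix x y :: 'a and t u :: real assume tu: "0 < t" "0 < u" "t + u = 1" and p: "0 < w' x" "0 < w' y"
      show "w' x powr t * w' y powr u \<le> w' (t *\<^sub>R x + u *\<^sub>R y)"
      proof (rule LIMSEQ_le)
        show "(\<lambda>n. exp (- h n x) powr t * exp (- h n y) powr u) \<longlonglongrightarrow> w' x powr t * w' y powr u"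
          using p by (intro tendsto_mult tendsto_powr lim tendsto_const) auto
        show "(\<lambda>n. exp (- h n (t *\<^sub>R x + u *\<^sub>R y))) \<longlonglongrightarrow> w' (t *\<^sub>R x + u *\<^sub>R y)" by (rule lim)
        show "\<exists>N. \<forall>n\<ge>N. exp (- h n x) powr t * exp (- h n y) powr u \<le> exp (- h n (t *\<^sub>R x + u *\<^sub>R y))"
          using log_concaveD[OF log_concave_exp_neg[OF h(1)] tu] by auto
      qed
    qed
  qed
qed

section \<open>Gaussian averages and the reference measure\<close>

lemma measurable_epow [measurable]:
  assumes [measurable]: "f \<in> borel_measurable M"
  shows "(\<lambda>x. epow (f x) t) \<in> borel_measurable M"
  unfolding epow_def by measurable

lemma nn_integral_holder_epow:
  assumes [measurable]: "f \<in> borel_measurable M" "g \<in> borel_measurable M"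
    and tu: "0 < t" "0 < u" "t + u = 1"
  shows "(\<integral>\<^sup>+x. epow (f x) t * epow (g x) u \<partial>M) \<le> epow (\<integral>\<^sup>+x. f x \<partial>M) t * epow (\<integral>\<^sup>+x. g x \<partial>M) u"
proof -
  consider "(\<integral>\<^sup>+x. f x \<partial>M) = 0 \<or> (\<integral>\<^sup>+x. g x \<partial>M) = 0"
    | "(\<integral>\<^sup>+x. f x \<partial>M) \<noteq> 0" "(\<integral>\<^sup>+x. g x \<partial>M) \<noteq> 0" "(\<integral>\<^sup>+x. f x \<partial>M) = \<infinity> \<or> (\<integral>\<^sup>+x. g x \<partial>M) = \<infinity>"
    | A B where "(\<integral>\<^sup>+x. f x \<partial>M) = ennreal A" "(\<integral>\<^sup>+x. g x \<partial>M) = ennreal B" "0 < A" "0 < B"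
    by (cases "\<integral>\<^sup>+x. f x \<partial>M"; cases "\<integral>\<^sup>+x. g x \<partial>M") (auto simp: less_le)
  then show ?thesis
  proof cases
    case 1
    then have "(AE x in M. f x = 0) \<or> (AE x in M. g x = 0)" by (simp add: nn_integral_0_iff_AE)
    then have "AE x in M. epow (f x) t * epow (g x) u = 0" by auto
    then have "(\<integral>\<^sup>+x. epow (f x) t * epow (g x) u \<partial>M) = 0" by (subst nn_integral_0_iff_AE) auto
    then show ?thesis by simp
  next
    case 2
    have "epow x v \<noteq> 0" if "x \<noteq> 0" "0 < v" for x v using that by (cases x) auto
    then show ?thesis using 2 tu by (auto simp: ennreal_mult_eq_top_iff top_unique)
  next
    case 3
    define c where "c = A powr t * B powr u"
    have c: "0 < c" using 3 by (simp add: c_def)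
    have "(\<integral>\<^sup>+x. epow (f x) t * epow (g x) u \<partial>M)
       \<le> (\<integral>\<^sup>+x. ennreal (c * t / A) * f x + ennreal (c * u / B) * g x \<partial>M)"
    proof (rule nn_integral_mono)
      fix x
      have f: "f x = ennreal A * (ennreal (1 / A) * f x)" and g: "g x = ennreal B * (ennreal (1 / B) * g x)"
        using 3 by (simp_all add: mult.assoc[symmetric] ennreal_mult[symmetric])
      have "epow (f x) t * epow (g x) u = ennreal c * (epow (ennreal (1/A) * f x) t * epow (ennreal (1/B) * g x) u)"
        using 3 tu by (subst f, subst g) (simp add: epow_mult[of _ "ennreal A"] epow_mult[of _ "ennreal B"] c_def ennreal_mult ac_simps)
      also have "\<dots> \<le> ennreal c * (ennreal t * (ennreal (1/A) * f x) + ennreal u * (ennreal (1/B) * g x))"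
        by (intro mult_left_mono epow_arith_geo tu) simp
      also have "\<dots> = ennreal (c * t / A) * f x + ennreal (c * u / B) * g x"
        using 3 tu c by (simp add: distrib_left mult.assoc[symmetric] ennreal_mult[symmetric])
      finally show "epow (f x) t * epow (g x) u \<le> \<dots>" .
    qed
    also have "\<dots> = ennreal (c * t / A) * ennreal A + ennreal (c * u / B) * ennreal B"
      using 3 by (simp add: nn_integral_add nn_integral_cmult)
    also have "\<dots> = ennreal (c * (t + u))"
      using 3 tu c by (simp add: ennreal_mult[symmetric] ennreal_plus[symmetric] distrib_left[symmetric] del: ennreal_plus)
    also have "\<dots> = epow (\<integral>\<^sup>+x. f x \<partial>M) t * epow (\<integral>\<^sup>+x. g x \<partial>M) u"
      using 3 tu by (simp add: c_def ennreal_mult)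
    finally show ?thesis .
  qed
qed

definition gauss_density :: "'a::euclidean_space \<Rightarrow> real" where
  "gauss_density x = (1 / sqrt (2 * pi)) ^ DIM('a) * exp (- (norm x)\<^sup>2 / 2)"

lemma gauss_density_pos: "0 < gauss_density x"
  by (simp add: gauss_density_def)

lemma measurable_gauss_density [measurable]: "gauss_density \<in> borel_measurable borel"
  unfolding gauss_density_def by measurable

lemma prod_std_normal_density:
  "(\<Prod>b\<in>Basis. std_normal_density (x \<bullet> b)) = gauss_density (x::'a::euclidean_space)"
proof -
  have "(\<Sum>b\<in>Basis. (x \<bullet> b)\<^sup>2) = (norm x)\<^sup>2"
    unfolding power2_norm_eq_inner euclidean_inner[of x x] by (simp only: power2_eq_square)
  then have "(\<Prod>b\<in>Basis. exp (- (x \<bullet> b)\<^sup>2 / 2)) = exp (- (norm x)\<^sup>2 / 2)"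
    by (simp add: exp_sum[symmetric] sum_negf sum_divide_distrib[symmetric])
  then show ?thesis
    by (simp add: gauss_density_def std_normal_density_def prod.distrib prod_dividef power_divide)
qed

lemma std_gaussian_eq: "std_gaussian = density lborel (\<lambda>x. ennreal (gauss_density x))"
  by (simp add: std_gaussian_def prod_std_normal_density)

lemma sets_std_gaussian [simp, measurable_cong]: "sets std_gaussian = sets borel"
  and space_std_gaussian [simp]: "space std_gaussian = UNIV"
  by (simp_all add: std_gaussian_def)

lemma nn_integral_std_gaussian:
  "f \<in> borel_measurable borel \<Longrightarrow>
    (\<integral>\<^sup>+x. f x \<partial>std_gaussian) = (\<integral>\<^sup>+x. ennreal (gauss_density x) * f x \<partial>lborel)"
  unfolding std_gaussian_eq by (subst nn_integral_density) auto

lemma prob_space_std_gaussian: "prob_space (std_gaussian :: 'a::euclidean_space measure)"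
proof
  have 1: "(\<integral>\<^sup>+x. ennreal (std_normal_density x) \<partial>lborel) = 1"
    using prob_space.emeasure_space_1[OF prob_space_normal_density[of 1 0]]
    by (simp add: emeasure_density)
  have "emeasure (std_gaussian :: 'a measure) (space std_gaussian)
      = (\<integral>\<^sup>+x. (\<Prod>b\<in>Basis. ennreal (std_normal_density (x \<bullet> b))) \<partial>(lborel :: 'a measure))"
    by (simp add: std_gaussian_def emeasure_density prod_ennreal)
  also have "\<dots> = (\<Prod>b\<in>(Basis :: 'a set). (\<integral>\<^sup>+x. ennreal (std_normal_density x) \<partial>lborel))"
    by (rule nn_integral_lborel_prod) auto
  finally show "emeasure (std_gaussian :: 'a measure) (space std_gaussian) = 1" by (simp add: 1)
qed

lemma AE_std_gaussian_iff: "(AE x in std_gaussian. P x) \<longleftrightarrow> (AE x in lborel. P x)"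
  unfolding std_gaussian_eq by (subst AE_density) (auto simp: gauss_density_pos)

lemma nn_integral_lborel_affine:
  fixes f :: "'a::euclidean_space \<Rightarrow> ennreal"
  assumes [measurable]: "f \<in> borel_measurable borel" and c: "c \<noteq> 0"
  shows "(\<integral>\<^sup>+x. f x \<partial>lborel) = ennreal (\<bar>c\<bar> ^ DIM('a)) * (\<integral>\<^sup>+x. f (t + c *\<^sub>R x) \<partial>lborel)"
  by (subst lborel_affine[OF c, of t])
     (simp add: nn_integral_density nn_integral_distr nn_integral_cmult)

text \<open>The density of the reference measure with respect to the product of two standard Gaussian measures,
for correlation \<open>s = exp (- \<epsilon> / 2)\<close>.\<close>

definition mehler :: "real \<Rightarrow> 'a::euclidean_space \<Rightarrow> 'a \<Rightarrow> real" where
  "mehler s x y = exp (s / (1 - s\<^sup>2) * (x \<bullet> y) - s\<^sup>2 / (2 * (1 - s\<^sup>2)) * ((norm x)\<^sup>2 + (norm y)\<^sup>2))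
     / sqrt (1 - s\<^sup>2) ^ DIM('a)"

lemma measurable_mehler [measurable]:
  assumes [measurable]: "f \<in> borel_measurable M" "g \<in> borel_measurable M"
  shows "(\<lambda>z. mehler s (f z) (g z)) \<in> borel_measurable M"
  unfolding mehler_def by measurable

lemma mehler_pos: "0 < s \<Longrightarrow> s < 1 \<Longrightarrow> 0 < mehler s x y"
  by (simp add: mehler_def power_less_one_iff)

lemma mehler_gauss_density:
  fixes x z :: "'a::euclidean_space"
  assumes s: "0 < s" "s < 1"
  defines "\<sigma> \<equiv> sqrt (1 - s\<^sup>2)"
  shows "\<sigma> ^ DIM('a) * (mehler s x (s *\<^sub>R x + \<sigma> *\<^sub>R z) * gauss_density (s *\<^sub>R x + \<sigma> *\<^sub>R z)) = gauss_density z"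
proof -
  have v: "0 < 1 - s\<^sup>2" using s by (simp add: power_less_one_iff)
  have \<sigma>2: "\<sigma>\<^sup>2 = 1 - s\<^sup>2" and \<sigma>: "0 < \<sigma>" using v by (simp_all add: \<sigma>_def)
  define Y where "Y = (norm (s *\<^sub>R x + \<sigma> *\<^sub>R z))\<^sup>2"
  define p q X Z where "p = x \<bullet> (s *\<^sub>R x + \<sigma> *\<^sub>R z)" "q = x \<bullet> z" "X = (norm x)\<^sup>2" "Z = (norm z)\<^sup>2"
  note d = this
  have Y: "Y = s\<^sup>2 * X + 2 * s * \<sigma> * q + (1 - s\<^sup>2) * Z"
  proof -
    have "Y = s\<^sup>2 * X + 2 * s * \<sigma> * q + \<sigma>\<^sup>2 * Z"
      unfolding Y_def d power2_norm_eq_inner inner_add_left inner_add_right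
          inner_scaleR_left inner_scaleR_right inner_commute[of z x]
      by (simp only: power2_eq_square algebra_simps)
    then show ?thesis by (simp add: \<sigma>2)
  qed
  have p: "p = s * X + \<sigma> * q"
    unfolding d by (simp add: power2_norm_eq_inner inner_add_right)
  have "(s / (1 - s\<^sup>2) * p - s\<^sup>2 / (2 * (1 - s\<^sup>2)) * (X + Y)) + (- Y / 2)
     = (2 * s * p - s\<^sup>2 * (X + Y) - (1 - s\<^sup>2) * Y) / (2 * (1 - s\<^sup>2))"
    if "0 < 1 - s\<^sup>2"
    using that unfolding \<sigma>2[symmetric] by (simp add: field_simps)
  note this[OF v]
  also have "2 * s * p - s\<^sup>2 * (X + Y) - (1 - s\<^sup>2) * Y = - ((1 - s\<^sup>2) * Z)"
    unfolding p Y by (simp add: algebra_simps power2_eq_square)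
  also have "- ((1 - s\<^sup>2) * Z) / (2 * (1 - s\<^sup>2)) = - Z / 2" unfolding \<sigma>2[symmetric] using \<sigma> by simp
  finally have "exp (s / (1 - s\<^sup>2) * p - s\<^sup>2 / (2 * (1 - s\<^sup>2)) * (X + Y)) * exp (- Y / 2) = exp (- Z / 2)"
    by (simp add: exp_add[symmetric])
  then show ?thesis
    using \<sigma> by (simp add: mehler_def gauss_density_def \<sigma>_def[symmetric] Y_def[symmetric] d(1,3,4)[symmetric])
qed

text \<open>For fixed \<open>x\<close>, the Mehler kernel times the Gaussian density is the law of \<open>s x +
sqrt (1 - s\<^sup>2) z\<close> with \<open>z\<close> standard Gaussian. The representation on the
right makes the dependence on \<open>x\<close> affine inside \<open>F\<close>, which is what
convexity arguments need.\<close>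

lemma mehler_average:
  fixes F :: "'a::euclidean_space \<Rightarrow> ennreal"
  assumes [measurable]: "F \<in> borel_measurable borel" and s: "0 < s" "s < 1"
  shows "(\<integral>\<^sup>+y. F y * ennreal (mehler s x y) \<partial>std_gaussian)
    = (\<integral>\<^sup>+z. F (s *\<^sub>R x + sqrt (1 - s\<^sup>2) *\<^sub>R z) \<partial>std_gaussian)"
proof -
  define \<sigma> where "\<sigma> = sqrt (1 - s\<^sup>2)"
  have \<sigma>: "0 < \<sigma>" using s by (simp add: \<sigma>_def power_less_one_iff)
  have "(\<integral>\<^sup>+y. F y * ennreal (mehler s x y) \<partial>std_gaussian)
     = (\<integral>\<^sup>+y. ennreal (gauss_density y) * (F y * ennreal (mehler s x y)) \<partial>lborel)"
    by (simp add: nn_integral_std_gaussian)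
  also have "\<dots> = ennreal (\<sigma> ^ DIM('a)) * (\<integral>\<^sup>+z. ennreal (gauss_density (s *\<^sub>R x + \<sigma> *\<^sub>R z)) *
      (F (s *\<^sub>R x + \<sigma> *\<^sub>R z) * ennreal (mehler s x (s *\<^sub>R x + \<sigma> *\<^sub>R z))) \<partial>lborel)"
    using \<sigma> by (subst nn_integral_lborel_affine[where c = \<sigma> and t = "s *\<^sub>R x"]) auto
  also have "\<dots> = (\<integral>\<^sup>+z. ennreal (\<sigma> ^ DIM('a)) * (ennreal (gauss_density (s *\<^sub>R x + \<sigma> *\<^sub>R z)) *
      (F (s *\<^sub>R x + \<sigma> *\<^sub>R z) * ennreal (mehler s x (s *\<^sub>R x + \<sigma> *\<^sub>R z)))) \<partial>lborel)"
    by (simp add: nn_integral_cmult)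
  also have "\<dots> = (\<integral>\<^sup>+z. ennreal (gauss_density z) * F (s *\<^sub>R x + \<sigma> *\<^sub>R z) \<partial>lborel)"
  proof (rule nn_integral_cong)
    fix z
    have "ennreal (gauss_density z) = ennreal (\<sigma> ^ DIM('a)) * (ennreal (gauss_density (s *\<^sub>R x + \<sigma> *\<^sub>R z)) *
       ennreal (mehler s x (s *\<^sub>R x + \<sigma> *\<^sub>R z)))"
    proof -
      have "gauss_density z = \<sigma> ^ DIM('a) * (gauss_density (s *\<^sub>R x + \<sigma> *\<^sub>R z) * mehler s x (s *\<^sub>R x + \<sigma> *\<^sub>R z))"
        using mehler_gauss_density[OF s, of x z] by (simp add: \<sigma>_def[symmetric] mult.commute)
      then show ?thesis
        using \<sigma> mehler_pos[OF s, of x "s *\<^sub>R x + \<sigma> *\<^sub>R z"] gauss_density_pos[of "s *\<^sub>R x + \<sigma> *\<^sub>R z"]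
        by (simp add: ennreal_mult less_imp_le)
    qed
    then show "ennreal (\<sigma> ^ DIM('a)) * (ennreal (gauss_density (s *\<^sub>R x + \<sigma> *\<^sub>R z)) *
      (F (s *\<^sub>R x + \<sigma> *\<^sub>R z) * ennreal (mehler s x (s *\<^sub>R x + \<sigma> *\<^sub>R z)))) = ennreal (gauss_density z) * F (s *\<^sub>R x + \<sigma> *\<^sub>R z)"
      by (simp only: ac_simps)
  qed
  also have "\<dots> = (\<integral>\<^sup>+z. F (s *\<^sub>R x + \<sigma> *\<^sub>R z) \<partial>std_gaussian)"
    by (simp add: nn_integral_std_gaussian)
  finally show ?thesis by (simp add: \<sigma>_def)
qed

lemma ref_measure_eq_density:
  assumes e: "0 < \<epsilon>"
  shows "ref_measure \<epsilon> = density (std_gaussian \<Otimes>\<^sub>M (std_gaussian :: 'a::euclidean_space measure))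
    (\<lambda>(x, y). ennreal (mehler (exp (- \<epsilon> / 2)) x y))"
    (is "_ = density (?G \<Otimes>\<^sub>M ?G) ?k")
proof (rule measure_eqI)
  interpret G: prob_space ?G by (rule prob_space_std_gaussian)
  interpret GG: pair_sigma_finite ?G ?G ..
  define s where "s = exp (- \<epsilon> / 2)"
  have s: "0 < s" "s < 1" using e by (simp_all add: s_def)
  have s2: "s\<^sup>2 = exp (- \<epsilon>)" by (simp add: s_def exp_double[symmetric])
  have sets: "sets (?G \<Otimes>\<^sub>M ?G) = sets (borel :: ('a \<times> 'a) measure)"
    unfolding borel_prod[symmetric] by (rule sets_pair_measure_cong) simp_all
  show "sets (ref_measure \<epsilon>) = sets (density (?G \<Otimes>\<^sub>M ?G) ?k)"
    unfolding sets_density sets by (simp add: ref_measure_def)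
  fix A assume "A \<in> sets (ref_measure \<epsilon> :: ('a \<times> 'a) measure)"
  then have A [measurable]: "A \<in> sets (borel :: ('a \<times> 'a) measure)" by (simp add: ref_measure_def)
  then have [measurable]: "A \<in> sets (borel \<Otimes>\<^sub>M (borel :: 'a measure))" by (simp only: borel_prod)
  have T: "(\<lambda>(x, y). (x, exp (- \<epsilon> / 2) *\<^sub>R x + sqrt (1 - exp (- \<epsilon>)) *\<^sub>R y)) \<in> measurable (?G \<Otimes>\<^sub>M ?G) borel"
    by (subst borel_prod[symmetric]) measurable
  have "emeasure (ref_measure \<epsilon>) A = (\<integral>\<^sup>+z. indicator A z \<partial>ref_measure \<epsilon>)"
    using A by (simp add: ref_measure_def)
  also have "\<dots> = (\<integral>\<^sup>+z. indicator A ((\<lambda>(x, y). (x, s *\<^sub>R x + sqrt (1 - s\<^sup>2) *\<^sub>R y)) z) \<partial>(?G \<Otimes>\<^sub>M ?G))"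
    unfolding ref_measure_def s2 unfolding s_def by (subst nn_integral_distr[OF T]) auto
  also have "\<dots> = (\<integral>\<^sup>+x. \<integral>\<^sup>+y. indicator A (x, s *\<^sub>R x + sqrt (1 - s\<^sup>2) *\<^sub>R y) \<partial>?G \<partial>?G)"
    by (subst G.nn_integral_fst[symmetric]) (auto simp: split_beta')
  also have "\<dots> = (\<integral>\<^sup>+x. \<integral>\<^sup>+y. indicator A (x, y) * ennreal (mehler s x y) \<partial>?G \<partial>?G)"
    by (intro nn_integral_cong mehler_average[symmetric] s) measurable
  also have "\<dots> = (\<integral>\<^sup>+z. indicator A z * ennreal (mehler s (fst z) (snd z)) \<partial>(?G \<Otimes>\<^sub>M ?G))"
    by (subst G.nn_integral_fst[symmetric]) auto
  also have "\<dots> = emeasure (density (?G \<Otimes>\<^sub>M ?G) ?k) A"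
    by (subst emeasure_density) (auto simp: sets s_def split_beta' mult.commute)
  finally show "emeasure (ref_measure \<epsilon>) A = emeasure (density (?G \<Otimes>\<^sub>M ?G) ?k) A" .
qed

lemma convex_on_norm_power2: "convex_on UNIV (\<lambda>x::'a::real_inner. (norm x)\<^sup>2)"
proof (rule convex_onI)
  fix t :: real and x y :: 'a assume t: "0 < t" "t < 1"
  have "(1 - t) * (norm x)\<^sup>2 + t * (norm y)\<^sup>2 - (norm ((1 - t) *\<^sub>R x + t *\<^sub>R y))\<^sup>2
     = t * (1 - t) * (norm (x - y))\<^sup>2"
    by (simp add: power2_norm_eq_inner inner_add_left inner_add_right inner_diff_left inner_diff_right inner_commute algebra_simps)
  also have "\<dots> \<ge> 0" using t by simp
  finally show "(norm ((1 - t) *\<^sub>R x + t *\<^sub>R y))\<^sup>2 \<le> (1 - t) * (norm x)\<^sup>2 + t * (norm y)\<^sup>2" by simp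
qed simp

lemma log_concave_mult:
  fixes v w :: "'a::real_vector \<Rightarrow> real"
  assumes v: "log_concave v" and w: "log_concave w"
  shows "log_concave (\<lambda>x. v x * w x)"
proof (rule log_concaveI)
  show "0 \<le> v x * w x" for x using v w by (simp add: log_concave_nonneg)
  fix x y :: 'a and t u :: real assume tu: "0 < t" "0 < u" "t + u = 1"
  have "(v x powr t * v y powr u) * (w x powr t * w y powr u) \<le> v (t *\<^sub>R x + u *\<^sub>R y) * w (t *\<^sub>R x + u *\<^sub>R y)"
    using v w tu by (intro mult_mono log_concaveD) (auto simp: log_concave_nonneg)
  then show "(v x * w x) powr t * (v y * w y) powr u \<le> v (t *\<^sub>R x + u *\<^sub>R y) * w (t *\<^sub>R x + u *\<^sub>R y)"
    using v w by (simp add: powr_mult log_concave_nonneg ac_simps)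
qed

lemma log_concave_cmult:
  fixes w :: "'a::real_vector \<Rightarrow> real"
  assumes w: "log_concave w" and c: "0 \<le> c"
  shows "log_concave (\<lambda>x. c * w x)"
proof (rule log_concaveI)
  show "0 \<le> c * w x" for x using w c by (simp add: log_concave_nonneg)
  fix x y :: 'a and t u :: real assume tu: "0 < t" "0 < u" "t + u = 1" and p: "0 < c * w x"
  have c': "0 < c" using p c by (cases "c = 0") auto
  have "(c powr t * c powr u) * (w x powr t * w y powr u) \<le> c * w (t *\<^sub>R x + u *\<^sub>R y)"
    using w tu c' by (subst powr_add[symmetric]) (auto intro!: mult_left_mono log_concaveD)
  then show "(c * w x) powr t * (c * w y) powr u \<le> c * w (t *\<^sub>R x + u *\<^sub>R y)"
    using w c by (simp add: powr_mult log_concave_nonneg ac_simps)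
qed

lemma log_concave_gauss_density: "log_concave gauss_density"
proof -
  have "convex_on UNIV (\<lambda>x::'a. 1/2 * (norm x)\<^sup>2)"
    by (intro convex_on_cmul convex_on_norm_power2) simp
  from log_concave_cmult[OF log_concave_exp_neg[OF this], of "(1 / sqrt (2 * pi)) ^ DIM('a)"]
  show ?thesis by (simp add: gauss_density_def[abs_def])
qed

text \<open>The integrand is jointly log-concave in \<open>(x, z)\<close>, as the Gaussian density is
log-concave; so this is an instance of the Prekopa-Leindler inequality.\<close>

lemma log_concave_gaussian_average:
  fixes w :: "'a::euclidean_space \<Rightarrow> real" and s \<sigma> t u :: real
  assumes w: "log_concave w" and [measurable]: "w \<in> borel_measurable borel"
    and tu: "0 < t" "0 < u" "t + u = 1"
  defines "G \<equiv> \<lambda>x. \<integral>\<^sup>+z. ennreal (w (s *\<^sub>R x + \<sigma> *\<^sub>R z)) \<partial>std_gaussian"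
  shows "epow (G x) t * epow (G y) u \<le> G (t *\<^sub>R x + u *\<^sub>R y)"
proof -
  let ?p = "\<lambda>x z. ennreal (gauss_density z) * ennreal (w (s *\<^sub>R x + \<sigma> *\<^sub>R z))"
  have G: "G x = (\<integral>\<^sup>+z. ?p x z \<partial>lborel)" for x
    unfolding G_def by (subst nn_integral_std_gaussian) auto
  show ?thesis unfolding G
  proof (rule prekopa_leindler[OF _ _ _ tu])
    fix a b :: 'a
    let ?a = "s *\<^sub>R x + \<sigma> *\<^sub>R a" and ?b = "s *\<^sub>R y + \<sigma> *\<^sub>R b"
    have c: "t *\<^sub>R ?a + u *\<^sub>R ?b = s *\<^sub>R (t *\<^sub>R x + u *\<^sub>R y) + \<sigma> *\<^sub>R (t *\<^sub>R a + u *\<^sub>R b)"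
      by (simp add: algebra_simps)
    have nn: "0 \<le> gauss_density z" "0 \<le> w z" for z :: 'a
      using gauss_density_pos[of z] log_concave_nonneg[OF w] by auto
    have "(gauss_density a powr t * gauss_density b powr u) * (w ?a powr t * w ?b powr u)
      \<le> gauss_density (t *\<^sub>R a + u *\<^sub>R b) * w (t *\<^sub>R ?a + u *\<^sub>R ?b)"
      using tu by (intro mult_mono log_concaveD log_concave_gauss_density w nn) auto
    then show "epow (?p x a) t * epow (?p y b) u \<le> ?p (t *\<^sub>R x + u *\<^sub>R y) (t *\<^sub>R a + u *\<^sub>R b)"
      unfolding c using nn by (simp add: ennreal_mult[symmetric] powr_mult mult_ac ennreal_leI)
  qed auto
qed

text \<open>For each fixed \<open>z\<close> the integrand is log-convex in \<open>x\<close>, and the Hoelder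
inequality shows that integration preserves this.\<close>

lemma log_convex_gaussian_average:
  fixes f :: "'a::euclidean_space \<Rightarrow> real" and s \<sigma> t u :: real
  assumes f: "convex_on UNIV f" and tu: "0 < t" "0 < u" "t + u = 1"
  defines "F \<equiv> \<lambda>x. \<integral>\<^sup>+z. ennreal (exp (f (s *\<^sub>R x + \<sigma> *\<^sub>R z))) \<partial>std_gaussian"
  shows "F (t *\<^sub>R x + u *\<^sub>R y) \<le> epow (F x) t * epow (F y) u"
proof -
  have [measurable]: "f \<in> borel_measurable borel"
    by (intro borel_measurable_continuous_onI convex_on_continuous f) auto
  let ?p = "\<lambda>x z. ennreal (exp (f (s *\<^sub>R x + \<sigma> *\<^sub>R z)))"
  have "F (t *\<^sub>R x + u *\<^sub>R y) \<le> (\<integral>\<^sup>+z. epow (?p x z) t * epow (?p y z) u \<partial>std_gaussian)"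
    unfolding F_def
  proof (rule nn_integral_mono)
    fix z
    let ?a = "s *\<^sub>R x + \<sigma> *\<^sub>R z" and ?b = "s *\<^sub>R y + \<sigma> *\<^sub>R z"
    have "t *\<^sub>R ?a + u *\<^sub>R ?b = s *\<^sub>R (t *\<^sub>R x + u *\<^sub>R y) + \<sigma> *\<^sub>R (t + u) *\<^sub>R z"
      by (simp add: algebra_simps)
    then have c: "t *\<^sub>R ?a + u *\<^sub>R ?b = s *\<^sub>R (t *\<^sub>R x + u *\<^sub>R y) + \<sigma> *\<^sub>R z" using tu by simp
    have "f (t *\<^sub>R ?a + u *\<^sub>R ?b) \<le> t * f ?a + u * f ?b"
      using f tu by (auto simp: convex_on_def)
    then have "exp (f (t *\<^sub>R ?a + u *\<^sub>R ?b)) \<le> exp (f ?a) powr t * exp (f ?b) powr u"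
      by (simp add: powr_def exp_add[symmetric])
    then show "?p (t *\<^sub>R x + u *\<^sub>R y) z \<le> epow (?p x z) t * epow (?p y z) u"
      unfolding c by (simp add: ennreal_mult[symmetric] ennreal_leI)
  qed
  also have "\<dots> \<le> epow (F x) t * epow (F y) u"
    unfolding F_def by (intro nn_integral_holder_epow tu) measurable
  finally show ?thesis .
qed

section \<open>Compactness and lower semicontinuity\<close>

text \<open>The function \<open>ln + c\<close> on \<open>(0, \<infinity>]\<close>, with value
\<open>\<infinity>\<close> at \<open>\<infinity>\<close>. Its negative part is cut off, which loses
nothing for arguments that are at least \<open>exp (- c)\<close>. The value at \<open>0\<close> is a
default.\<close>

definition eln :: "real \<Rightarrow> ennreal \<Rightarrow> ennreal" where
  "eln c z = (if z = \<infinity> then \<infinity> else ennreal (ln (enn2real z) + c))"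

lemma measurable_eln [measurable]:
  assumes [measurable]: "f \<in> borel_measurable M"
  shows "(\<lambda>x. eln c (f x)) \<in> borel_measurable M"
  unfolding eln_def by measurable

lemma less_eln_iff:
  assumes "0 \<le> m" "0 < z"
  shows "ennreal m < eln c z \<longleftrightarrow> ennreal (exp (m - c)) < z"
proof (cases z)
  case (real v)
  then have v: "0 < v" using assms by auto
  have "m < ln v + c \<longleftrightarrow> m - c < ln v" by linarith
  also have "\<dots> \<longleftrightarrow> exp (m - c) < exp (ln v)" by (subst exp_less_cancel_iff) simp
  also have "\<dots> \<longleftrightarrow> exp (m - c) < v" using v by simp
  finally show ?thesis using real v assms by (simp add: eln_def ennreal_less_iff)
qed (simp add: eln_def)

lemma eln_le_iff:
  assumes "0 \<le> m" "0 < z"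
  shows "eln c z \<le> ennreal m \<longleftrightarrow> z \<le> ennreal (exp (m - c))"
  using less_eln_iff[OF assms] by (auto simp: not_less[symmetric])

lemma eln_le_liminf:
  assumes z: "z \<le> liminf Z" and pos: "0 < z" "\<And>n. 0 < Z n"
  shows "eln c z \<le> liminf (\<lambda>n. eln c (Z n))"
  unfolding le_Liminf_iff
proof (intro allI impI)
  fix y assume y: "y < eln c z"
  then obtain m where m: "y = ennreal m" "0 \<le> m" by (cases y) auto
  then have "ennreal (exp (m - c)) < z" using y pos by (simp add: less_eln_iff)
  then have "ennreal (exp (m - c)) < liminf Z" using z by (rule order_less_le_trans)
  then have "eventually (\<lambda>n. ennreal (exp (m - c)) < Z n) sequentially"
    by (rule less_LiminfD)
  then show "eventually (\<lambda>n. y < eln c (Z n)) sequentially"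
    by eventually_elim (use m pos in \<open>simp add: less_eln_iff\<close>)
qed

lemma ennreal_liminf_add:
  fixes f g :: "nat \<Rightarrow> ennreal"
  shows "liminf f + liminf g \<le> liminf (\<lambda>n. f n + g n)"
proof -
  have "liminf f + liminf g = (SUP n. (INF m\<in>{n..}. f m) + (INF m\<in>{n..}. g m))"
    unfolding liminf_SUP_INF
    by (rule ennreal_SUP_add[symmetric]) (auto simp: incseq_def intro!: INF_superset_mono)
  also have "\<dots> \<le> (SUP n. INF m\<in>{n..}. f m + g m)"
    by (intro SUP_mono' INF_greatest add_mono INF_lower) auto
  finally show ?thesis by (simp add: liminf_SUP_INF)
qed

text \<open>A diagonal sequence converges on a countable dense set, and equicontinuity extends the convergence
to all points. Division by \<open>1 + C norm x\<close> makes the family uniformly bounded.\<close>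

lemma lipschitz_convergent_subsequence:
  fixes \<phi> :: "nat \<Rightarrow> 'a::euclidean_space \<Rightarrow> real"
  assumes zero: "\<And>n. \<phi> n 0 = 0" and lip: "\<And>n x y. \<bar>\<phi> n x - \<phi> n y\<bar> \<le> C * norm (x - y)"
  obtains k \<psi> where "strict_mono (k :: nat \<Rightarrow> nat)" "\<And>x. (\<lambda>n. \<phi> (k n) x) \<longlonglongrightarrow> \<psi> x"
proof -
  obtain D :: "'a set" where D: "countable D" "\<And>X. open X \<Longrightarrow> X \<noteq> {} \<Longrightarrow> \<exists>d\<in>D. d \<in> X"
    using countable_dense_exists by blast
  have C: "0 \<le> C * norm x" for x :: 'a
    using lip[of 0 x 0] by (metis abs_ge_zero diff_zero order_trans)
  have bnd: "norm (\<phi> n x / (1 + C * norm x)) \<le> 1" for n x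
    using lip[of n x 0] zero[of n] C[of x] by (simp add: divide_le_eq)
  obtain k where k: "strict_mono (k :: nat \<Rightarrow> nat)"
    "\<And>x. x \<in> D \<Longrightarrow> \<exists>l. (\<lambda>n. \<phi> (k n) x / (1 + C * norm x)) \<longlonglongrightarrow> l"
    using function_convergent_subsequence[of D "\<lambda>n x. \<phi> n x / (1 + C * norm x)" 1] D(1) bnd by auto
  have conv: "convergent (\<lambda>n. \<phi> (k n) x)" for x
  proof -
    have "Cauchy (\<lambda>n. \<phi> (k n) x)"
    proof (rule metric_CauchyI)
      fix e :: real assume e: "0 < e"
      have C': "0 \<le> C"
      proof -
        obtain v :: 'a where "norm v = 1" using vector_choose_size[of 1] by auto
        then show ?thesis using C[of v] by simp
      qed
      define d where "d = e / (4 * (C + 1))"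
      have d: "0 < d" "C * d \<le> e / 4"
        using e C' by (simp_all add: d_def field_simps)
      obtain y where y: "y \<in> D" "y \<in> ball x d" using D(2)[of "ball x d"] d by auto
      then have "norm (x - y) \<le> d" by (simp add: dist_norm)
      then have "C * norm (x - y) \<le> C * d" using C' by (rule mult_left_mono)
      then have near: "\<bar>\<phi> n x - \<phi> n y\<bar> \<le> e / 4" for n using lip[of n x y] d by linarith
      from k(2)[OF y(1)] obtain l where "(\<lambda>n. \<phi> (k n) y / (1 + C * norm y)) \<longlonglongrightarrow> l" by auto
      then have "(\<lambda>n. \<phi> (k n) y / (1 + C * norm y) * (1 + C * norm y)) \<longlonglongrightarrow> l * (1 + C * norm y)"
        by (intro tendsto_intros)
      moreover have "1 + C * norm y \<noteq> 0" using C[of y] by simp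
      ultimately have "Cauchy (\<lambda>n. \<phi> (k n) y)" using LIMSEQ_imp_Cauchy by fastforce
      then obtain M where M: "\<And>m n. m \<ge> M \<Longrightarrow> n \<ge> M \<Longrightarrow> dist (\<phi> (k m) y) (\<phi> (k n) y) < e / 4"
        using metric_CauchyD[of "\<lambda>n. \<phi> (k n) y" "e / 4"] e by auto
      show "\<exists>M. \<forall>m\<ge>M. \<forall>n\<ge>M. dist (\<phi> (k m) x) (\<phi> (k n) x) < e"
      proof (intro exI[of _ M] allI impI)
        fix m n assume "m \<ge> M" "n \<ge> M"
        then show "dist (\<phi> (k m) x) (\<phi> (k n) x) < e"
          using M[of m n] near[of "k m"] near[of "k n"] e unfolding dist_real_def by linarith
      qed
    qed
    then show ?thesis by (rule Cauchy_convergent)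
  qed
  show ?thesis
    by (rule that[of k "\<lambda>x. lim (\<lambda>n. \<phi> (k n) x)"]) (use k conv convergent_LIMSEQ_iff in auto)
qed

section \<open>The dual problem and its minimizer\<close>

text \<open>The data of the problem in regular form: \<open>V\<close> is real-valued, the density
\<open>w\<close> of \<open>\<nu>\<close> is Borel measurable, and \<open>\<nu>\<close> is carried by
the ball of radius \<open>r\<close>.\<close>

locale schroedinger =
  fixes s r :: real and V w :: "'a::euclidean_space \<Rightarrow> real" and \<mu> \<nu> :: "'a measure"
  assumes s: "0 < s" "s < 1" and r: "0 \<le> r"
    and V: "convex_on UNIV V" and w: "log_concave w" and w_borel [measurable]: "w \<in> borel_measurable borel"
    and \<mu>_eq: "\<mu> = density std_gaussian (\<lambda>x. ennreal (exp (V x)))" and prob_\<mu>: "prob_space \<mu>"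
    and \<nu>_eq: "\<nu> = density std_gaussian (\<lambda>x. ennreal (w x))" and prob_\<nu>: "prob_space \<nu>"
    and moment: "integrable \<mu> (\<lambda>x. (norm x)\<^sup>2)"
    and supp: "AE y in \<nu>. norm y \<le> r"
begin

sublocale M: prob_space \<mu> by (rule prob_\<mu>)
sublocale N: prob_space \<nu> by (rule prob_\<nu>)
sublocale MN: pair_sigma_finite \<mu> \<nu> ..

text \<open>With these constants the Mehler kernel is \<open>exp (a (x \<bullet> y) - b ((norm x)\<^sup>2 +
(norm y)\<^sup>2)) / c0\<close>.\<close>

definition a where "a = s / (1 - s\<^sup>2)"
definition b where "b = s\<^sup>2 / (2 * (1 - s\<^sup>2))"
definition c0 where "c0 = sqrt (1 - s\<^sup>2) ^ DIM('a)"

lemma a_pos: "0 < a" and b_pos: "0 < b" and c0_pos: "0 < c0"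
  using s by (simp_all add: a_def b_def c0_def power_less_one_iff)

lemma ar_nonneg: "0 \<le> a * r" using a_pos r by simp

lemma mehler_eq: "mehler s x y = exp (a * (x \<bullet> y) - b * ((norm x)\<^sup>2 + (norm y)\<^sup>2)) / c0"
  for x y :: 'a by (simp add: mehler_def a_def b_def c0_def)

lemma sets_\<mu> [simp, measurable_cong]: "sets \<mu> = sets borel"
  and sets_\<nu> [simp, measurable_cong]: "sets \<nu> = sets borel"
  and space_\<mu> [simp]: "space \<mu> = UNIV" and space_\<nu> [simp]: "space \<nu> = UNIV"
  by (simp_all add: \<mu>_eq \<nu>_eq)

lemma V_borel [measurable]: "V \<in> borel_measurable borel"
  by (intro borel_measurable_continuous_onI convex_on_continuous V) auto

lemma w_nonneg: "0 \<le> w x" by (rule log_concave_nonneg[OF w])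

lemma nn_integral_\<mu>:
  "f \<in> borel_measurable borel \<Longrightarrow> (\<integral>\<^sup>+x. f x \<partial>\<mu>) = (\<integral>\<^sup>+x. ennreal (exp (V x)) * f x \<partial>std_gaussian)"
  unfolding \<mu>_eq by (subst nn_integral_density) auto

lemma nn_integral_\<nu>:
  "f \<in> borel_measurable borel \<Longrightarrow> (\<integral>\<^sup>+x. f x \<partial>\<nu>) = (\<integral>\<^sup>+x. ennreal (w x) * f x \<partial>std_gaussian)"
  unfolding \<nu>_eq by (subst nn_integral_density) auto

lemma integrable_norm_\<mu>: "integrable \<mu> norm"
proof (rule Bochner_Integration.integrable_bound)
  show "integrable \<mu> (\<lambda>x. 1 + (norm x)\<^sup>2)" using moment by simp
  show "AE x in \<mu>. norm (norm x) \<le> norm (1 + (norm x)\<^sup>2)"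
  proof (rule AE_I2)
    fix x :: 'a
    have "0 \<le> (norm x - 1)\<^sup>2" by simp
    then have "norm x * 2 \<le> 1 + (norm x)\<^sup>2" by (simp add: power2_diff)
    then have "norm x \<le> 1 + (norm x)\<^sup>2" using norm_ge_zero[of x] by linarith
    then show "norm (norm x) \<le> norm (1 + (norm x)\<^sup>2)" by simp
  qed
qed simp

text \<open>The class in which the dual problem is solved. A potential \<open>\<phi>\<close> stands for the
first factor of the density \<open>exp (a (x \<bullet> y) - \<phi> x) g y\<close> with respect to
\<open>\<mu> \<Otimes> \<nu>\<close>; with respect to the reference measure the factor depending on
\<open>x\<close> becomes \<open>exp (V x - \<phi> x + b (norm x)\<^sup>2)\<close> up to a constant,
and it is required to be log-convex. The normalization at the origin makes the class compact.\<close>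

definition potentials :: "('a \<Rightarrow> real) set" where
  "potentials = {\<phi>. \<phi> 0 = 0 \<and> (\<forall>x y. \<bar>\<phi> x - \<phi> y\<bar> \<le> a * r * norm (x - y)) \<and>
     convex_on UNIV (\<lambda>x. V x - \<phi> x + b * (norm x)\<^sup>2)}"

lemma potentials_lip: "\<phi> \<in> potentials \<Longrightarrow> \<bar>\<phi> x - \<phi> y\<bar> \<le> a * r * norm (x - y)"
  and potentials_0: "\<phi> \<in> potentials \<Longrightarrow> \<phi> 0 = 0"
  and potentials_convex: "\<phi> \<in> potentials \<Longrightarrow> convex_on UNIV (\<lambda>x. V x - \<phi> x + b * (norm x)\<^sup>2)"
  by (auto simp: potentials_def)

lemma potentials_bound: "\<phi> \<in> potentials \<Longrightarrow> \<bar>\<phi> x\<bar> \<le> a * r * norm x"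
  using potentials_lip[of \<phi> x 0] potentials_0[of \<phi>] by simp

lemma lip_borel:
  assumes "\<And>x y. \<bar>\<phi> x - \<phi> y\<bar> \<le> a * r * norm (x - y)"
  shows "\<phi> \<in> borel_measurable borel"
proof -
  have "(a * r)-lipschitz_on UNIV \<phi>"
    using assms ar_nonneg by (intro lipschitz_onI) (auto simp: dist_real_def dist_norm)
  then show ?thesis by (intro borel_measurable_continuous_onI lipschitz_on_continuous_on)
qed

lemma potentials_borel [measurable_dest]: "\<phi> \<in> potentials \<Longrightarrow> \<phi> \<in> borel_measurable borel"
  by (rule lip_borel) (rule potentials_lip)

text \<open>The factor \<open>g = 1 / Z \<phi>\<close> restores the second marginal for the given
\<open>\<phi>\<close>. It can happen that \<open>Z \<phi> y = \<infinity>\<close>.\<close>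

definition Z :: "('a \<Rightarrow> real) \<Rightarrow> 'a \<Rightarrow> ennreal" where
  "Z \<phi> y = (\<integral>\<^sup>+x. ennreal (exp (a * (x \<bullet> y) - \<phi> x)) \<partial>\<mu>)"

lemma Z_borel [measurable]:
  assumes [measurable]: "\<phi> \<in> borel_measurable borel"
  shows "Z \<phi> \<in> borel_measurable borel"
  unfolding Z_def by measurable

lemma nn_integral_\<mu>_pos:
  assumes [measurable]: "f \<in> borel_measurable borel" and "\<And>x. 0 < f x"
  shows "0 < (\<integral>\<^sup>+x. f x \<partial>\<mu>)"
proof -
  have "f x \<noteq> 0" for x using assms(2)[of x] by simp
  then have "\<not> (AE x in \<mu>. f x = 0)" using M.not_empty M.AE_False by auto
  then have "(\<integral>\<^sup>+x. f x \<partial>\<mu>) \<noteq> 0" by (subst nn_integral_0_iff_AE) auto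
  then show ?thesis by (simp add: zero_less_iff_neq_zero)
qed

lemma Z_pos: "\<phi> \<in> borel_measurable borel \<Longrightarrow> 0 < Z \<phi> y"
  unfolding Z_def by (rule nn_integral_\<mu>_pos) auto

text \<open>A lower bound for \<open>Z \<phi> y\<close>, uniform over the class and over the support of
\<open>\<nu>\<close>.\<close>

definition z0 where "z0 = enn2real (\<integral>\<^sup>+x. ennreal (exp (- 2 * (a * r * norm x))) \<partial>\<mu>)"

lemma z0: "ennreal z0 = (\<integral>\<^sup>+x. ennreal (exp (- 2 * (a * r * norm x))) \<partial>\<mu>)" "0 < z0"
proof -
  let ?I = "\<integral>\<^sup>+x. ennreal (exp (- 2 * (a * r * norm x))) \<partial>\<mu>"
  have "?I \<le> (\<integral>\<^sup>+x. 1 \<partial>\<mu>)"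
    using ar_nonneg by (intro nn_integral_mono) (auto simp: ennreal_le_1)
  also have "\<dots> = 1" using M.emeasure_space_1 by simp
  finally have fin: "?I < \<infinity>" by (simp add: order_le_less_trans)
  have "0 < ?I" by (rule nn_integral_\<mu>_pos) auto
  then show "0 < z0" using fin unfolding z0_def by (simp add: enn2real_positive_iff)
  show "ennreal z0 = ?I" using fin by (simp add: z0_def)
qed

lemma Z_lower:
  assumes \<phi>: "\<phi> \<in> potentials" and y: "norm y \<le> r"
  shows "ennreal z0 \<le> Z \<phi> y"
  unfolding z0(1) Z_def
proof (intro nn_integral_mono ennreal_leI, subst exp_le_cancel_iff)
  fix x :: 'a
  have "\<bar>x \<bullet> y\<bar> \<le> norm x * r"
    using Cauchy_Schwarz_ineq2[of x y] mult_left_mono[OF y norm_ge_zero[of x]] by linarith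
  then have "a * - (x \<bullet> y) \<le> a * (norm x * r)" using a_pos by (intro mult_left_mono) auto
  moreover have "\<phi> x \<le> a * r * norm x" using potentials_bound[OF \<phi>, of x] by simp
  ultimately show "- 2 * (a * r * norm x) \<le> a * (x \<bullet> y) - \<phi> x" by (simp add: algebra_simps)
qed

text \<open>The negative of the dual objective, \<open>\<integral> \<phi> d\<mu> + \<integral> ln (Z \<phi>)
d\<nu>\<close>, shifted by constants so that both integrands are nonnegative on the class. In this
form it always has a meaning in \<open>[0, \<infinity>]\<close>, and Fatou's lemma applies.\<close>

definition dual_cost :: "('a \<Rightarrow> real) \<Rightarrow> ennreal" where
  "dual_cost \<phi> = (\<integral>\<^sup>+x. ennreal (\<phi> x + a * r * norm x) \<partial>\<mu>) + (\<integral>\<^sup>+y. eln (- ln z0) (Z \<phi> y) \<partial>\<nu>)"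

text \<open>A member of the class with finite dual cost. It equals \<open>b (norm x)\<^sup>2\<close> near the
origin and is continued by tangent cones where the slope reaches \<open>a r\<close>. Thus it is
Lipschitz, it differs from \<open>b (norm x)\<^sup>2\<close> by a convex function, and it grows as
fast as \<open>a (x \<bullet> y)\<close> can for \<open>norm y \<le> r\<close>.\<close>

definition \<phi>\<^sub>0 :: "'a \<Rightarrow> real" where
  "\<phi>\<^sub>0 x = b * (norm x)\<^sup>2 - b * (max 0 (norm x - a * r / (2 * b)))\<^sup>2"

lemma \<phi>\<^sub>0_potential: "\<phi>\<^sub>0 \<in> potentials"
proof -
  define \<rho> where "\<rho> = a * r / (2 * b)"
  have \<rho>: "0 \<le> \<rho>" "a * r = 2 * b * \<rho>" using ar_nonneg b_pos by (simp_all add: \<rho>_def)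
  define q where "q \<tau> = b * \<tau>\<^sup>2 - b * (max 0 (\<tau> - \<rho>))\<^sup>2" for \<tau> :: real
  have \<phi>q: "\<phi>\<^sub>0 x = q (norm x)" for x by (simp add: \<phi>\<^sub>0_def q_def \<rho>_def)
  have q_le: "q \<tau> \<le> q \<tau>' \<and> q \<tau>' - q \<tau> \<le> 2 * b * \<rho> * (\<tau>' - \<tau>)" if "0 \<le> \<tau>" "\<tau> \<le> \<tau>'" for \<tau> \<tau>'
  proof -
    \<comment> \<open>below the radius \<open>\<rho>\<close> the slope \<open>2 b \<tau>\<close> is at most \<open>2 b \<rho> = a r\<close>; beyond it, it is equal to it\<close>
    have A: "q \<tau> \<le> q \<tau>' \<and> q \<tau>' - q \<tau> \<le> 2 * b * \<rho> * (\<tau>' - \<tau>)" if "0 \<le> \<tau>" "\<tau> \<le> \<tau>'" "\<tau>' \<le> \<rho>" for \<tau> \<tau>'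
    proof -
      have "q \<tau>' - q \<tau> = b * ((\<tau>' + \<tau>) * (\<tau>' - \<tau>))"
        using that by (simp add: q_def power2_eq_square algebra_simps)
      moreover have "b * ((\<tau>' + \<tau>) * (\<tau>' - \<tau>)) \<le> b * ((2 * \<rho>) * (\<tau>' - \<tau>))"
        using that b_pos by (intro mult_left_mono mult_right_mono) auto
      moreover have "0 \<le> b * ((\<tau>' + \<tau>) * (\<tau>' - \<tau>))" using that b_pos by simp
      ultimately show ?thesis by (simp add: mult.assoc mult.left_commute)
    qed
    have B: "q \<tau>' - q \<tau> = 2 * b * \<rho> * (\<tau>' - \<tau>)" if "\<rho> \<le> \<tau>" "\<tau> \<le> \<tau>'" for \<tau> \<tau>'
      using that by (simp add: q_def power2_eq_square algebra_simps)
    have B0: "0 \<le> 2 * b * \<rho> * (\<tau>' - \<tau>)" if "\<tau> \<le> \<tau>'" for \<tau> \<tau>' using that \<rho>(1) b_pos by simp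
    consider "\<tau>' \<le> \<rho>" | "\<rho> \<le> \<tau>" | "\<tau> \<le> \<rho>" "\<rho> \<le> \<tau>'" by linarith
    then show ?thesis
    proof cases
      case 1 then show ?thesis using A[of \<tau> \<tau>'] that by auto
    next
      case 2
      have "q \<tau>' - q \<tau> = 2 * b * \<rho> * (\<tau>' - \<tau>)" using B 2 that by blast
      then show ?thesis using B0[of \<tau> \<tau>'] that by linarith
    next
      case 3
      have "2 * b * \<rho> * (\<tau>' - \<rho>) + 2 * b * \<rho> * (\<rho> - \<tau>) = 2 * b * \<rho> * (\<tau>' - \<tau>)" by (simp add: algebra_simps)
      moreover have "q \<tau>' - q \<rho> = 2 * b * \<rho> * (\<tau>' - \<rho>)" using B 3 by blast
      ultimately show ?thesis using A[of \<tau> \<rho>] B0[of \<rho> \<tau>'] that 3 by linarith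
    qed
  qed
  have "\<bar>\<phi>\<^sub>0 x - \<phi>\<^sub>0 y\<bar> \<le> a * r * norm (x - y)" for x y
  proof -
    have "\<bar>\<phi>\<^sub>0 x - \<phi>\<^sub>0 y\<bar> \<le> 2 * b * \<rho> * \<bar>norm x - norm y\<bar>"
      using q_le[of "norm x" "norm y"] q_le[of "norm y" "norm x"] unfolding \<phi>q
      by (cases "norm x \<le> norm y") auto
    also have "\<dots> \<le> 2 * b * \<rho> * norm (x - y)"
      using b_pos \<rho> norm_triangle_ineq3[of x y] by (intro mult_left_mono) auto
    finally show ?thesis by (simp add: \<rho>)
  qed
  moreover have "convex_on UNIV (\<lambda>x. V x - \<phi>\<^sub>0 x + b * (norm x)\<^sup>2)"
  proof -
    have "convex_on UNIV (\<lambda>x::'a. (max 0 (norm x - \<rho>))\<^sup>2)"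
    proof (rule convex_onI)
      fix t :: real and x y :: 'a assume t: "0 < t" "t < 1"
      let ?g = "\<lambda>x::'a. max 0 (norm x - \<rho>)"
      have "norm ((1 - t) *\<^sub>R x + t *\<^sub>R y) \<le> (1 - t) * norm x + t * norm y"
        using t norm_triangle_ineq[of "(1 - t) *\<^sub>R x" "t *\<^sub>R y"] by simp
      then have "norm ((1 - t) *\<^sub>R x + t *\<^sub>R y) - \<rho> \<le> (1 - t) * (norm x - \<rho>) + t * (norm y - \<rho>)"
        by (simp add: algebra_simps)
      also have "\<dots> \<le> (1 - t) * ?g x + t * ?g y"
        using t by (intro add_mono mult_left_mono) auto
      finally have "?g ((1 - t) *\<^sub>R x + t *\<^sub>R y) \<le> (1 - t) * ?g x + t * ?g y"
        using t by simp
      then have "(?g ((1 - t) *\<^sub>R x + t *\<^sub>R y))\<^sup>2 \<le> ((1 - t) * ?g x + t * ?g y)\<^sup>2"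
        by (intro power_mono) auto
      also have "\<dots> = (1 - t) * (?g x)\<^sup>2 + t * (?g y)\<^sup>2 - t * (1 - t) * (?g x - ?g y)\<^sup>2"
        by (simp add: power2_eq_square algebra_simps)
      also have "\<dots> \<le> (1 - t) * (?g x)\<^sup>2 + t * (?g y)\<^sup>2" using t by simp
      finally show "(?g ((1 - t) *\<^sub>R x + t *\<^sub>R y))\<^sup>2 \<le> (1 - t) * (?g x)\<^sup>2 + t * (?g y)\<^sup>2" .
    qed simp
    then have "convex_on UNIV (\<lambda>x. V x + b * (max 0 (norm x - \<rho>))\<^sup>2)"
      using V b_pos by (intro convex_on_add convex_on_cmul) auto
    then show ?thesis by (simp add: \<phi>q q_def)
  qed
  moreover have "\<phi>\<^sub>0 0 = 0" using \<rho> by (simp add: \<phi>q q_def)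
  ultimately show ?thesis by (auto simp: potentials_def)
qed

lemma dual_cost_\<phi>\<^sub>0: "dual_cost \<phi>\<^sub>0 < \<infinity>"
proof -
  define \<rho> where "\<rho> = a * r / (2 * b)"
  have \<rho>: "0 \<le> \<rho>" "a * r = 2 * b * \<rho>" using ar_nonneg b_pos by (simp_all add: \<rho>_def)
  note \<phi>\<^sub>0_potential[measurable]
  have "(\<integral>\<^sup>+x. ennreal (\<phi>\<^sub>0 x + a * r * norm x) \<partial>\<mu>) \<le> (\<integral>\<^sup>+x. ennreal (2 * (a * r) * norm x) \<partial>\<mu>)"
  proof (intro nn_integral_mono ennreal_leI)
    fix x :: 'a
    have "2 * (a * r) * norm x = a * r * norm x + a * r * norm x" by simp
    then show "\<phi>\<^sub>0 x + a * r * norm x \<le> 2 * (a * r) * norm x"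
      using potentials_bound[OF \<phi>\<^sub>0_potential, of x] by linarith
  qed
  also have "\<dots> < \<infinity>"
    using integrable_norm_\<mu> ar_nonneg by (subst nn_integral_eq_integral) auto
  finally have 1: "(\<integral>\<^sup>+x. ennreal (\<phi>\<^sub>0 x + a * r * norm x) \<partial>\<mu>) < \<infinity>" .
  define K where "K = max 0 (b * \<rho>\<^sup>2 - ln z0)"
  have "(\<integral>\<^sup>+y. eln (- ln z0) (Z \<phi>\<^sub>0 y) \<partial>\<nu>) \<le> (\<integral>\<^sup>+y. ennreal K \<partial>\<nu>)"
  proof (rule nn_integral_mono_AE)
    show "AE y in \<nu>. eln (- ln z0) (Z \<phi>\<^sub>0 y) \<le> ennreal K"
      using supp
    proof eventually_elim
      case (elim y)
      have "Z \<phi>\<^sub>0 y \<le> (\<integral>\<^sup>+x. ennreal (exp (b * \<rho>\<^sup>2)) \<partial>\<mu>)"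
        unfolding Z_def
      proof (intro nn_integral_mono ennreal_leI, subst exp_le_cancel_iff)
        fix x :: 'a
        have "x \<bullet> y \<le> norm x * r"
          using Cauchy_Schwarz_ineq2[of x y] mult_left_mono[OF elim norm_ge_zero[of x]] by linarith
        then have "a * (x \<bullet> y) \<le> a * (norm x * r)" using a_pos by (intro mult_left_mono) auto
        also have "\<dots> = 2 * b * \<rho> * norm x" using \<rho>(2) by (metis mult.assoc mult.commute)
        finally have "a * (x \<bullet> y) \<le> 2 * b * \<rho> * norm x" .
        moreover have "(max 0 (norm x - \<rho>))\<^sup>2 \<le> (norm x - \<rho>)\<^sup>2" by (simp add: max_def)
        then have "b * (max 0 (norm x - \<rho>))\<^sup>2 \<le> b * (norm x - \<rho>)\<^sup>2"
          using b_pos by (intro mult_left_mono) auto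
        ultimately show "a * (x \<bullet> y) - \<phi>\<^sub>0 x \<le> b * \<rho>\<^sup>2"
          unfolding \<phi>\<^sub>0_def \<rho>_def[symmetric] by (simp add: power2_diff algebra_simps)
      qed
      also have "\<dots> = ennreal (exp (b * \<rho>\<^sup>2))" using M.emeasure_space_1 by simp
      also have "\<dots> \<le> ennreal (exp (K - - ln z0))" by (intro ennreal_leI) (simp add: K_def)
      finally show ?case by (subst eln_le_iff) (auto simp: K_def intro!: Z_pos)
    qed
  qed
  also have "\<dots> < \<infinity>" using N.emeasure_space_1 by simp
  finally show ?thesis using 1 by (simp add: dual_cost_def)
qed

text \<open>A minimizing sequence has a pointwise convergent subsequence, whose limit stays in the class because
convexity and the Lipschitz bound are closed conditions. Fatou's lemma, once in \<open>x\<close> for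
\<open>Z\<close> and then in \<open>x\<close> and \<open>y\<close> for the two integrals, shows that
the cost of the limit is minimal.\<close>

lemma dual_cost_minimizer:
  obtains \<phi> where "\<phi> \<in> potentials" "dual_cost \<phi> < \<infinity>" "\<And>\<phi>'. \<phi>' \<in> potentials \<Longrightarrow> dual_cost \<phi> \<le> dual_cost \<phi>'"
proof -
  let ?I = "INF \<phi>\<in>potentials. dual_cost \<phi>"
  obtain u where u: "\<And>n::nat. u n \<in> dual_cost ` potentials" "u \<longlonglongrightarrow> ?I"
    using Inf_as_limit[of "dual_cost ` potentials"] \<phi>\<^sub>0_potential by auto
  then have "\<forall>n. \<exists>\<phi>\<in>potentials. u n = dual_cost \<phi>" by auto
  then obtain \<Phi> where \<Phi>: "\<And>n. \<Phi> n \<in> potentials" "\<And>n. u n = dual_cost (\<Phi> n)" by metis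
  obtain k \<phi> where k: "strict_mono (k :: nat \<Rightarrow> nat)" and lim: "\<And>x. (\<lambda>n. \<Phi> (k n) x) \<longlonglongrightarrow> \<phi> x"
    by (rule lipschitz_convergent_subsequence[of \<Phi> "a * r"])
       (use \<Phi> potentials_0 potentials_lip in auto)
  define \<Psi> where "\<Psi> n = \<Phi> (k n)" for n
  have \<Psi>: "\<Psi> n \<in> potentials" for n using \<Phi> by (simp add: \<Psi>_def)
  have lim: "(\<lambda>n. \<Psi> n x) \<longlonglongrightarrow> \<phi> x" for x using lim by (simp add: \<Psi>_def)
  have limL: "(\<lambda>n. dual_cost (\<Psi> n)) \<longlonglongrightarrow> ?I"
    using LIMSEQ_subseq_LIMSEQ[OF u(2) k] by (simp add: o_def \<Phi>(2) \<Psi>_def)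
  have \<phi>: "\<phi> \<in> potentials"
    unfolding potentials_def
  proof (intro CollectI conjI allI)
    have "(\<lambda>n. 0) \<longlonglongrightarrow> \<phi> 0" using lim[of 0] by (simp add: potentials_0[OF \<Psi>])
    then show "\<phi> 0 = 0" by (simp add: LIMSEQ_const_iff)
    show "\<bar>\<phi> x - \<phi> y\<bar> \<le> a * r * norm (x - y)" for x y
      by (rule LIMSEQ_le_const2[OF tendsto_rabs[OF tendsto_diff[OF lim lim]]])
         (use potentials_lip[OF \<Psi>] in auto)
    show "convex_on UNIV (\<lambda>x. V x - \<phi> x + b * (norm x)\<^sup>2)"
    proof (rule convex_onI)
      fix t :: real and x y :: 'a assume t: "0 < t" "t < 1"
      let ?f = "\<lambda>n x. V x - \<Psi> n x + b * (norm x)\<^sup>2"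
      have l: "(\<lambda>n. ?f n x) \<longlonglongrightarrow> V x - \<phi> x + b * (norm x)\<^sup>2" for x
        by (intro tendsto_intros lim)
      show "V ((1 - t) *\<^sub>R x + t *\<^sub>R y) - \<phi> ((1 - t) *\<^sub>R x + t *\<^sub>R y) + b * (norm ((1 - t) *\<^sub>R x + t *\<^sub>R y))\<^sup>2
        \<le> (1 - t) * (V x - \<phi> x + b * (norm x)\<^sup>2) + t * (V y - \<phi> y + b * (norm y)\<^sup>2)"
      proof (rule LIMSEQ_le[OF l])
        show "(\<lambda>n. (1 - t) * ?f n x + t * ?f n y) \<longlonglongrightarrow>
          (1 - t) * (V x - \<phi> x + b * (norm x)\<^sup>2) + t * (V y - \<phi> y + b * (norm y)\<^sup>2)"
          by (intro tendsto_add tendsto_mult tendsto_const l)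
        show "\<exists>N. \<forall>n\<ge>N. ?f n ((1 - t) *\<^sub>R x + t *\<^sub>R y) \<le> (1 - t) * ?f n x + t * ?f n y"
          using t by (intro exI allI impI convex_onD[OF potentials_convex[OF \<Psi>]]) auto
      qed
    qed simp
  qed
  note [measurable] = potentials_borel[OF \<phi>] potentials_borel[OF \<Psi>]
  have "(\<integral>\<^sup>+x. ennreal (\<phi> x + a * r * norm x) \<partial>\<mu>) \<le> liminf (\<lambda>n. \<integral>\<^sup>+x. ennreal (\<Psi> n x + a * r * norm x) \<partial>\<mu>)"
  proof -
    have "(\<lambda>n. ennreal (\<Psi> n x + a * r * norm x)) \<longlonglongrightarrow> ennreal (\<phi> x + a * r * norm x)" for x
      by (intro tendsto_ennrealI tendsto_intros lim)
    then have "liminf (\<lambda>n. ennreal (\<Psi> n x + a * r * norm x)) = ennreal (\<phi> x + a * r * norm x)" for x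
      by (intro lim_imp_Liminf) auto
    then show ?thesis
      using nn_integral_liminf[of "\<lambda>n x. ennreal (\<Psi> n x + a * r * norm x)" \<mu>] by simp
  qed
  moreover have "(\<integral>\<^sup>+y. eln (- ln z0) (Z \<phi> y) \<partial>\<nu>) \<le> liminf (\<lambda>n. \<integral>\<^sup>+y. eln (- ln z0) (Z (\<Psi> n) y) \<partial>\<nu>)"
  proof -
    have "Z \<phi> y \<le> liminf (\<lambda>n. Z (\<Psi> n) y)" for y
    proof -
      have "(\<lambda>n. ennreal (exp (a * (x \<bullet> y) - \<Psi> n x))) \<longlonglongrightarrow> ennreal (exp (a * (x \<bullet> y) - \<phi> x))" for x
        by (intro tendsto_ennrealI tendsto_intros lim)
      then have "liminf (\<lambda>n. ennreal (exp (a * (x \<bullet> y) - \<Psi> n x))) = ennreal (exp (a * (x \<bullet> y) - \<phi> x))" for x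
        by (intro lim_imp_Liminf) auto
      then show ?thesis
        using nn_integral_liminf[of "\<lambda>n x. ennreal (exp (a * (x \<bullet> y) - \<Psi> n x))" \<mu>] by (simp add: Z_def)
    qed
    then have "eln (- ln z0) (Z \<phi> y) \<le> liminf (\<lambda>n. eln (- ln z0) (Z (\<Psi> n) y))" for y
      by (intro eln_le_liminf Z_pos) auto
    then have "(\<integral>\<^sup>+y. eln (- ln z0) (Z \<phi> y) \<partial>\<nu>) \<le> (\<integral>\<^sup>+y. liminf (\<lambda>n. eln (- ln z0) (Z (\<Psi> n) y)) \<partial>\<nu>)"
      by (intro nn_integral_mono)
    also have "\<dots> \<le> liminf (\<lambda>n. \<integral>\<^sup>+y. eln (- ln z0) (Z (\<Psi> n) y) \<partial>\<nu>)"
      by (rule nn_integral_liminf) auto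
    finally show ?thesis .
  qed
  ultimately have "dual_cost \<phi> \<le> liminf (\<lambda>n. \<integral>\<^sup>+x. ennreal (\<Psi> n x + a * r * norm x) \<partial>\<mu>)
      + liminf (\<lambda>n. \<integral>\<^sup>+y. eln (- ln z0) (Z (\<Psi> n) y) \<partial>\<nu>)"
    unfolding dual_cost_def by (rule add_mono)
  also have "\<dots> \<le> liminf (\<lambda>n. dual_cost (\<Psi> n))"
    unfolding dual_cost_def by (rule ennreal_liminf_add)
  also have "\<dots> = ?I" using limL by (intro lim_imp_Liminf) auto
  finally have "dual_cost \<phi> \<le> ?I" .
  then have le: "dual_cost \<phi> \<le> dual_cost \<phi>'" if "\<phi>' \<in> potentials" for \<phi>'
    using INF_lower[OF that, of dual_cost] by simp
  show ?thesis
    by (rule that[OF \<phi> _ le]) (use le[OF \<phi>\<^sub>0_potential] dual_cost_\<phi>\<^sub>0 in auto)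
qed

end

section \<open>The Sinkhorn step and the Schroedinger system\<close>

text \<open>Reciprocals of log-convex functions are log-concave; the value \<open>\<infinity>\<close> of
\<open>F\<close> corresponds to \<open>0\<close>.\<close>

lemma log_concave_inverse_ennreal:
  fixes F :: "'a::real_vector \<Rightarrow> ennreal"
  assumes pos: "\<And>x. 0 < F x"
    and F: "\<And>x y t u. 0 < t \<Longrightarrow> 0 < u \<Longrightarrow> t + u = 1 \<Longrightarrow> F (t *\<^sub>R x + u *\<^sub>R y) \<le> epow (F x) t * epow (F y) u"
  shows "log_concave (\<lambda>x. enn2real (inverse (F x)))"
proof (rule log_concaveI)
  fix x y :: 'a and t u :: real
  assume tu: "0 < t" "0 < u" "t + u = 1" and p: "0 < enn2real (inverse (F x))" "0 < enn2real (inverse (F y))"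
  obtain A where A: "F x = ennreal A" "0 < A" using p(1) pos[of x] by (cases "F x") auto
  obtain B where B: "F y = ennreal B" "0 < B" using p(2) pos[of y] by (cases "F y") auto
  have le: "F (t *\<^sub>R x + u *\<^sub>R y) \<le> ennreal (A powr t * B powr u)"
    using F[OF tu, of x y] A B by (simp add: ennreal_mult)
  obtain C where C: "F (t *\<^sub>R x + u *\<^sub>R y) = ennreal C" "0 < C"
    using le pos[of "t *\<^sub>R x + u *\<^sub>R y"] by (cases "F (t *\<^sub>R x + u *\<^sub>R y)") (auto simp: top_unique)
  have "C \<le> A powr t * B powr u" using le C A B by (simp add: ennreal_le_iff)
  then have "inverse (A powr t * B powr u) \<le> inverse C" using C by (intro le_imp_inverse_le)
  moreover have "inverse (A powr t * B powr u) = inverse A powr t * inverse B powr u"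
    using A B by (simp add: inverse_eq_divide powr_divide)
  ultimately show "enn2real (inverse (F x)) powr t * enn2real (inverse (F y)) powr u
      \<le> enn2real (inverse (F (t *\<^sub>R x + u *\<^sub>R y)))"
    using A B C by (simp add: inverse_ennreal)
qed simp

context schroedinger
begin

text \<open>The factor \<open>1 / Z \<phi>\<close>, which is \<open>0\<close> where \<open>Z \<phi> =
\<infinity>\<close>.\<close>

definition q :: "('a \<Rightarrow> real) \<Rightarrow> 'a \<Rightarrow> real" where
  "q \<phi> y = enn2real (inverse (Z \<phi> y))"

lemma q_borel [measurable]:
  assumes [measurable]: "\<phi> \<in> borel_measurable borel"
  shows "q \<phi> \<in> borel_measurable borel"
  unfolding q_def by measurable

lemma q_nonneg: "0 \<le> q \<phi> y" by (simp add: q_def)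

lemma Z_q:
  assumes "\<phi> \<in> borel_measurable borel" "Z \<phi> y < \<infinity>"
  shows "0 < enn2real (Z \<phi> y)" "ennreal (enn2real (Z \<phi> y)) = Z \<phi> y"
    "q \<phi> y = 1 / enn2real (Z \<phi> y)" "0 < q \<phi> y" "Z \<phi> y * ennreal (q \<phi> y) = 1"
proof -
  obtain z where z: "Z \<phi> y = ennreal z" "0 < z"
    using Z_pos[OF assms(1), of y] assms(2) by (cases "Z \<phi> y") auto
  then show "0 < enn2real (Z \<phi> y)" "ennreal (enn2real (Z \<phi> y)) = Z \<phi> y"
    "q \<phi> y = 1 / enn2real (Z \<phi> y)" "0 < q \<phi> y" "Z \<phi> y * ennreal (q \<phi> y) = 1"
    by (simp_all add: q_def inverse_ennreal inverse_eq_divide ennreal_mult[symmetric])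
qed

lemma q_le:
  assumes "\<phi> \<in> potentials" "norm y \<le> r"
  shows "q \<phi> y \<le> 1 / z0"
proof (cases "Z \<phi> y < \<infinity>")
  case True
  note Zq = Z_q[OF potentials_borel[OF assms(1)] True]
  have "z0 \<le> enn2real (Z \<phi> y)"
    using Z_lower[OF assms] Zq by (metis enn2real_ennreal enn2real_mono infinity_ennreal_def True less_imp_le z0(2))
  then show ?thesis using z0(2) Zq by (simp add: frac_le)
next
  case False
  then have "Z \<phi> y = top" by (metis infinity_ennreal_def top.not_eq_extremum)
  then show ?thesis using z0(2) by (simp add: q_def)
qed

text \<open>The density of \<open>\<mu>\<close> and the Mehler kernel turn \<open>Z \<phi>\<close> into a
Gaussian average of a log-convex function.\<close>

lemma Z_average:
  assumes "\<phi> \<in> potentials"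
  shows "Z \<phi> y = ennreal (c0 * exp (b * (norm y)\<^sup>2)) *
    (\<integral>\<^sup>+z. ennreal (exp ((\<lambda>x. V x - \<phi> x + b * (norm x)\<^sup>2) (s *\<^sub>R y + sqrt (1 - s\<^sup>2) *\<^sub>R z))) \<partial>std_gaussian)"
proof -
  note [measurable] = potentials_borel[OF assms]
  let ?f = "\<lambda>x. V x - \<phi> x + b * (norm x)\<^sup>2"
  have "Z \<phi> y = (\<integral>\<^sup>+x. ennreal (exp (V x)) * ennreal (exp (a * (x \<bullet> y) - \<phi> x)) \<partial>std_gaussian)"
    unfolding Z_def by (rule nn_integral_\<mu>) measurable
  also have "\<dots> = (\<integral>\<^sup>+x. ennreal (c0 * exp (b * (norm y)\<^sup>2)) * (ennreal (exp (?f x)) * ennreal (mehler s y x)) \<partial>std_gaussian)"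
  proof (rule nn_integral_cong)
    fix x :: 'a
    have "exp (V x) * exp (a * (x \<bullet> y) - \<phi> x) = c0 * exp (b * (norm y)\<^sup>2) * (exp (?f x) * mehler s y x)"
      using c0_pos by (simp add: mehler_eq exp_add[symmetric] inner_commute algebra_simps)
    then show "ennreal (exp (V x)) * ennreal (exp (a * (x \<bullet> y) - \<phi> x)) =
       ennreal (c0 * exp (b * (norm y)\<^sup>2)) * (ennreal (exp (?f x)) * ennreal (mehler s y x))"
      using c0_pos mehler_pos[OF s, of y x] by (simp add: ennreal_mult[symmetric] less_imp_le)
  qed
  also have "\<dots> = ennreal (c0 * exp (b * (norm y)\<^sup>2)) * (\<integral>\<^sup>+x. ennreal (exp (?f x)) * ennreal (mehler s y x) \<partial>std_gaussian)"
    by (rule nn_integral_cmult) measurable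
  also have "(\<integral>\<^sup>+x. ennreal (exp (?f x)) * ennreal (mehler s y x) \<partial>std_gaussian)
     = (\<integral>\<^sup>+z. ennreal (exp (?f (s *\<^sub>R y + sqrt (1 - s\<^sup>2) *\<^sub>R z))) \<partial>std_gaussian)"
    by (rule mehler_average[OF _ s]) measurable
  finally show ?thesis .
qed

text \<open>Up to a constant, the factor depending on \<open>y\<close> in the density of the coupling with
respect to the reference measure.\<close>

definition target_weight :: "('a \<Rightarrow> real) \<Rightarrow> 'a \<Rightarrow> real" where
  "target_weight \<phi> y = w y * exp (b * (norm y)\<^sup>2) * q \<phi> y"

text \<open>The factor \<open>exp (b (norm y)\<^sup>2)\<close> cancels against the one in
\<open>Z_average\<close>, so that what remains is \<open>w\<close> divided by a log-convex function.\<close>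

lemma log_concave_target_weight:
  assumes \<phi>: "\<phi> \<in> potentials"
  shows "log_concave (target_weight \<phi>)"
proof -
  note [measurable] = potentials_borel[OF \<phi>]
  let ?f = "\<lambda>x. V x - \<phi> x + b * (norm x)\<^sup>2"
  define F where "F y = (\<integral>\<^sup>+z. ennreal (exp (?f (s *\<^sub>R y + sqrt (1 - s\<^sup>2) *\<^sub>R z))) \<partial>std_gaussian)" for y
  have Z: "Z \<phi> y = ennreal (c0 * exp (b * (norm y)\<^sup>2)) * F y" for y
    using Z_average[OF \<phi>] by (simp add: F_def)
  have Fpos: "0 < F y" for y
    using Z_pos[OF potentials_borel[OF \<phi>], of y] unfolding Z by (auto simp: zero_less_iff_neq_zero)
  have "log_concave (\<lambda>y. enn2real (inverse (F y)))"
  proof (rule log_concave_inverse_ennreal[OF Fpos])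
    fix x y :: 'a and t u :: real assume tu: "0 < t" "0 < u" "t + u = 1"
    show "F (t *\<^sub>R x + u *\<^sub>R y) \<le> epow (F x) t * epow (F y) u"
      unfolding F_def by (rule log_convex_gaussian_average[OF potentials_convex[OF \<phi>] tu])
  qed
  from log_concave_cmult[OF log_concave_mult[OF w this], of "1 / c0"]
  have "log_concave (\<lambda>y. 1 / c0 * (w y * enn2real (inverse (F y))))" using c0_pos by simp
  moreover have "1 / c0 * (w y * enn2real (inverse (F y))) = target_weight \<phi> y" for y
  proof (cases "F y")
    case (real v)
    then show ?thesis using Fpos[of y] c0_pos
      by (simp add: target_weight_def q_def Z ennreal_mult[symmetric] inverse_ennreal field_simps)
  next
    case top
    then show ?thesis using c0_pos by (simp add: target_weight_def q_def Z ennreal_mult_top)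
  qed
  ultimately show ?thesis by simp
qed

text \<open>The integral of \<open>exp (a (x \<bullet> y)) q \<phi> y\<close> in \<open>y\<close> is the
reciprocal of the factor in \<open>x\<close> that gives the correct first marginal; a Sinkhorn step
replaces \<open>\<phi>\<close> by \<open>ln U\<close>.\<close>

definition U :: "('a \<Rightarrow> real) \<Rightarrow> 'a \<Rightarrow> ennreal" where
  "U \<phi> x = (\<integral>\<^sup>+y. ennreal (exp (a * (x \<bullet> y)) * q \<phi> y) \<partial>\<nu>)"

lemma inner_bound: "norm y \<le> r \<Longrightarrow> a * (x \<bullet> y) \<le> a * r * norm x" for x y :: 'a
proof -
  assume y: "norm y \<le> r"
  have "x \<bullet> y \<le> norm x * r"
    using Cauchy_Schwarz_ineq2[of x y] mult_left_mono[OF y norm_ge_zero[of x]] by linarith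
  then have "a * (x \<bullet> y) \<le> a * (norm x * r)" using a_pos by (intro mult_left_mono) auto
  then show ?thesis by (simp add: ac_simps)
qed

lemma U_finite:
  assumes \<phi>: "\<phi> \<in> potentials"
  shows "U \<phi> x < \<infinity>"
proof -
  have "U \<phi> x \<le> (\<integral>\<^sup>+y. ennreal (exp (a * r * norm x) * (1 / z0)) \<partial>\<nu>)"
    unfolding U_def
  proof (rule nn_integral_mono_AE)
    show "AE y in \<nu>. ennreal (exp (a * (x \<bullet> y)) * q \<phi> y) \<le> ennreal (exp (a * r * norm x) * (1 / z0))"
      using supp by eventually_elim
        (intro ennreal_leI mult_mono q_le \<phi>, auto simp: q_nonneg inner_bound)
  qed
  also have "\<dots> < \<infinity>" using N.emeasure_space_1 by simp
  finally show ?thesis .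
qed

lemma U_pos:
  assumes \<phi>: "\<phi> \<in> potentials" and fin: "AE y in \<nu>. Z \<phi> y < \<infinity>"
  shows "0 < U \<phi> x"
proof -
  note [measurable] = potentials_borel[OF \<phi>]
  have "\<not> (AE y in \<nu>. ennreal (exp (a * (x \<bullet> y)) * q \<phi> y) = 0)"
  proof
    assume "AE y in \<nu>. ennreal (exp (a * (x \<bullet> y)) * q \<phi> y) = 0"
    with fin have "AE y in \<nu>. False"
    proof eventually_elim
      case (elim y)
      then show ?case using Z_q(4)[OF potentials_borel[OF \<phi>] elim(1)] q_nonneg[of \<phi> y]
        by (simp add: ennreal_eq_0_iff mult_le_0_iff)
    qed
    then show False by (simp add: N.AE_False)
  qed
  then have "U \<phi> x \<noteq> 0" unfolding U_def by (subst nn_integral_0_iff_AE) auto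
  then show ?thesis by (simp add: zero_less_iff_neq_zero)
qed

lemma U_le:
  assumes \<phi>: "\<phi> \<in> potentials"
  shows "U \<phi> x \<le> ennreal (exp (a * r * norm (x - x'))) * U \<phi> x'"
proof -
  note [measurable] = potentials_borel[OF \<phi>]
  have "U \<phi> x \<le> (\<integral>\<^sup>+y. ennreal (exp (a * r * norm (x - x'))) * ennreal (exp (a * (x' \<bullet> y)) * q \<phi> y) \<partial>\<nu>)"
    unfolding U_def
  proof (rule nn_integral_mono_AE)
    show "AE y in \<nu>. ennreal (exp (a * (x \<bullet> y)) * q \<phi> y)
      \<le> ennreal (exp (a * r * norm (x - x'))) * ennreal (exp (a * (x' \<bullet> y)) * q \<phi> y)"
      using supp
    proof eventually_elim
      case (elim y)
      have "a * (x \<bullet> y) \<le> a * r * norm (x - x') + a * (x' \<bullet> y)"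
        using inner_bound[OF elim, of "x - x'"] by (simp add: inner_diff_left algebra_simps)
      then have "exp (a * (x \<bullet> y)) \<le> exp (a * r * norm (x - x')) * exp (a * (x' \<bullet> y))"
        by (simp add: exp_add[symmetric])
      then have "exp (a * (x \<bullet> y)) * q \<phi> y \<le> exp (a * r * norm (x - x')) * exp (a * (x' \<bullet> y)) * q \<phi> y"
        by (rule mult_right_mono) (rule q_nonneg)
      then show ?case using q_nonneg[of \<phi> y] by (simp add: ennreal_mult[symmetric] ennreal_leI mult.assoc)
    qed
  qed
  also have "\<dots> = ennreal (exp (a * r * norm (x - x'))) * U \<phi> x'"
    unfolding U_def by (rule nn_integral_cmult) measurable
  finally show ?thesis .
qed

definition next_pot :: "('a \<Rightarrow> real) \<Rightarrow> 'a \<Rightarrow> real" where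
  "next_pot \<phi> x = ln (enn2real (U \<phi> x))"

lemma exp_next_pot:
  assumes "\<phi> \<in> potentials" "AE y in \<nu>. Z \<phi> y < \<infinity>"
  shows "ennreal (exp (next_pot \<phi> x)) = U \<phi> x"
  using U_finite[OF assms(1), of x] U_pos[OF assms, of x]
  by (cases "U \<phi> x") (auto simp: next_pot_def)

lemma next_pot_lip:
  assumes "\<phi> \<in> potentials" "AE y in \<nu>. Z \<phi> y < \<infinity>"
  shows "\<bar>next_pot \<phi> x - next_pot \<phi> y\<bar> \<le> a * r * norm (x - y)"
proof -
  have 1: "next_pot \<phi> x \<le> a * r * norm (x - y) + next_pot \<phi> y" for x y
  proof -
    have "ennreal (exp (next_pot \<phi> x)) \<le> ennreal (exp (a * r * norm (x - y)) * exp (next_pot \<phi> y))"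
      using U_le[OF assms(1), of x y] by (simp add: exp_next_pot[OF assms] ennreal_mult)
    then show ?thesis by (simp add: exp_add[symmetric])
  qed
  show ?thesis using 1[of x y] 1[of y x] by (simp add: norm_minus_commute abs_le_iff)
qed

lemma next_pot_borel:
  assumes "\<phi> \<in> potentials" "AE y in \<nu>. Z \<phi> y < \<infinity>"
  shows "next_pot \<phi> \<in> borel_measurable borel"
  by (rule lip_borel) (rule next_pot_lip[OF assms])

text \<open>The factor split off here is compensated by the term \<open>b (norm x)\<^sup>2\<close> in the
definition of the class of potentials; what remains is a Gaussian average of a log-concave function.\<close>

lemma U_average:
  assumes \<phi>: "\<phi> \<in> potentials"
  shows "U \<phi> x = ennreal (c0 * exp (b * (norm x)\<^sup>2)) *
    (\<integral>\<^sup>+z. ennreal (target_weight \<phi> (s *\<^sub>R x + sqrt (1 - s\<^sup>2) *\<^sub>R z)) \<partial>std_gaussian)"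
proof -
  note [measurable] = potentials_borel[OF \<phi>]
  have [measurable]: "target_weight \<phi> \<in> borel_measurable borel" unfolding target_weight_def[abs_def] by measurable
  have "U \<phi> x = (\<integral>\<^sup>+y. ennreal (w y) * ennreal (exp (a * (x \<bullet> y)) * q \<phi> y) \<partial>std_gaussian)"
    unfolding U_def by (rule nn_integral_\<nu>) measurable
  also have "\<dots> = (\<integral>\<^sup>+y. ennreal (c0 * exp (b * (norm x)\<^sup>2)) * (ennreal (target_weight \<phi> y) * ennreal (mehler s x y)) \<partial>std_gaussian)"
  proof (rule nn_integral_cong)
    fix y :: 'a
    have "w y * (exp (a * (x \<bullet> y)) * q \<phi> y) = w y * q \<phi> y * exp (b * (norm x)\<^sup>2 + b * (norm y)\<^sup>2 + (a * (x \<bullet> y) - b * ((norm x)\<^sup>2 + (norm y)\<^sup>2)))"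
      by (simp add: algebra_simps)
    also have "\<dots> = c0 * exp (b * (norm x)\<^sup>2) * (target_weight \<phi> y * mehler s x y)"
      using c0_pos unfolding exp_add by (simp add: mehler_eq target_weight_def)
    finally show "ennreal (w y) * ennreal (exp (a * (x \<bullet> y)) * q \<phi> y) =
       ennreal (c0 * exp (b * (norm x)\<^sup>2)) * (ennreal (target_weight \<phi> y) * ennreal (mehler s x y))"
      using c0_pos mehler_pos[OF s, of x y] w_nonneg[of y] q_nonneg[of \<phi> y]
      by (simp add: ennreal_mult[symmetric] less_imp_le target_weight_def)
  qed
  also have "\<dots> = ennreal (c0 * exp (b * (norm x)\<^sup>2)) * (\<integral>\<^sup>+y. ennreal (target_weight \<phi> y) * ennreal (mehler s x y) \<partial>std_gaussian)"
    by (rule nn_integral_cmult) measurable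
  also have "(\<integral>\<^sup>+y. ennreal (target_weight \<phi> y) * ennreal (mehler s x y) \<partial>std_gaussian)
     = (\<integral>\<^sup>+z. ennreal (target_weight \<phi> (s *\<^sub>R x + sqrt (1 - s\<^sup>2) *\<^sub>R z)) \<partial>std_gaussian)"
    by (rule mehler_average[OF _ s]) measurable
  finally show ?thesis .
qed

text \<open>By \<open>U_average\<close>, \<open>next_pot \<phi> x - b (norm x)\<^sup>2\<close> is, up to a
constant, the logarithm of a log-concave function, so subtracting it from \<open>V\<close> gives a
convex function.\<close>

lemma next_pot_potential:
  assumes \<phi>: "\<phi> \<in> potentials" and fin: "AE y in \<nu>. Z \<phi> y < \<infinity>"
  shows "(\<lambda>x. next_pot \<phi> x - next_pot \<phi> 0) \<in> potentials"
proof -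
  note [measurable] = potentials_borel[OF \<phi>]
  have [measurable]: "target_weight \<phi> \<in> borel_measurable borel" unfolding target_weight_def[abs_def] by measurable
  let ?k = "\<lambda>x. next_pot \<phi> x - ln c0 - b * (norm x)\<^sup>2"
  define G where "G x = (\<integral>\<^sup>+z. ennreal (target_weight \<phi> (s *\<^sub>R x + sqrt (1 - s\<^sup>2) *\<^sub>R z)) \<partial>std_gaussian)" for x
  have U: "U \<phi> x = ennreal (c0 * exp (b * (norm x)\<^sup>2)) * G x" for x
    using U_average[OF \<phi>] by (simp add: G_def)
  have G: "G x = ennreal (exp (?k x))" for x
  proof -
    obtain v where v: "G x = ennreal v" "0 < v"
      using U_finite[OF \<phi>, of x] U_pos[OF \<phi> fin, of x] c0_pos unfolding U
      by (cases "G x") (auto simp: ennreal_mult_top less_le)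
    have "next_pot \<phi> x = ln (c0 * exp (b * (norm x)\<^sup>2) * v)"
      using v c0_pos by (simp add: next_pot_def U ennreal_mult[symmetric])
    also have "\<dots> = ln c0 + b * (norm x)\<^sup>2 + ln v" using v c0_pos by (simp add: ln_mult)
    finally show ?thesis using v by simp
  qed
  have "convex_on UNIV (\<lambda>x. - (?k x))"
  proof (rule convex_onI)
    fix t :: real and x y :: 'a assume t: "0 < t" "t < 1"
    have "epow (G x) (1 - t) * epow (G y) t \<le> G ((1 - t) *\<^sub>R x + t *\<^sub>R y)"
      unfolding G_def using t by (intro log_concave_gaussian_average log_concave_target_weight \<phi>) auto
    then have "(1 - t) * (?k x) + t * (?k y)
       \<le> ?k ((1 - t) *\<^sub>R x + t *\<^sub>R y)"
      unfolding G by (simp add: ennreal_mult[symmetric] powr_def exp_add[symmetric])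
    then show "- (?k ((1 - t) *\<^sub>R x + t *\<^sub>R y))
       \<le> (1 - t) * - (?k x) + t * - (?k y)"
      unfolding mult_minus_right by linarith
  qed simp
  moreover have "convex_on UNIV (\<lambda>x::'a. next_pot \<phi> 0 - ln c0)" by (simp add: convex_on_const)
  ultimately have "convex_on UNIV (\<lambda>x. V x + (- (?k x) + (next_pot \<phi> 0 - ln c0)))"
    using V by (intro convex_on_add)
  then have "convex_on UNIV (\<lambda>x. V x - (next_pot \<phi> x - next_pot \<phi> 0) + b * (norm x)\<^sup>2)"
    by (simp add: algebra_simps)
  then show ?thesis
    using next_pot_lip[OF \<phi> fin] by (simp add: potentials_def)
qed

text \<open>Tonelli's theorem: both sides are the integral of \<open>exp (a (x \<bullet> y) - c x) q \<phi>
y\<close> over \<open>\<mu> \<Otimes> \<nu>\<close>.\<close>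

lemma nn_integral_U:
  assumes [measurable]: "c \<in> borel_measurable borel" and \<phi>: "\<phi> \<in> potentials"
  shows "(\<integral>\<^sup>+x. ennreal (exp (- c x)) * U \<phi> x \<partial>\<mu>) = (\<integral>\<^sup>+y. Z c y * ennreal (q \<phi> y) \<partial>\<nu>)"
proof -
  note [measurable] = potentials_borel[OF \<phi>]
  have "(\<integral>\<^sup>+x. ennreal (exp (- c x)) * U \<phi> x \<partial>\<mu>)
     = (\<integral>\<^sup>+x. \<integral>\<^sup>+y. ennreal (exp (- c x)) * ennreal (exp (a * (x \<bullet> y)) * q \<phi> y) \<partial>\<nu> \<partial>\<mu>)"
    unfolding U_def by (intro nn_integral_cong nn_integral_cmult[symmetric]) measurable
  also have "\<dots> = (\<integral>\<^sup>+y. \<integral>\<^sup>+x. ennreal (exp (- c x)) * ennreal (exp (a * (x \<bullet> y)) * q \<phi> y) \<partial>\<mu> \<partial>\<nu>)"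
    by (rule MN.Fubini'[symmetric]) measurable
  also have "\<dots> = (\<integral>\<^sup>+y. \<integral>\<^sup>+x. ennreal (exp (a * (x \<bullet> y) - c x)) * ennreal (q \<phi> y) \<partial>\<mu> \<partial>\<nu>)"
    using q_nonneg by (intro nn_integral_cong) (simp add: ennreal_mult[symmetric] exp_diff exp_minus field_simps)
  also have "\<dots> = (\<integral>\<^sup>+y. Z c y * ennreal (q \<phi> y) \<partial>\<nu>)"
    unfolding Z_def by (intro nn_integral_cong nn_integral_multc) measurable
  finally show ?thesis .
qed

lemma integrable_potential: "\<phi> \<in> potentials \<Longrightarrow> integrable \<mu> \<phi>"
  using integrable_norm_\<mu> ar_nonneg potentials_bound[of \<phi>] potentials_borel[of \<phi>]
  by (intro Bochner_Integration.integrable_bound[of \<mu> "\<lambda>x. a * r * norm x" \<phi>]) auto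

abbreviation lnZ :: "('a \<Rightarrow> real) \<Rightarrow> 'a \<Rightarrow> real" where
  "lnZ \<phi> y \<equiv> ln (enn2real (Z \<phi> y))"

lemma ln_Z_lower:
  assumes "\<phi> \<in> potentials" "norm y \<le> r" "Z \<phi> y < \<infinity>"
  shows "ln z0 \<le> lnZ \<phi> y"
proof -
  note Zq = Z_q[OF potentials_borel[OF assms(1)] assms(3)]
  have "ennreal z0 \<le> ennreal (enn2real (Z \<phi> y))" using Z_lower[OF assms(1,2)] Zq by simp
  then have "z0 \<le> enn2real (Z \<phi> y)" using z0(2) by (simp add: ennreal_le_iff)
  then show ?thesis using z0(2) Zq by (subst ln_le_cancel_iff) auto
qed

lemma dual_cost_finite:
  assumes \<phi>: "\<phi> \<in> potentials" and fin: "dual_cost \<phi> < \<infinity>"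
  shows "AE y in \<nu>. Z \<phi> y < \<infinity>" "integrable \<nu> (\<lambda>y. lnZ \<phi> y)"
proof -
  note [measurable] = potentials_borel[OF \<phi>]
  have f: "(\<integral>\<^sup>+y. eln (- ln z0) (Z \<phi> y) \<partial>\<nu>) < \<infinity>" using fin by (simp add: dual_cost_def)
  then have "AE y in \<nu>. eln (- ln z0) (Z \<phi> y) \<noteq> \<infinity>" by (intro nn_integral_PInf_AE) auto
  then show AE: "AE y in \<nu>. Z \<phi> y < \<infinity>"
    by eventually_elim (auto simp: eln_def less_top split: if_splits)
  have "integrable \<nu> (\<lambda>y. lnZ \<phi> y + (- ln z0))"
  proof (rule integrableI_nonneg)
    show "AE y in \<nu>. 0 \<le> lnZ \<phi> y + - ln z0"
      using AE supp by eventually_elim (use ln_Z_lower[OF \<phi>] in simp)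
    have "(\<integral>\<^sup>+y. ennreal (lnZ \<phi> y + - ln z0) \<partial>\<nu>) = (\<integral>\<^sup>+y. eln (- ln z0) (Z \<phi> y) \<partial>\<nu>)"
      by (rule nn_integral_cong_AE) (use AE in eventually_elim, auto simp: eln_def)
    then show "(\<integral>\<^sup>+y. ennreal (lnZ \<phi> y + - ln z0) \<partial>\<nu>) < \<infinity>" using f by simp
  qed measurable
  from Bochner_Integration.integrable_add[OF this, of "\<lambda>_. ln z0"]
  show "integrable \<nu> (\<lambda>y. lnZ \<phi> y)" by simp
qed

lemma dual_cost_eq:
  assumes \<phi>: "\<phi> \<in> potentials" and fin: "AE y in \<nu>. Z \<phi> y < \<infinity>"
    and int: "integrable \<nu> (\<lambda>y. lnZ \<phi> y)"
  defines "K \<equiv> (\<integral>x. a * r * norm x \<partial>\<mu>) - ln z0"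
  shows "dual_cost \<phi> = ennreal ((\<integral>x. \<phi> x \<partial>\<mu>) + (\<integral>y. lnZ \<phi> y \<partial>\<nu>) + K)"
    "0 \<le> (\<integral>x. \<phi> x \<partial>\<mu>) + (\<integral>y. lnZ \<phi> y \<partial>\<nu>) + K"
proof -
  note [measurable] = potentials_borel[OF \<phi>]
  have nn1: "0 \<le> \<phi> x + a * r * norm x" for x using potentials_bound[OF \<phi>, of x] by simp
  have i1: "integrable \<mu> (\<lambda>x. \<phi> x + a * r * norm x)"
    using integrable_potential[OF \<phi>] integrable_norm_\<mu> by simp
  have e1: "(\<integral>\<^sup>+x. ennreal (\<phi> x + a * r * norm x) \<partial>\<mu>) = ennreal (\<integral>x. \<phi> x + a * r * norm x \<partial>\<mu>)"
    using nn1 i1 by (intro nn_integral_eq_integral) auto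
  have nn2: "AE y in \<nu>. 0 \<le> lnZ \<phi> y - ln z0"
    using fin supp by eventually_elim (use ln_Z_lower[OF \<phi>] in simp)
  have i2: "integrable \<nu> (\<lambda>y. lnZ \<phi> y - ln z0)" using int by simp
  have "(\<integral>\<^sup>+y. eln (- ln z0) (Z \<phi> y) \<partial>\<nu>) = (\<integral>\<^sup>+y. ennreal (lnZ \<phi> y - ln z0) \<partial>\<nu>)"
    by (rule nn_integral_cong_AE) (use fin in eventually_elim, auto simp: eln_def)
  also have "\<dots> = ennreal (\<integral>y. lnZ \<phi> y - ln z0 \<partial>\<nu>)"
    by (rule nn_integral_eq_integral[OF i2 nn2])
  finally have e2: "(\<integral>\<^sup>+y. eln (- ln z0) (Z \<phi> y) \<partial>\<nu>) = ennreal (\<integral>y. lnZ \<phi> y - ln z0 \<partial>\<nu>)" .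
  have p: "0 \<le> (\<integral>x. \<phi> x + a * r * norm x \<partial>\<mu>)" "0 \<le> (\<integral>y. lnZ \<phi> y - ln z0 \<partial>\<nu>)"
    using nn1 nn2 by (auto intro: integral_nonneg_AE)
  have s1: "(\<integral>x. \<phi> x + a * r * norm x \<partial>\<mu>) = (\<integral>x. \<phi> x \<partial>\<mu>) + (\<integral>x. a * r * norm x \<partial>\<mu>)"
    using integrable_potential[OF \<phi>] integrable_norm_\<mu> by (intro Bochner_Integration.integral_add) auto
  have s2: "(\<integral>y. lnZ \<phi> y - ln z0 \<partial>\<nu>) = (\<integral>y. lnZ \<phi> y \<partial>\<nu>) - ln z0"
    using int by (subst Bochner_Integration.integral_diff) (auto simp: N.prob_space[simplified])
  show "dual_cost \<phi> = ennreal ((\<integral>x. \<phi> x \<partial>\<mu>) + (\<integral>y. lnZ \<phi> y \<partial>\<nu>) + K)"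
    "0 \<le> (\<integral>x. \<phi> x \<partial>\<mu>) + (\<integral>y. lnZ \<phi> y \<partial>\<nu>) + K"
    using p unfolding dual_cost_def e1 e2 s1 s2 K_def
    by (simp_all add: ennreal_plus[symmetric] algebra_simps del: ennreal_plus)
qed

text \<open>Let \<open>\<psi> = next_pot \<phi>\<close> and \<open>m = exp (\<psi> - \<phi>)\<close>, the
density of the first marginal of the current coupling with respect to \<open>\<mu>\<close>, so that
\<open>\<integral> m d\<mu> = 1\<close>. Also \<open>\<integral> Z \<psi> / Z \<phi> d\<nu> =
1\<close>, and \<open>ln t \<le> t - 1\<close> gives \<open>\<integral> ln (Z \<psi>) d\<nu> \<le>
\<integral> ln (Z \<phi>) d\<nu>\<close>. Adding a constant to a potential does not change the dual
cost, so minimality of \<open>\<phi>\<close> then forces \<open>\<integral> ln m d\<mu> \<ge>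
0\<close>, which is compatible with \<open>\<integral> m d\<mu> = 1\<close> only if \<open>m =
1\<close> almost everywhere.\<close>

lemma minimizer_fixed_point:
  assumes \<phi>: "\<phi> \<in> potentials" and cost: "dual_cost \<phi> < \<infinity>"
    and min: "\<And>\<phi>'. \<phi>' \<in> potentials \<Longrightarrow> dual_cost \<phi> \<le> dual_cost \<phi>'"
  shows "AE x in \<mu>. next_pot \<phi> x = \<phi> x"
proof -
  note [measurable] = potentials_borel[OF \<phi>]
  note fin = dual_cost_finite(1)[OF \<phi> cost] and intZ = dual_cost_finite(2)[OF \<phi> cost]
  let ?\<psi> = "next_pot \<phi>"
  define \<phi>' where "\<phi>' x = ?\<psi> x - ?\<psi> 0" for x
  have \<phi>': "\<phi>' \<in> potentials" unfolding \<phi>'_def[abs_def] by (rule next_pot_potential[OF \<phi> fin])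
  note [measurable] = next_pot_borel[OF \<phi> fin] potentials_borel[OF \<phi>']
  have Z': "Z \<phi>' y = ennreal (exp (?\<psi> 0)) * Z ?\<psi> y" for y
    unfolding Z_def \<phi>'_def
    by (subst nn_integral_cmult[symmetric]) (auto simp: ennreal_mult[symmetric] exp_add[symmetric] intro!: nn_integral_cong)
  have "(\<integral>\<^sup>+y. Z ?\<psi> y * ennreal (q \<phi> y) \<partial>\<nu>) = (\<integral>\<^sup>+x. ennreal (exp (- ?\<psi> x)) * U \<phi> x \<partial>\<mu>)"
    by (rule nn_integral_U[symmetric, OF _ \<phi>]) measurable
  also have "\<dots> = (\<integral>\<^sup>+x. 1 \<partial>\<mu>)"
    by (intro nn_integral_cong) (simp add: exp_next_pot[OF \<phi> fin, symmetric] ennreal_mult[symmetric] exp_add[symmetric])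
  also have "\<dots> = 1" using M.emeasure_space_1 by simp
  finally have Zq1: "(\<integral>\<^sup>+y. Z ?\<psi> y * ennreal (q \<phi> y) \<partial>\<nu>) = 1" .
  then have "AE y in \<nu>. Z ?\<psi> y * ennreal (q \<phi> y) \<noteq> \<infinity>"
    by (intro nn_integral_PInf_AE) auto
  with fin have fin\<psi>: "AE y in \<nu>. Z ?\<psi> y < \<infinity>"
  proof eventually_elim
    case (elim y)
    then show ?case using Z_q(4)[OF potentials_borel[OF \<phi>] elim(1)]
      by (cases "Z ?\<psi> y") (auto simp: ennreal_top_mult)
  qed
  then have fin': "AE y in \<nu>. Z \<phi>' y < \<infinity>"
    by eventually_elim (simp add: Z' ennreal_mult_less_top)
  \<comment> \<open>the ratio \<open>Z \<psi> / Z \<phi>\<close>, of integral 1\<close>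
  define T where "T y = enn2real (Z ?\<psi> y) * q \<phi> y" for y
  have [measurable]: "T \<in> borel_measurable borel" unfolding T_def[abs_def] by measurable
  have T_nn: "0 \<le> T y" for y by (simp add: T_def q_nonneg)
  have "(\<integral>\<^sup>+y. ennreal (T y) \<partial>\<nu>) = (\<integral>\<^sup>+y. Z ?\<psi> y * ennreal (q \<phi> y) \<partial>\<nu>)"
    by (rule nn_integral_cong_AE, use fin\<psi> in eventually_elim)
       (simp add: T_def ennreal_mult q_nonneg less_top[symmetric])
  then have "(\<integral>\<^sup>+y. ennreal (T y) \<partial>\<nu>) = ennreal 1" using Zq1 by simp
  then have T: "integrable \<nu> T" "(\<integral>y. T y \<partial>\<nu>) = 1"
    using nn_integral_eq_integrable[of T \<nu> 1] T_nn by simp_all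
  have lnZ': "AE y in \<nu>. lnZ \<phi>' y \<le> lnZ \<phi> y + (T y - 1) + ?\<psi> 0 \<and>
      ln z0 \<le> lnZ \<phi>' y"
    using fin fin\<psi> fin' supp
  proof eventually_elim
    case (elim y)
    note A = Z_q[OF potentials_borel[OF \<phi>] elim(1)] and B = Z_q[OF next_pot_borel[OF \<phi> fin] elim(2)]
    have "enn2real (Z \<phi>' y) = exp (?\<psi> 0) * enn2real (Z ?\<psi> y)"
      by (simp add: Z' enn2real_mult)
    then have 1: "lnZ \<phi>' y = ?\<psi> 0 + lnZ ?\<psi> y"
      using B(1) by (simp add: ln_mult)
    have "0 < T y" using A(4) B(1) by (simp add: T_def)
    then have "ln (T y) \<le> T y - 1" by (rule ln_le_minus_one)
    moreover have "ln (T y) = lnZ ?\<psi> y - lnZ \<phi> y"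
      using A(1) B(1) by (simp add: T_def A(3) ln_div)
    ultimately show ?case using 1 ln_Z_lower[OF \<phi>' elim(4,3)] by simp
  qed
  have intZ': "integrable \<nu> (\<lambda>y. lnZ \<phi>' y)"
  proof (rule Bochner_Integration.integrable_bound)
    show "integrable \<nu> (\<lambda>y. \<bar>lnZ \<phi> y\<bar> + (T y + 1) + \<bar>?\<psi> 0\<bar> + \<bar>ln z0\<bar>)"
      using intZ T(1) by simp
    show "AE y in \<nu>. norm (lnZ \<phi>' y) \<le> norm (\<bar>lnZ \<phi> y\<bar> + (T y + 1) + \<bar>?\<psi> 0\<bar> + \<bar>ln z0\<bar>)"
      using lnZ'
    proof eventually_elim
      case (elim y)
      then show ?case using T_nn[of y] unfolding real_norm_def by linarith
    qed
  qed measurable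
  have "(\<integral>y. lnZ \<phi>' y \<partial>\<nu>) \<le> (\<integral>y. lnZ \<phi> y + (T y - 1) + ?\<psi> 0 \<partial>\<nu>)"
    using intZ' intZ T(1) lnZ' by (intro integral_mono_AE) auto
  also have "\<dots> = (\<integral>y. lnZ \<phi> y \<partial>\<nu>) + ?\<psi> 0"
    using intZ T N.prob_space by simp
  finally have le1: "(\<integral>y. lnZ \<phi>' y \<partial>\<nu>) \<le> (\<integral>y. lnZ \<phi> y \<partial>\<nu>) + ?\<psi> 0" .
  have le2: "(\<integral>x. \<phi> x \<partial>\<mu>) + (\<integral>y. lnZ \<phi> y \<partial>\<nu>) \<le> (\<integral>x. \<phi>' x \<partial>\<mu>) + (\<integral>y. lnZ \<phi>' y \<partial>\<nu>)"
    using min[OF \<phi>'] dual_cost_eq(2)[OF \<phi>' fin' intZ']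
    unfolding dual_cost_eq(1)[OF \<phi> fin intZ] dual_cost_eq(1)[OF \<phi>' fin' intZ'] by (simp add: ennreal_le_iff)
  have int\<psi>: "integrable \<mu> ?\<psi>"
    using Bochner_Integration.integrable_add[OF integrable_potential[OF \<phi>'], of "\<lambda>_. ?\<psi> 0"]
    by (simp add: \<phi>'_def)
  have "(\<integral>x. \<phi>' x \<partial>\<mu>) = (\<integral>x. ?\<psi> x \<partial>\<mu>) - ?\<psi> 0"
    unfolding \<phi>'_def using int\<psi> M.prob_space by simp
  with le1 le2 have le3: "(\<integral>x. \<phi> x \<partial>\<mu>) \<le> (\<integral>x. ?\<psi> x \<partial>\<mu>)" by simp
  define m where "m x = exp (?\<psi> x - \<phi> x)" for x
  have [measurable]: "m \<in> borel_measurable borel" unfolding m_def[abs_def] by measurable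
  have m_nn: "0 \<le> m x" for x by (simp add: m_def)
  have "(\<integral>\<^sup>+x. ennreal (m x) \<partial>\<mu>) = (\<integral>\<^sup>+x. ennreal (exp (- \<phi> x)) * U \<phi> x \<partial>\<mu>)"
    by (intro nn_integral_cong)
       (simp add: m_def exp_next_pot[OF \<phi> fin, symmetric] ennreal_mult[symmetric] exp_add[symmetric])
  also have "\<dots> = (\<integral>\<^sup>+y. Z \<phi> y * ennreal (q \<phi> y) \<partial>\<nu>)" by (rule nn_integral_U[OF _ \<phi>]) measurable
  also have "\<dots> = (\<integral>\<^sup>+y. 1 \<partial>\<nu>)"
    by (rule nn_integral_cong_AE, use fin in eventually_elim) (rule Z_q(5)[OF potentials_borel[OF \<phi>]])
  also have "\<dots> = ennreal 1" using N.emeasure_space_1 by simp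
  finally have "(\<integral>\<^sup>+x. ennreal (m x) \<partial>\<mu>) = ennreal 1" .
  then have m: "integrable \<mu> m" "(\<integral>x. m x \<partial>\<mu>) = 1"
    using nn_integral_eq_integrable[of m \<mu> 1] m_nn by simp_all
  let ?d = "\<lambda>x. m x - 1 - (?\<psi> x - \<phi> x)"
  have d_nn: "0 \<le> ?d x" for x
    using exp_ge_add_one_self[of "?\<psi> x - \<phi> x"] unfolding m_def by linarith
  have d_int: "integrable \<mu> ?d" using m int\<psi> integrable_potential[OF \<phi>] by simp
  have "(\<integral>x. ?d x \<partial>\<mu>) = (\<integral>x. \<phi> x \<partial>\<mu>) - (\<integral>x. ?\<psi> x \<partial>\<mu>)"
    using m int\<psi> integrable_potential[OF \<phi>] M.prob_space by simp
  then have "(\<integral>x. ?d x \<partial>\<mu>) = 0" using le3 Bochner_Integration.integral_nonneg[of \<mu> ?d] d_nn by simp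
  then have "AE x in \<mu>. ?d x = 0"
    using d_nn d_int by (subst (asm) integral_nonneg_eq_0_iff_AE) auto
  then show ?thesis
  proof eventually_elim
    case (elim x)
    have "ln (m x) = m x - 1" using elim by (simp add: m_def)
    then have "m x = 1" by (intro ln_eq_minus_one) (auto simp: m_def)
    then show ?case by (simp add: m_def)
  qed
qed

text \<open>For \<open>\<psi> = next_pot \<phi>\<close> the first marginal constraint holds everywhere by
construction. The second one holds with \<open>\<phi>\<close> in place of \<open>\<psi>\<close>, and
the two agree almost everywhere if \<open>\<phi>\<close> is the minimizer.\<close>

theorem schroedinger_system:
  obtains \<psi> g :: "'a \<Rightarrow> real" where
    "\<And>x y. \<bar>\<psi> x - \<psi> y\<bar> \<le> a * r * norm (x - y)"
    "g \<in> borel_measurable borel" "\<And>y. 0 \<le> g y"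
    "\<And>x. (\<integral>\<^sup>+y. ennreal (exp (a * (x \<bullet> y) - \<psi> x) * g y) \<partial>\<nu>) = 1"
    "AE y in \<nu>. (\<integral>\<^sup>+x. ennreal (exp (a * (x \<bullet> y) - \<psi> x) * g y) \<partial>\<mu>) = 1"
    "log_concave (\<lambda>y. w y * exp (b * (norm y)\<^sup>2) * g y)"
    "AE y in \<nu>. 0 < g y" "integrable \<nu> (\<lambda>y. ln (g y))"
proof -
  obtain \<phi> where \<phi>: "\<phi> \<in> potentials" and cost: "dual_cost \<phi> < \<infinity>"
    and min: "\<And>\<phi>'. \<phi>' \<in> potentials \<Longrightarrow> dual_cost \<phi> \<le> dual_cost \<phi>'"
    using dual_cost_minimizer by blast
  note [measurable] = potentials_borel[OF \<phi>]
  note fin = dual_cost_finite(1)[OF \<phi> cost] and intZ = dual_cost_finite(2)[OF \<phi> cost]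
  note [measurable] = next_pot_borel[OF \<phi> fin]
  have fixed: "AE x in \<mu>. next_pot \<phi> x = \<phi> x"
    by (rule minimizer_fixed_point[OF \<phi> cost]) (rule min)
  show ?thesis
  proof (rule that[of "next_pot \<phi>" "q \<phi>"])
    show "\<bar>next_pot \<phi> x - next_pot \<phi> y\<bar> \<le> a * r * norm (x - y)" for x y
      by (rule next_pot_lip[OF \<phi> fin])
    show "q \<phi> \<in> borel_measurable borel" by measurable
    show "0 \<le> q \<phi> y" for y by (rule q_nonneg)
    show "(\<integral>\<^sup>+y. ennreal (exp (a * (x \<bullet> y) - next_pot \<phi> x) * q \<phi> y) \<partial>\<nu>) = 1" for x
    proof -
      have "(\<integral>\<^sup>+y. ennreal (exp (a * (x \<bullet> y) - next_pot \<phi> x) * q \<phi> y) \<partial>\<nu>)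
         = (\<integral>\<^sup>+y. ennreal (exp (- next_pot \<phi> x)) * ennreal (exp (a * (x \<bullet> y)) * q \<phi> y) \<partial>\<nu>)"
        using q_nonneg by (intro nn_integral_cong) (simp add: ennreal_mult[symmetric] exp_diff exp_minus field_simps)
      also have "\<dots> = ennreal (exp (- next_pot \<phi> x)) * U \<phi> x"
        unfolding U_def by (rule nn_integral_cmult) measurable
      also have "\<dots> = 1"
        by (simp add: exp_next_pot[OF \<phi> fin, symmetric] ennreal_mult[symmetric] exp_add[symmetric])
      finally show ?thesis .
    qed
    show "AE y in \<nu>. (\<integral>\<^sup>+x. ennreal (exp (a * (x \<bullet> y) - next_pot \<phi> x) * q \<phi> y) \<partial>\<mu>) = 1"
      using fin
    proof eventually_elim
      case (elim y)
      have "(\<integral>\<^sup>+x. ennreal (exp (a * (x \<bullet> y) - next_pot \<phi> x) * q \<phi> y) \<partial>\<mu>)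
        = (\<integral>\<^sup>+x. ennreal (exp (a * (x \<bullet> y) - \<phi> x)) * ennreal (q \<phi> y) \<partial>\<mu>)"
        by (rule nn_integral_cong_AE, use fixed in eventually_elim) (simp add: ennreal_mult q_nonneg)
      also have "\<dots> = Z \<phi> y * ennreal (q \<phi> y)"
        unfolding Z_def by (rule nn_integral_multc) measurable
      also have "\<dots> = 1" by (rule Z_q(5)[OF potentials_borel[OF \<phi>] elim])
      finally show ?case .
    qed
    show "log_concave (\<lambda>y. w y * exp (b * (norm y)\<^sup>2) * q \<phi> y)"
      using log_concave_target_weight[OF \<phi>] by (simp add: target_weight_def[abs_def])
    show "AE y in \<nu>. 0 < q \<phi> y"
      using fin by eventually_elim (rule Z_q(4)[OF potentials_borel[OF \<phi>]])
    have "integrable \<nu> (\<lambda>y. - lnZ \<phi> y)" using intZ by simp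
    moreover have "AE y in \<nu>. - lnZ \<phi> y = ln (q \<phi> y)"
      using fin
    proof eventually_elim
      case (elim y)
      then show ?case using Z_q(1,3)[OF potentials_borel[OF \<phi>] elim] by (simp add: ln_div)
    qed
    ultimately show "integrable \<nu> (\<lambda>y. ln (q \<phi> y))"
      by (subst (asm) integrable_cong_AE) auto
  qed
qed

end

section \<open>Entropy and the convex order\<close>

lemma eintegral_eq_integral:
  assumes "integrable M f"
  shows "eintegral M f = ereal (integral\<^sup>L M f)"
proof -
  have "(\<integral>\<^sup>+x. ennreal (f x) \<partial>M) \<noteq> \<infinity>" "(\<integral>\<^sup>+x. ennreal (- f x) \<partial>M) \<noteq> \<infinity>"
    using assms by (auto simp: real_integrable_def)
  then obtain p n where pn: "(\<integral>\<^sup>+x. ennreal (f x) \<partial>M) = ennreal p" "0 \<le> p"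
      "(\<integral>\<^sup>+x. ennreal (- f x) \<partial>M) = ennreal n" "0 \<le> n"
    by (cases "\<integral>\<^sup>+x. ennreal (f x) \<partial>M"; cases "\<integral>\<^sup>+x. ennreal (- f x) \<partial>M") auto
  then show ?thesis by (simp add: eintegral_def real_lebesgue_integral_def[OF assms])
qed

lemma integrable_from_eintegral_less_top:
  assumes [measurable]: "f \<in> borel_measurable M" and g: "integrable M g" "AE x in M. g x \<le> f x"
    and fin: "eintegral M f < \<infinity>"
  shows "integrable M f"
proof -
  have "(\<integral>\<^sup>+x. ennreal (- f x) \<partial>M) \<le> (\<integral>\<^sup>+x. ennreal (- g x) \<partial>M)"
    by (rule nn_integral_mono_AE, use g(2) in eventually_elim) (simp add: ennreal_leI)
  also have "\<dots> < \<infinity>" using g(1) by (auto simp: real_integrable_def less_top)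
  finally have neg: "(\<integral>\<^sup>+x. ennreal (- f x) \<partial>M) < \<infinity>" .
  have "(\<integral>\<^sup>+x. ennreal (f x) \<partial>M) \<noteq> \<infinity>"
    using fin by (auto simp: eintegral_def)
  with neg show ?thesis by (auto simp: real_integrable_def)
qed

text \<open>With \<open>D\<close> the density of \<open>\<alpha>\<close>, integrate \<open>ln (u / D) \<le> u /
D - 1\<close> against \<open>\<alpha>\<close>. The lower bound \<open>l\<close> excludes that
\<open>ln u\<close> has a negative part of infinite integral; the integrability of its positive part
is a consequence of the finite entropy.\<close>

lemma gibbs_inequality:
  fixes u l :: "'a \<Rightarrow> real"
  assumes \<beta>: "sigma_finite_measure \<beta>" and \<alpha>: "prob_space \<alpha>" and sets: "sets \<alpha> = sets \<beta>"
    and u [measurable]: "u \<in> borel_measurable \<beta>" and u_nn: "\<And>x. 0 \<le> u x"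
    and mass: "(\<integral>\<^sup>+x. ennreal (u x) \<partial>\<beta>) \<le> 1"
    and pos: "AE x in \<alpha>. 0 < u x" and l: "integrable \<alpha> l" "AE x in \<alpha>. l x \<le> ln (u x)"
    and fin: "rel_entropy \<alpha> \<beta> < \<infinity>"
  shows "integrable \<alpha> (\<lambda>x. ln (u x))" "ereal (\<integral>x. ln (u x) \<partial>\<alpha>) \<le> rel_entropy \<alpha> \<beta>"
proof -
  interpret B: sigma_finite_measure \<beta> by fact
  interpret A: prob_space \<alpha> by fact
  have ac: "absolutely_continuous \<beta> \<alpha>" and fin: "eintegral \<alpha> (entropy_density (exp 1) \<beta> \<alpha>) < \<infinity>"
    and re: "rel_entropy \<alpha> \<beta> = eintegral \<alpha> (entropy_density (exp 1) \<beta> \<alpha>)"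
    using fin by (auto simp: rel_entropy_def split: if_splits)
  define D where "D x = enn2real (RN_deriv \<beta> \<alpha> x)" for x
  have [measurable]: "D \<in> borel_measurable \<beta>" unfolding D_def[abs_def] by measurable
  note [measurable_cong] = sets
  have D_nn: "0 \<le> D x" for x by (simp add: D_def)
  have "AE x in \<beta>. RN_deriv \<beta> \<alpha> x \<noteq> \<infinity>"
    by (rule B.RN_deriv_finite) (use A.sigma_finite_measure_axioms ac sets in auto)
  then have "AE x in \<beta>. RN_deriv \<beta> \<alpha> x = ennreal (D x)"
    by eventually_elim (simp add: D_def less_top)
  then have "density \<beta> (RN_deriv \<beta> \<alpha>) = density \<beta> (\<lambda>x. ennreal (D x))"
    by (intro density_cong) auto
  then have \<alpha>_eq: "\<alpha> = density \<beta> (\<lambda>x. ennreal (D x))"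
    using B.density_RN_deriv[OF ac sets] by simp
  have D_pos: "AE x in \<alpha>. 0 < D x"
    by (subst \<alpha>_eq) (auto simp: AE_density)
  have L: "entropy_density (exp 1) \<beta> \<alpha> = (\<lambda>x. ln (D x))"
    by (auto simp: entropy_density_def D_def log_def fun_eq_iff)
  have key: "AE x in \<alpha>. ln (u x) \<le> ln (D x) + (u x / D x - 1)"
    using pos D_pos
  proof eventually_elim
    case (elim x)
    have "ln (u x / D x) \<le> u x / D x - 1" using elim by (intro ln_le_minus_one) simp
    then show ?case using elim by (simp add: ln_div)
  qed
  have "(\<integral>\<^sup>+x. ennreal (u x / D x) \<partial>\<alpha>) = (\<integral>\<^sup>+x. ennreal (D x) * ennreal (u x / D x) \<partial>\<beta>)"
    by (subst \<alpha>_eq, subst nn_integral_density) auto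
  also have "\<dots> \<le> (\<integral>\<^sup>+x. ennreal (u x) \<partial>\<beta>)"
  proof (rule nn_integral_mono)
    fix x
    show "ennreal (D x) * ennreal (u x / D x) \<le> ennreal (u x)"
      using D_nn[of x] u_nn[of x] by (cases "D x = 0") (auto simp: ennreal_mult[symmetric])
  qed
  also note mass
  finally have q1: "(\<integral>\<^sup>+x. ennreal (u x / D x) \<partial>\<alpha>) \<le> 1" .
  have q_int: "integrable \<alpha> (\<lambda>x. u x / D x)"
    using q1 u_nn D_nn by (intro integrableI_nonneg) (auto simp: order_le_less_trans)
  have "ennreal (\<integral>x. u x / D x \<partial>\<alpha>) \<le> 1"
    using q1 u_nn D_nn by (subst nn_integral_eq_integral[OF q_int, symmetric]) auto
  then have q_le: "(\<integral>x. u x / D x \<partial>\<alpha>) \<le> 1" by simp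
  have lnD: "integrable \<alpha> (\<lambda>x. ln (D x))"
  proof (rule integrable_from_eintegral_less_top)
    show "integrable \<alpha> (\<lambda>x. l x - (u x / D x - 1))" using l q_int by simp
    show "AE x in \<alpha>. l x - (u x / D x - 1) \<le> ln (D x)"
      using key l(2) by eventually_elim simp
    show "eintegral \<alpha> (\<lambda>x. ln (D x)) < \<infinity>" using fin L by simp
  qed measurable
  show int: "integrable \<alpha> (\<lambda>x. ln (u x))"
  proof (rule Bochner_Integration.integrable_bound)
    show "integrable \<alpha> (\<lambda>x. \<bar>l x\<bar> + (\<bar>ln (D x)\<bar> + (u x / D x + 1)))" using l q_int lnD by simp
    show "AE x in \<alpha>. norm (ln (u x)) \<le> norm (\<bar>l x\<bar> + (\<bar>ln (D x)\<bar> + (u x / D x + 1)))"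
      using key l(2)
    proof eventually_elim
      case (elim x)
      have "0 \<le> u x / D x" using u_nn D_nn by simp
      then show ?case using elim unfolding real_norm_def by linarith
    qed
  qed measurable
  have "(\<integral>x. ln (u x) \<partial>\<alpha>) \<le> (\<integral>x. ln (D x) + (u x / D x - 1) \<partial>\<alpha>)"
    using int lnD q_int key by (intro integral_mono_AE) auto
  also have "\<dots> = (\<integral>x. ln (D x) \<partial>\<alpha>) + ((\<integral>x. u x / D x \<partial>\<alpha>) - 1)"
    using lnD q_int A.prob_space by simp
  also have "\<dots> \<le> (\<integral>x. ln (D x) \<partial>\<alpha>)" using q_le by simp
  finally show "ereal (\<integral>x. ln (u x) \<partial>\<alpha>) \<le> rel_entropy \<alpha> \<beta>"
    by (simp add: re L eintegral_eq_integral[OF lnD])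
qed

lemma rel_entropy_density:
  fixes u :: "'a \<Rightarrow> real"
  assumes \<beta>: "sigma_finite_measure \<beta>" and u [measurable]: "u \<in> borel_measurable \<beta>" and u_nn: "\<And>x. 0 \<le> u x"
    and int: "integrable (density \<beta> u) (\<lambda>x. ln (u x))"
  shows "rel_entropy (density \<beta> u) \<beta> = ereal (\<integral>x. ln (u x) \<partial>density \<beta> u)"
proof -
  interpret B: sigma_finite_measure \<beta> by fact
  let ?\<alpha> = "density \<beta> u"
  have ac: "absolutely_continuous \<beta> ?\<alpha>" by (rule absolutely_continuousI_density) measurable
  have "AE x in \<beta>. ennreal (u x) = RN_deriv \<beta> ?\<alpha> x" by (rule B.RN_deriv_unique) auto
  then have "AE x in ?\<alpha>. ennreal (u x) = RN_deriv \<beta> ?\<alpha> x"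
    by (subst AE_density) auto
  then have ae: "AE x in ?\<alpha>. entropy_density (exp 1) \<beta> ?\<alpha> x = ln (u x)"
  proof eventually_elim
    case (elim x)
    have "enn2real (RN_deriv \<beta> ?\<alpha> x) = u x" using elim u_nn[of x] by (metis enn2real_ennreal)
    then show ?case by (simp add: entropy_density_def log_def)
  qed
  have "eintegral ?\<alpha> (entropy_density (exp 1) \<beta> ?\<alpha>) = eintegral ?\<alpha> (\<lambda>x. ln (u x))"
    unfolding eintegral_def
    by (intro arg_cong2[where f = "(-)"] arg_cong[where f = enn2ereal] nn_integral_cong_AE; use ae in eventually_elim) simp_all
  then show ?thesis using ac by (simp add: rel_entropy_def eintegral_eq_integral[OF int])
qed

text \<open>Each \<open>h n\<close> is real-valued and convex, hence admissible in the convex order, and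
\<open>k\<close> bounds its integral against \<open>\<nu>\<close>, hence also against
\<open>\<eta>\<close>, uniformly in \<open>n\<close>. Monotone convergence under
\<open>\<eta>\<close> gives the bound for the limit \<open>- ln v\<close>, and in particular that
\<open>v\<close> is positive \<open>\<eta>\<close>-almost everywhere.\<close>

lemma convex_order_monotone_limit:
  fixes h :: "nat \<Rightarrow> 'a::euclidean_space \<Rightarrow> real" and v :: "'a \<Rightarrow> real"
  assumes co: "\<eta> \<le>\<^sub>c \<nu>"
    and h: "\<And>n. convex_on UNIV (h n)" "\<And>y. incseq (\<lambda>n. h n y)" "\<And>n y. - A - K * norm y \<le> h n y"
    and k: "integrable \<nu> k" "\<And>n. AE y in \<nu>. h n y \<le> k y"
    and v: "\<And>y. (\<lambda>n. exp (- h n y)) \<longlonglongrightarrow> v y"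
  shows "AE y in \<eta>. 0 < v y" "integrable \<eta> (\<lambda>y. ln (v y))" "- (\<integral>y. k y \<partial>\<nu>) \<le> (\<integral>y. ln (v y) \<partial>\<eta>)"
proof -
  have \<eta>: "borel_prob \<eta>" "integrable \<eta> norm" and \<nu>: "borel_prob \<nu>" "integrable \<nu> norm"
    and le: "\<And>f. convex_on UNIV f \<Longrightarrow> eintegral \<eta> f \<le> eintegral \<nu> f"
    using co by (auto simp: convex_order_def)
  interpret E: prob_space \<eta> using \<eta> by (simp add: borel_prob_def)
  interpret N: prob_space \<nu> using \<nu> by (simp add: borel_prob_def)
  have [measurable_cong]: "sets \<eta> = sets borel" "sets \<nu> = sets borel" using \<eta> \<nu> by (auto simp: borel_prob_def)
  have [measurable]: "h n \<in> borel_measurable borel" for n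
    by (intro borel_measurable_continuous_onI convex_on_continuous h(1)) auto
  have [measurable]: "v \<in> borel_measurable borel"
    by (rule borel_measurable_LIMSEQ_real[OF v]) measurable
  let ?l = "\<lambda>y. - A - K * norm y"
  have l: "integrable \<eta> ?l" "integrable \<nu> ?l" using \<eta>(2) \<nu>(2) by auto
  have h\<nu>: "integrable \<nu> (h n)" for n
  proof (rule Bochner_Integration.integrable_bound)
    show "integrable \<nu> (\<lambda>y. \<bar>?l y\<bar> + \<bar>k y\<bar>)" using l k by simp
    show "AE y in \<nu>. norm (h n y) \<le> norm (\<bar>?l y\<bar> + \<bar>k y\<bar>)"
      using k(2)[of n]
    proof eventually_elim
      case (elim y)
      then show ?case using h(3)[where n = n and y = y] unfolding real_norm_def by linarith
    qed
  qed measurable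
  have int\<nu>: "(\<integral>y. h n y \<partial>\<nu>) \<le> (\<integral>y. k y \<partial>\<nu>)" for n
    using h\<nu> k by (intro integral_mono_AE) auto
  have ei: "eintegral \<eta> (h n) \<le> ereal (\<integral>y. k y \<partial>\<nu>)" for n
  proof -
    have "eintegral \<eta> (h n) \<le> eintegral \<nu> (h n)" by (rule le[OF h(1)])
    also have "\<dots> \<le> ereal (\<integral>y. k y \<partial>\<nu>)"
      using int\<nu>[of n] by (simp add: eintegral_eq_integral[OF h\<nu>])
    finally show ?thesis .
  qed
  have h\<eta>: "integrable \<eta> (h n)" for n
  proof (rule integrable_from_eintegral_less_top[OF _ l(1)])
    show "AE y in \<eta>. ?l y \<le> h n y" using h(3) by simp
    have "eintegral \<eta> (h n) \<le> ereal (\<integral>y. k y \<partial>\<nu>)" by (rule ei)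
    also have "\<dots> < \<infinity>" by simp
    finally show "eintegral \<eta> (h n) < \<infinity>" .
  qed measurable
  have int\<eta>: "(\<integral>y. h n y \<partial>\<eta>) \<le> (\<integral>y. k y \<partial>\<nu>)" for n
    using ei[of n] by (simp add: eintegral_eq_integral[OF h\<eta>])
  let ?G = "\<lambda>n y. ennreal (h n y - ?l y)"
  have G: "(\<integral>\<^sup>+y. ?G n y \<partial>\<eta>) \<le> ennreal ((\<integral>y. k y \<partial>\<nu>) - (\<integral>y. ?l y \<partial>\<eta>))" for n
  proof -
    have "(\<integral>\<^sup>+y. ?G n y \<partial>\<eta>) = ennreal (\<integral>y. h n y - ?l y \<partial>\<eta>)"
    proof (rule nn_integral_eq_integral)
      show "integrable \<eta> (\<lambda>y. h n y - ?l y)" by (rule Bochner_Integration.integrable_diff[OF h\<eta> l(1)])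
      show "AE y in \<eta>. 0 \<le> h n y - ?l y"
      proof (rule AE_I2)
        fix y show "0 \<le> h n y - ?l y" using h(3)[where n = n and y = y] by linarith
      qed
    qed
    also have "(\<integral>y. h n y - ?l y \<partial>\<eta>) = (\<integral>y. h n y \<partial>\<eta>) - (\<integral>y. ?l y \<partial>\<eta>)"
      using h\<eta>[of n] l(1) by (rule Bochner_Integration.integral_diff)
    finally show ?thesis using int\<eta>[of n] by (simp add: ennreal_leI)
  qed
  have "(\<integral>\<^sup>+y. (SUP n. ?G n y) \<partial>\<eta>) = (SUP n. \<integral>\<^sup>+y. ?G n y \<partial>\<eta>)"
    using h(2) by (intro nn_integral_monotone_convergence_SUP) (auto simp: incseq_def le_fun_def intro!: ennreal_leI)
  also have "\<dots> \<le> ennreal ((\<integral>y. k y \<partial>\<nu>) - (\<integral>y. ?l y \<partial>\<eta>))" by (rule SUP_least) (rule G)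
  finally have "(\<integral>\<^sup>+y. (SUP n. ?G n y) \<partial>\<eta>) \<noteq> \<infinity>" by (auto simp: top_unique)
  then have "AE y in \<eta>. (SUP n. ?G n y) \<noteq> \<infinity>" by (intro nn_integral_PInf_AE) auto
  then show pos: "AE y in \<eta>. 0 < v y"
  proof eventually_elim
    case (elim y)
    then obtain c where c: "(SUP n. ?G n y) = ennreal c" "0 \<le> c" by (cases "SUP n. ?G n y") auto
    have "exp (- (c + ?l y)) \<le> exp (- h n y)" for n
    proof -
      have "?G n y \<le> ennreal c" unfolding c(1)[symmetric] by (rule SUP_upper) simp
      then have "h n y - ?l y \<le> c" using c(2) by (simp add: ennreal_le_iff)
      then show ?thesis by simp
    qed
    then have "exp (- (c + ?l y)) \<le> v y" by (intro LIMSEQ_le_const[OF v]) auto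
    then show ?case by (rule less_le_trans[rotated]) simp
  qed
  have lim: "AE y in \<eta>. (\<lambda>n. h n y) \<longlonglongrightarrow> - ln (v y)"
    using pos
  proof eventually_elim
    case (elim y)
    have "(\<lambda>n. - ln (exp (- h n y))) \<longlonglongrightarrow> - ln (v y)"
      using elim by (intro tendsto_minus tendsto_ln v) auto
    then show ?case by simp
  qed
  have "incseq (\<lambda>n. \<integral>y. h n y \<partial>\<eta>)"
    using h\<eta> h(2) by (auto simp: incseq_def intro!: integral_mono)
  then obtain x where x: "(\<lambda>n. \<integral>y. h n y \<partial>\<eta>) \<longlonglongrightarrow> x"
    using incseq_convergent[of "\<lambda>n. \<integral>y. h n y \<partial>\<eta>"] int\<eta> by metis
  have mono: "AE y in \<eta>. mono (\<lambda>n. h n y)" using h(2) by simp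
  have "integrable \<eta> (\<lambda>y. - ln (v y))"
    by (rule integrable_monotone_convergence[OF h\<eta> mono lim x]) measurable
  then show "integrable \<eta> (\<lambda>y. ln (v y))" by simp
  have "(\<integral>y. - ln (v y) \<partial>\<eta>) = x"
    by (rule integral_monotone_convergence[OF h\<eta> mono lim x]) measurable
  moreover have "x \<le> (\<integral>y. k y \<partial>\<nu>)" by (rule LIMSEQ_le_const2[OF x]) (use int\<eta> in auto)
  ultimately show "- (\<integral>y. k y \<partial>\<nu>) \<le> (\<integral>y. ln (v y) \<partial>\<eta>)" by simp
qed

lemma sets_ref_measure: "sets (ref_measure \<epsilon>) = sets (borel \<Otimes>\<^sub>M borel)"
  unfolding borel_prod by (simp add: ref_measure_def)

text \<open>The reference measure is a probability measure, as the law of a random vector.\<close>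

lemma sigma_finite_ref_measure:
  assumes "0 < \<epsilon>"
  shows "sigma_finite_measure (ref_measure \<epsilon> :: ('a::euclidean_space \<times> 'a) measure)"
proof -
  interpret G: prob_space "std_gaussian :: 'a measure" by (rule prob_space_std_gaussian)
  interpret GG: pair_prob_space "std_gaussian :: 'a measure" "std_gaussian :: 'a measure" ..
  have "(\<lambda>(x, y). (x, exp (- \<epsilon> / 2) *\<^sub>R x + sqrt (1 - exp (- \<epsilon>)) *\<^sub>R y))
    \<in> measurable (std_gaussian \<Otimes>\<^sub>M std_gaussian) (borel :: ('a \<times> 'a) measure)"
    by (subst borel_prod[symmetric]) measurable
  then have "prob_space (ref_measure \<epsilon> :: ('a \<times> 'a) measure)"
    unfolding ref_measure_def by (rule GG.prob_space_distr)
  then show ?thesis by (rule prob_space_imp_sigma_finite)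
qed

lemma nn_integral_ref_measure:
  fixes f :: "'a::euclidean_space \<times> 'a \<Rightarrow> ennreal"
  assumes e: "0 < \<epsilon>" and [measurable]: "f \<in> borel_measurable (borel \<Otimes>\<^sub>M borel)"
  shows "(\<integral>\<^sup>+z. f z \<partial>ref_measure \<epsilon>) = (\<integral>\<^sup>+x. \<integral>\<^sup>+y. ennreal (mehler (exp (- \<epsilon> / 2)) x y) * f (x, y) \<partial>std_gaussian \<partial>std_gaussian)"
proof -
  interpret G: prob_space "std_gaussian :: 'a measure" by (rule prob_space_std_gaussian)
  show ?thesis
    unfolding ref_measure_eq_density[OF e]
    by (subst nn_integral_density) (auto simp: split_beta' G.nn_integral_fst[symmetric])
qed

lemma couplings_projections:
  fixes \<mu> \<eta> :: "'a::euclidean_space measure"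
  assumes "\<rho> \<in> couplings \<mu> \<eta>"
  shows "prob_space \<rho>" "sets \<rho> = sets (borel \<Otimes>\<^sub>M borel)" "\<mu> = distr \<rho> borel fst" "\<eta> = distr \<rho> borel snd"
    "fst \<in> measurable \<rho> borel" "snd \<in> measurable \<rho> borel"
proof -
  show *: "prob_space \<rho>" "sets \<rho> = sets (borel \<Otimes>\<^sub>M borel)" "\<mu> = distr \<rho> borel fst" "\<eta> = distr \<rho> borel snd"
    using assms unfolding borel_prod by (auto simp: couplings_def borel_prob_def)
  show "fst \<in> measurable \<rho> borel" "snd \<in> measurable \<rho> borel"
    by (simp_all add: measurable_cong_sets[OF *(2) refl])
qed

text \<open>The logarithm of a density of product form separates the variables, so its integral against a
coupling depends only on the marginals.\<close>

lemma coupling_product_density: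
  fixes F v :: "'a::euclidean_space \<Rightarrow> real"
  assumes \<rho>: "\<rho> \<in> couplings \<mu> \<eta>"
    and [measurable]: "F \<in> borel_measurable borel" "v \<in> borel_measurable borel"
    and pos: "AE y in \<eta>. 0 < v y" and int: "integrable \<eta> (\<lambda>y. ln (v y))"
  defines "u \<equiv> \<lambda>z. exp (F (fst z)) * v (snd z)"
  shows "AE z in \<rho>. 0 < u z" "AE z in \<rho>. ln (u z) = F (fst z) + ln (v (snd z))"
    "integrable \<rho> (\<lambda>z. ln (v (snd z)))"
    "integrable \<rho> (\<lambda>z. ln (u z)) \<longleftrightarrow> integrable \<mu> F"
    "integrable \<mu> F \<Longrightarrow> (\<integral>z. ln (u z) \<partial>\<rho>) = (\<integral>x. F x \<partial>\<mu>) + (\<integral>y. ln (v y) \<partial>\<eta>)"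
proof -
  note \<rho>' = couplings_projections[OF \<rho>]
  note [measurable] = \<rho>'(5,6)
  have [measurable]: "u \<in> borel_measurable \<rho>" unfolding u_def by measurable
  have v_pos: "AE z in \<rho>. 0 < v (snd z)"
    using pos unfolding \<rho>'(4) by (subst (asm) AE_distr_iff) auto
  then show "AE z in \<rho>. 0 < u z" by eventually_elim (simp add: u_def)
  show ln_u: "AE z in \<rho>. ln (u z) = F (fst z) + ln (v (snd z))"
    using v_pos by eventually_elim (simp add: u_def ln_mult)
  show v_int: "integrable \<rho> (\<lambda>z. ln (v (snd z)))"
    using int unfolding \<rho>'(4) by (subst (asm) integrable_distr_eq) auto
  have F_iff: "integrable \<mu> F \<longleftrightarrow> integrable \<rho> (\<lambda>z. F (fst z))"
    unfolding \<rho>'(3) by (subst integrable_distr_eq) auto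
  have "integrable \<rho> (\<lambda>z. ln (u z)) \<longleftrightarrow> integrable \<rho> (\<lambda>z. F (fst z) + ln (v (snd z)))"
    by (rule integrable_cong_AE[OF _ _ ln_u]) measurable
  also have "\<dots> \<longleftrightarrow> integrable \<rho> (\<lambda>z. F (fst z))"
    using Bochner_Integration.integrable_diff[OF _ v_int, of "\<lambda>z. F (fst z) + ln (v (snd z))"] v_int by auto
  finally show "integrable \<rho> (\<lambda>z. ln (u z)) \<longleftrightarrow> integrable \<mu> F" by (simp add: F_iff)
  assume "integrable \<mu> F"
  then have F_int: "integrable \<rho> (\<lambda>z. F (fst z))" by (simp add: F_iff)
  have "(\<integral>z. ln (u z) \<partial>\<rho>) = (\<integral>z. F (fst z) + ln (v (snd z)) \<partial>\<rho>)"
    by (rule integral_cong_AE[OF _ _ ln_u]) measurable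
  also have "\<dots> = (\<integral>z. F (fst z) \<partial>\<rho>) + (\<integral>z. ln (v (snd z)) \<partial>\<rho>)"
    by (rule Bochner_Integration.integral_add[OF F_int v_int])
  also have "(\<integral>z. F (fst z) \<partial>\<rho>) = (\<integral>x. F x \<partial>\<mu>)"
    unfolding \<rho>'(3) by (subst integral_distr) auto
  also have "(\<integral>z. ln (v (snd z)) \<partial>\<rho>) = (\<integral>y. ln (v y) \<partial>\<eta>)"
    unfolding \<rho>'(4) by (subst integral_distr) auto
  finally show "(\<integral>z. ln (u z) \<partial>\<rho>) = (\<integral>x. F x \<partial>\<mu>) + (\<integral>y. ln (v y) \<partial>\<eta>)" .
qed

text \<open>The logarithm of the density of \<open>\<pi>\<close> bounds the entropy of \<open>\<rho>\<close>
from below, by the Gibbs inequality. Since \<open>\<eta>\<close> may charge the null set where the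
regularizations of \<open>v\<close> do not converge to \<open>v\<close>, the Gibbs inequality is
applied with the limit \<open>v'\<close> of the regularizations instead, which does not change
integrals against the reference measure. The lower bound \<open>l\<close> makes the negative part of
\<open>F\<close> integrable; if the positive part is not integrable, no coupling of
\<open>\<mu>\<close> and \<open>\<eta>\<close> has finite entropy.\<close>

theorem log_concave_product_coupling_minimal:
  fixes F v l :: "'a::euclidean_space \<Rightarrow> real"
  assumes e: "0 < \<epsilon>" and co: "\<eta> \<le>\<^sub>c \<nu>"
    and F [measurable]: "F \<in> borel_measurable borel" and v [measurable]: "v \<in> borel_measurable borel"
    and v_lc: "log_concave v" and v_supp: "interior {y. 0 < v y} \<noteq> {}"
    and v_pos: "AE y in \<nu>. 0 < v y" and v_int: "integrable \<nu> (\<lambda>y. ln (v y))"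
    and l: "integrable \<mu> l" "\<And>x. l x \<le> F x"
  defines "\<pi> \<equiv> density (ref_measure \<epsilon>) (\<lambda>z. ennreal (exp (F (fst z)) * v (snd z)))"
  assumes \<pi>: "\<pi> \<in> couplings \<mu> \<nu>" and \<rho>: "\<rho> \<in> couplings \<mu> \<eta>"
  shows "rel_entropy \<pi> (ref_measure \<epsilon>) \<le> rel_entropy \<rho> (ref_measure \<epsilon>)"
proof (cases "rel_entropy \<rho> (ref_measure \<epsilon>) < \<infinity>")
  case False
  then show ?thesis by simp
next
  case True
  let ?R = "ref_measure \<epsilon> :: ('a \<times> 'a) measure"
  note R_meas = measurable_cong_sets[OF sets_ref_measure refl]
  note \<rho>' = couplings_projections[OF \<rho>] and \<pi>' = couplings_projections[OF \<pi>]
  obtain h :: "nat \<Rightarrow> 'a \<Rightarrow> real" and A K where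
    h: "\<And>n. convex_on UNIV (h n)" "\<And>y. incseq (\<lambda>n. h n y)" "\<And>n y. - A - K * norm y \<le> h n y"
      "\<And>n y. v y \<le> exp (- h n y)" "AE y in lborel. (\<lambda>n. exp (- h n y)) \<longlonglongrightarrow> v y"
    using log_concave_regularization[OF v_lc v_supp, of thesis] by blast
  obtain v' where v'_lim: "\<And>y. (\<lambda>n. exp (- h n y)) \<longlonglongrightarrow> v' y"
    by (rule exp_neg_incseq_limit[of h]) (use h(2) in auto)
  have [measurable]: "h n \<in> borel_measurable borel" for n
    by (intro borel_measurable_continuous_onI convex_on_continuous h(1)) auto
  have v' [measurable]: "v' \<in> borel_measurable borel"
    by (rule borel_measurable_LIMSEQ_real[OF v'_lim]) measurable
  have v'_nn: "0 \<le> v' y" for y by (rule LIMSEQ_le_const[OF v'_lim]) auto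
  have v'_eq: "AE y in lborel. v' y = v y"
    using h(5) by eventually_elim (metis v'_lim LIMSEQ_unique)
  have hk: "AE y in \<nu>. h n y \<le> - ln (v y)" for n
    using v_pos
  proof eventually_elim
    case (elim y)
    have "ln (v y) \<le> ln (exp (- h n y))" using elim h(4) by (subst ln_le_cancel_iff) auto
    then show ?case by simp
  qed
  have "integrable \<nu> (\<lambda>y. - ln (v y))" using v_int by simp
  from convex_order_monotone_limit[OF co h(1,2,3) this hk v'_lim]
  have v'_pos: "AE y in \<eta>. 0 < v' y" and v'_int: "integrable \<eta> (\<lambda>y. ln (v' y))"
    and v'_le: "(\<integral>y. ln (v y) \<partial>\<nu>) \<le> (\<integral>y. ln (v' y) \<partial>\<eta>)" by simp_all
  define u where "u z = exp (F (fst z)) * v' (snd z)" for z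
  have u [measurable]: "u \<in> borel_measurable (borel \<Otimes>\<^sub>M borel)" unfolding u_def by measurable
  have mass: "(\<integral>\<^sup>+z. ennreal (u z) \<partial>?R) = 1"
  proof -
    have "(\<integral>\<^sup>+z. ennreal (u z) \<partial>?R) = (\<integral>\<^sup>+z. ennreal (exp (F (fst z)) * v (snd z)) \<partial>?R)"
      by (simp add: nn_integral_ref_measure[OF e], intro nn_integral_cong nn_integral_cong_AE,
          unfold AE_std_gaussian_iff, use v'_eq in eventually_elim) (simp add: u_def)
    also have "\<dots> = emeasure \<pi> (space \<pi>)"
      unfolding \<pi>_def by (subst emeasure_density) (auto simp: R_meas intro!: nn_integral_cong)
    also have "\<dots> = 1" by (rule prob_space.emeasure_space_1[OF \<pi>'(1)])
    finally show ?thesis .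
  qed
  note prod' = coupling_product_density[OF \<rho> F v' v'_pos v'_int, folded u_def]
  have gibbs: "integrable \<rho> (\<lambda>z. ln (u z))" "ereal (\<integral>z. ln (u z) \<partial>\<rho>) \<le> rel_entropy \<rho> ?R"
  proof -
    have 1: "sets \<rho> = sets ?R" using \<rho>'(2) by (simp add: sets_ref_measure)
    have 2: "u \<in> borel_measurable ?R" using u by (simp add: R_meas)
    have 3: "0 \<le> u z" for z by (simp add: u_def v'_nn)
    have "integrable \<rho> (\<lambda>z. l (fst z))"
    proof -
      have "l \<in> borel_measurable borel"
        using borel_measurable_integrable[OF l(1)] by (subst (asm) \<rho>'(3)) simp
      then show ?thesis
        using l(1) \<rho>'(5) by (subst (asm) \<rho>'(3), subst (asm) integrable_distr_eq) auto
    qed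
    then have 4: "integrable \<rho> (\<lambda>z. l (fst z) + ln (v' (snd z)))"
      using prod'(3) by simp
    have 5: "AE z in \<rho>. l (fst z) + ln (v' (snd z)) \<le> ln (u z)"
      using prod'(2) by eventually_elim (use l(2) in simp)
    show "integrable \<rho> (\<lambda>z. ln (u z))" "ereal (\<integral>z. ln (u z) \<partial>\<rho>) \<le> rel_entropy \<rho> ?R"
      using gibbs_inequality[OF sigma_finite_ref_measure[OF e] \<rho>'(1) 1 2 3 _ prod'(1) 4 5 True] mass by simp_all
  qed
  have F_int: "integrable \<mu> F" using gibbs(1) by (simp add: prod'(4))
  let ?m = "(\<integral>x. F x \<partial>\<mu>) + (\<integral>y. ln (v y) \<partial>\<nu>)"
  have lower: "ereal ?m \<le> rel_entropy \<rho> ?R"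
    using gibbs(2) v'_le unfolding prod'(5)[OF F_int] by (metis add_left_mono ereal_less_eq(3) order_trans)
  note prod = coupling_product_density[OF \<pi> F v v_pos v_int]
  have "rel_entropy \<pi> ?R = ereal (\<integral>z. ln (exp (F (fst z)) * v (snd z)) \<partial>\<pi>)"
    unfolding \<pi>_def
  proof (rule rel_entropy_density[OF sigma_finite_ref_measure[OF e]])
    show "(\<lambda>z. exp (F (fst z)) * v (snd z)) \<in> borel_measurable ?R" unfolding R_meas by measurable
    show "0 \<le> exp (F (fst z)) * v (snd z)" for z by (simp add: log_concave_nonneg[OF v_lc])
  qed (use prod(4) F_int in \<open>simp add: \<pi>_def\<close>)
  then show ?thesis using lower by (simp add: prod(5)[OF F_int])
qed

section \<open>The optimal coupling\<close>

context schroedinger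
begin

lemma AE_\<nu>_w_pos: "AE y in \<nu>. 0 < w y"
  unfolding \<nu>_eq by (subst AE_density) auto

lemma AE_\<nu>_if_AE_lborel: "AE y in lborel. P y \<Longrightarrow> AE y in \<nu>. P y"
  unfolding \<nu>_eq by (subst AE_density) (auto simp: AE_std_gaussian_iff)

lemma log_concave_support_if_AE_pos:
  assumes "log_concave v" and "AE y in \<nu>. 0 < v y"
  shows "interior {y. 0 < v y} \<noteq> {}"
proof (rule log_concave_interior_support[OF assms(1)], rule notI)
  assume "AE x in lborel. v x = 0"
  from AE_\<nu>_if_AE_lborel[OF this] assms(2) have "AE y in \<nu>. False" by eventually_elim simp
  then show False by (simp add: N.AE_False)
qed

text \<open>The positive part is bounded on the ball that carries \<open>\<nu>\<close>, by the growth bound for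
log-concave functions. For the negative part, \<open>- w ln w \<le> 1\<close> and the Gaussian
measure is finite.\<close>

lemma integrable_ln_w: "integrable \<nu> (\<lambda>y. ln (w y))"
proof -
  obtain h :: "nat \<Rightarrow> 'a \<Rightarrow> real" and A K where
    h: "0 \<le> K" "\<And>n y. - A - K * norm y \<le> h n y" "\<And>n y. w y \<le> exp (- h n y)"
    using log_concave_regularization[OF w log_concave_support_if_AE_pos[OF w AE_\<nu>_w_pos], of thesis] by blast
  have "(\<integral>\<^sup>+y. ennreal (- ln (w y)) \<partial>\<nu>) = (\<integral>\<^sup>+y. ennreal (w y) * ennreal (- ln (w y)) \<partial>std_gaussian)"
    by (rule nn_integral_\<nu>) measurable
  also have "\<dots> \<le> (\<integral>\<^sup>+y. 1 \<partial>(std_gaussian :: 'a measure))"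
  proof (rule nn_integral_mono)
    fix y
    show "ennreal (w y) * ennreal (- ln (w y)) \<le> 1"
    proof (cases "0 < w y \<and> 0 \<le> - ln (w y)")
      case True
      have "ln (1 / w y) \<le> 1 / w y - 1" using True by (intro ln_le_minus_one) simp
      then have "- ln (w y) \<le> 1 / w y" using True by (simp add: ln_div)
      then have "w y * - ln (w y) \<le> w y * (1 / w y)" using True by (intro mult_left_mono) auto
      also have "\<dots> = 1" using True by simp
      finally show ?thesis using True by (simp add: ennreal_mult[symmetric] ennreal_le_1)
    next
      case False
      then have "w y = 0 \<or> - ln (w y) \<le> 0" using w_nonneg[of y] by linarith
      then show ?thesis by (auto simp: ennreal_neg)
    qed
  qed
  also have "\<dots> = 1" using prob_space.emeasure_space_1[OF prob_space_std_gaussian] by simp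
  finally have neg: "(\<integral>\<^sup>+y. ennreal (- ln (w y)) \<partial>\<nu>) < \<infinity>" by (simp add: order_le_less_trans)
  have "(\<integral>\<^sup>+y. ennreal (ln (w y)) \<partial>\<nu>) \<le> (\<integral>\<^sup>+y. ennreal (A + K * r) \<partial>\<nu>)"
  proof (rule nn_integral_mono_AE)
    show "AE y in \<nu>. ennreal (ln (w y)) \<le> ennreal (A + K * r)"
      using supp AE_\<nu>_w_pos
    proof eventually_elim
      case (elim y)
      have "ln (w y) \<le> ln (exp (- h 0 y))" using elim h(3) by (subst ln_le_cancel_iff) auto
      also have "\<dots> \<le> A + K * norm y" using h(2)[of y 0] by simp
      also have "\<dots> \<le> A + K * r" using elim h(1) by (simp add: mult_left_mono)
      finally show ?case by (rule ennreal_leI)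
    qed
  qed
  also have "\<dots> < \<infinity>" using N.emeasure_space_1 by simp
  finally show ?thesis using neg by (auto simp: real_integrable_def)
qed


text \<open>With respect to \<open>\<mu> \<Otimes> \<nu>\<close> the coupling has the density \<open>p x y = exp
(a (x \<bullet> y) - \<psi> x) g y\<close> given by the Schroedinger system. Dividing by the Mehler
kernel removes the interaction \<open>a (x \<bullet> y)\<close>, which leaves a product of functions
of one variable.\<close>

lemma schroedinger_coupling:
  assumes e: "0 < \<epsilon>" and s_eq: "s = exp (- \<epsilon> / 2)"
  obtains F v :: "'a \<Rightarrow> real" and k where
    "F \<in> borel_measurable borel" "v \<in> borel_measurable borel" "log_concave v"
    "AE y in \<nu>. 0 < v y" "integrable \<nu> (\<lambda>y. ln (v y))" "\<And>x. V x - a * r * norm x - k \<le> F x"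
    "density (ref_measure \<epsilon>) (\<lambda>z. ennreal (exp (F (fst z)) * v (snd z))) \<in> couplings \<mu> \<nu>"
proof -
  let ?G = "std_gaussian :: 'a measure"
  interpret G: prob_space ?G by (rule prob_space_std_gaussian)
  have sets_GG: "sets (?G \<Otimes>\<^sub>M ?G) = sets (borel \<Otimes>\<^sub>M borel)" and sets_MN: "sets (\<mu> \<Otimes>\<^sub>M \<nu>) = sets (borel \<Otimes>\<^sub>M borel)"
    by (rule sets_pair_measure_cong; simp)+
  obtain \<psi> g :: "'a \<Rightarrow> real" where
    lip: "\<And>x y. \<bar>\<psi> x - \<psi> y\<bar> \<le> a * r * norm (x - y)" and
    g [measurable]: "g \<in> borel_measurable borel" and g_nn: "\<And>y. 0 \<le> g y" and
    m1: "\<And>x. (\<integral>\<^sup>+y. ennreal (exp (a * (x \<bullet> y) - \<psi> x) * g y) \<partial>\<nu>) = 1" and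
    m2: "AE y in \<nu>. (\<integral>\<^sup>+x. ennreal (exp (a * (x \<bullet> y) - \<psi> x) * g y) \<partial>\<mu>) = 1" and
    lc: "log_concave (\<lambda>y. w y * exp (b * (norm y)\<^sup>2) * g y)" and
    g_pos: "AE y in \<nu>. 0 < g y" and g_int: "integrable \<nu> (\<lambda>y. ln (g y))"
    by (rule schroedinger_system) (rule that)
  have [measurable]: "\<psi> \<in> borel_measurable borel" by (rule lip_borel) (rule lip)
  define v where "v y = w y * exp (b * (norm y)\<^sup>2) * g y" for y
  have v [measurable]: "v \<in> borel_measurable borel" unfolding v_def[abs_def] by measurable
  have v_lc: "log_concave v" using lc by (simp add: v_def[abs_def])
  have v_pos: "AE y in \<nu>. 0 < v y"
    using AE_\<nu>_w_pos g_pos by eventually_elim (simp add: v_def)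
  have lnv: "AE y in \<nu>. ln (v y) = ln (w y) + b * (norm y)\<^sup>2 + ln (g y)"
    using AE_\<nu>_w_pos g_pos by eventually_elim (simp add: v_def ln_mult)
  have "integrable \<nu> (\<lambda>y. b * (norm y)\<^sup>2)"
    by (rule N.integrable_const_bound[of _ "b * r\<^sup>2"], use supp in eventually_elim)
       (use b_pos in \<open>auto intro!: mult_left_mono power_mono\<close>)
  then have "integrable \<nu> (\<lambda>y. ln (w y) + b * (norm y)\<^sup>2 + ln (g y))"
    using integrable_ln_w g_int by simp
  then have v_int: "integrable \<nu> (\<lambda>y. ln (v y))"
    by (subst integrable_cong_AE[OF _ _ lnv]) auto
  define F where "F x = ln c0 + V x + b * (norm x)\<^sup>2 - \<psi> x" for x
  have F [measurable]: "F \<in> borel_measurable borel" unfolding F_def[abs_def] by measurable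
  have F_lower: "V x - a * r * norm x - (\<bar>\<psi> 0\<bar> - ln c0) \<le> F x" for x
  proof -
    have "\<bar>\<psi> x - \<psi> 0\<bar> \<le> a * r * norm x" using lip[of x 0] by simp
    moreover have "0 \<le> b * (norm x)\<^sup>2" using b_pos by simp
    ultimately show ?thesis unfolding F_def by linarith
  qed
  define p where "p x y = exp (a * (x \<bullet> y) - \<psi> x) * g y" for x y
  have p [measurable]: "case_prod p \<in> borel_measurable (borel \<Otimes>\<^sub>M borel)"
    unfolding p_def by (simp add: split_beta')
  define \<pi> where "\<pi> = density (\<mu> \<Otimes>\<^sub>M \<nu>) (\<lambda>(x, y). ennreal (p x y))"
  have nn_\<pi>: "(\<integral>\<^sup>+z. f z \<partial>\<pi>) = (\<integral>\<^sup>+x. \<integral>\<^sup>+y. ennreal (p x y) * f (x, y) \<partial>\<nu> \<partial>\<mu>)"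
    if [measurable]: "f \<in> borel_measurable (borel \<Otimes>\<^sub>M borel)" for f
    unfolding \<pi>_def
    by (subst nn_integral_density) (auto simp: split_beta' N.nn_integral_fst[symmetric])
  have \<pi>_fst: "distr \<pi> borel fst = \<mu>"
  proof (rule measure_eqI)
    fix A assume "A \<in> sets (distr \<pi> borel fst)"
    then have [measurable]: "A \<in> sets borel" by simp
    have "emeasure (distr \<pi> borel fst) A = (\<integral>\<^sup>+z. indicator A (fst z) \<partial>\<pi>)"
      by (subst nn_integral_indicator[symmetric], simp, subst nn_integral_distr) (auto simp: \<pi>_def)
    also have "\<dots> = (\<integral>\<^sup>+x. \<integral>\<^sup>+y. ennreal (p x y) * indicator A x \<partial>\<nu> \<partial>\<mu>)"
      by (subst nn_\<pi>) auto
    also have "\<dots> = (\<integral>\<^sup>+x. indicator A x \<partial>\<mu>)"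
      by (intro nn_integral_cong) (simp add: nn_integral_multc m1 p_def)
    finally show "emeasure (distr \<pi> borel fst) A = emeasure \<mu> A" by simp
  qed simp
  have \<pi>_snd: "distr \<pi> borel snd = \<nu>"
  proof (rule measure_eqI)
    fix A assume "A \<in> sets (distr \<pi> borel snd)"
    then have [measurable]: "A \<in> sets borel" by simp
    have "emeasure (distr \<pi> borel snd) A = (\<integral>\<^sup>+z. indicator A (snd z) \<partial>\<pi>)"
      by (subst nn_integral_indicator[symmetric], simp, subst nn_integral_distr) (auto simp: \<pi>_def)
    also have "\<dots> = (\<integral>\<^sup>+x. \<integral>\<^sup>+y. ennreal (p x y) * indicator A y \<partial>\<nu> \<partial>\<mu>)"
      by (subst nn_\<pi>) auto
    also have "\<dots> = (\<integral>\<^sup>+y. \<integral>\<^sup>+x. ennreal (p x y) * indicator A y \<partial>\<mu> \<partial>\<nu>)"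
      by (rule MN.Fubini'[symmetric]) measurable
    also have "\<dots> = (\<integral>\<^sup>+y. indicator A y \<partial>\<nu>)"
      by (rule nn_integral_cong_AE, use m2 in eventually_elim) (simp add: nn_integral_multc p_def)
    finally show "emeasure (distr \<pi> borel snd) A = emeasure \<nu> A" by simp
  qed simp
  have "sets \<pi> = sets borel"
    by (simp only: \<pi>_def sets_MN borel_prod sets_density)
  moreover have "prob_space \<pi>"
    by (rule prob_space_distrD[of fst \<pi> borel]) (simp_all add: \<pi>_fst prob_\<mu>, simp add: \<pi>_def)
  ultimately have \<pi>: "\<pi> \<in> couplings \<mu> \<nu>"
    using \<pi>_fst \<pi>_snd by (simp add: couplings_def borel_prob_def)
  have dens: "ennreal (exp (V x)) * ennreal (w y) * ennreal (p x y) = ennreal (mehler s x y) * ennreal (exp (F x) * v y)"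
    for x y :: 'a
  proof -
    have "exp (V x) * w y * p x y = mehler s x y * (exp (F x) * v y)"
      using c0_pos unfolding p_def v_def F_def mehler_eq
      by (simp add: exp_add exp_diff field_simps)
    then show ?thesis
      using mehler_pos[OF s, of x y] w_nonneg[of y] g_nn[of y] log_concave_nonneg[OF v_lc, of y]
      by (simp add: ennreal_mult[symmetric] less_imp_le p_def)
  qed
  have "\<mu> \<Otimes>\<^sub>M \<nu> = density (?G \<Otimes>\<^sub>M ?G) (\<lambda>(x, y). ennreal (exp (V x)) * ennreal (w y))"
    unfolding \<mu>_eq \<nu>_eq
    by (rule pair_measure_density)
       (use G.sigma_finite_measure_axioms N.sigma_finite_measure_axioms in \<open>auto simp: \<nu>_eq[symmetric]\<close>)
  then have "\<pi> = density (ref_measure \<epsilon>) (\<lambda>z. ennreal (exp (F (fst z)) * v (snd z)))"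
    unfolding \<pi>_def ref_measure_eq_density[OF e] s_eq[symmetric]
    by (simp add: density_density_eq split_beta' dens)
  with \<pi> show ?thesis
    using that[OF F v v_lc v_pos v_int F_lower] by simp
qed

text \<open>The lower bound on \<open>V\<close> provides the integrable minorant of \<open>F\<close>, as
\<open>\<mu>\<close> has a first moment.\<close>

theorem entropic_cost_convex_order:
  assumes e: "0 < \<epsilon>" and s_eq: "s = exp (- \<epsilon> / 2)" and co: "\<eta> \<le>\<^sub>c \<nu>"
    and V_lower: "\<And>x. c \<le> V x"
  shows "entropic_cost \<epsilon> \<mu> \<nu> \<le> entropic_cost \<epsilon> \<mu> \<eta>"
proof -
  obtain F v :: "'a \<Rightarrow> real" and k where
    Fv: "F \<in> borel_measurable borel" "v \<in> borel_measurable borel" "log_concave v"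
    "AE y in \<nu>. 0 < v y" "integrable \<nu> (\<lambda>y. ln (v y))" and F: "\<And>x. V x - a * r * norm x - k \<le> F x"
    and \<pi>: "density (ref_measure \<epsilon>) (\<lambda>z. ennreal (exp (F (fst z)) * v (snd z))) \<in> couplings \<mu> \<nu>"
    by (rule schroedinger_coupling[OF e s_eq]) (rule that)
  have l: "integrable \<mu> (\<lambda>x. c - a * r * norm x - k)" "c - a * r * norm x - k \<le> F x" for x
    using integrable_norm_\<mu> V_lower[of x] F[of x] by auto
  show ?thesis
    unfolding entropic_cost_def[of \<epsilon> \<mu> \<eta>]
  proof (rule INF_greatest)
    fix \<rho> assume \<rho>: "\<rho> \<in> couplings \<mu> \<eta>"
    have "entropic_cost \<epsilon> \<mu> \<nu> \<le> rel_entropy (density (ref_measure \<epsilon>) (\<lambda>z. ennreal (exp (F (fst z)) * v (snd z)))) (ref_measure \<epsilon>)"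
      unfolding entropic_cost_def by (rule INF_lower[OF \<pi>])
    also have "\<dots> \<le> rel_entropy \<rho> (ref_measure \<epsilon>)"
      by (rule log_concave_product_coupling_minimal[OF e co Fv(1-3) _ Fv(4,5) l \<pi> \<rho>])
         (rule log_concave_support_if_AE_pos[OF Fv(3,4)])
    finally show "entropic_cost \<epsilon> \<mu> \<nu> \<le> rel_entropy \<rho> (ref_measure \<epsilon>)" .
  qed
qed

end

section \<open>Densities given by extended-valued convex functions\<close>

lemma eexp_simps [simp]: "eexp (ereal r) = ennreal (exp r)" "eexp \<infinity> = \<infinity>" "eexp (- \<infinity>) = 0"
  by (simp_all add: eexp_def infinity_ereal_def MInfty_eq_minfinity[symmetric] del: MInfty_eq_minfinity PInfty_eq_infinity)

text \<open>The integral of an arbitrary, possibly nonmeasurable function depends only on its almost everywhere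
class. This gives a meaning to densities that are irregular on a null set.\<close>

lemma density_cong_AE:
  assumes "AE x in M. f x = g x"
  shows "density M f = density M g"
proof -
  have "(\<integral>\<^sup>+x. f x * indicator A x \<partial>M) = (\<integral>\<^sup>+x. g x * indicator A x \<partial>M)" for A
    by (rule nn_integral_cong_AE, use assms in eventually_elim) simp
  then show ?thesis by (simp add: density_def)
qed

lemma econvex_log_concave:
  assumes f: "econvex f"
  shows "log_concave (\<lambda>x. enn2real (eexp (- f x)))"
proof (rule log_concaveI)
  fix x y and t u :: real
  assume tu: "0 < t" "0 < u" "t + u = 1"
    and p: "0 < enn2real (eexp (- f x))" "0 < enn2real (eexp (- f y))"
  have nm: "f z \<noteq> - \<infinity>" for z using f by (simp add: econvex_def)
  obtain a where a: "f x = ereal a" using p(1) nm[of x] by (cases "f x") auto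
  obtain b where b: "f y = ereal b" using p(2) nm[of y] by (cases "f y") auto
  have "f (t *\<^sub>R x + u *\<^sub>R y) \<le> ereal t * f x + ereal u * f y"
    using f tu by (auto simp: econvex_def)
  then have le: "f (t *\<^sub>R x + u *\<^sub>R y) \<le> ereal (t * a + u * b)" by (simp add: a b)
  then obtain c where c: "f (t *\<^sub>R x + u *\<^sub>R y) = ereal c" "c \<le> t * a + u * b"
    using nm[of "t *\<^sub>R x + u *\<^sub>R y"] by (cases "f (t *\<^sub>R x + u *\<^sub>R y)") auto
  then show "enn2real (eexp (- f x)) powr t * enn2real (eexp (- f y)) powr u \<le> enn2real (eexp (- f (t *\<^sub>R x + u *\<^sub>R y)))"
    by (simp add: a b powr_def exp_add[symmetric])
qed simp

text \<open>A point outside \<open>D\<close> is separated from \<open>D\<close> by a hyperplane, so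
\<open>D\<close> misses an open halfspace.\<close>

lemma convex_conull_eq_UNIV:
  fixes D :: "'a::euclidean_space set"
  assumes D: "convex D" and ae: "AE x in lborel. x \<in> D"
  shows "D = UNIV"
proof (rule ccontr)
  assume "D \<noteq> UNIV"
  then obtain x0 where x0: "x0 \<notin> D" by auto
  have "D \<noteq> {}"
  proof
    assume "D = {}"
    then have "AE x::'a in lborel. False" using ae by simp
    then have "(UNIV :: 'a set) \<in> null_sets lborel" by (simp add: eventually_False AE_iff_null_sets)
    then show False by (metis emeasure_lborel_UNIV null_setsD1 infinity_ennreal_def top_neq_ennreal ennreal_0 ennreal_top_neq_zero)
  qed
  then obtain a b where ab: "a \<noteq> 0" "\<And>x. x \<in> D \<Longrightarrow> a \<bullet> x \<le> b" "b \<le> a \<bullet> x0"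
    using separating_hyperplane_sets[OF D convex_singleton, of x0] x0 by auto
  let ?O = "{x. a \<bullet> x > b}"
  have O: "open ?O" by (rule open_halfspace_gt)
  have "0 < a \<bullet> a" using ab(1) by simp
  then have "b < a \<bullet> (x0 + a)" using ab(3) unfolding inner_add_right by linarith
  then have "x0 + a \<in> ?O" by simp
  then have ne: "?O \<noteq> {}" by blast
  have "AE x in lborel. x \<notin> ?O" using ae by eventually_elim (use ab(2) in force)
  then have "?O \<in> null_sets lborel" using O by (subst AE_iff_null_sets) auto
  then have "negligible ?O"
    using negligible_iff_null_sets null_sets_completionI by blast
  then show False using open_not_negligible[OF O ne] by simp
qed

text \<open>If \<open>V\<close> were infinite on a set of positive measure, so would be the total mass. Hence
the effective domain is convex and of full measure, which leaves only the whole space.\<close>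

lemma econvex_density_finite:
  fixes V :: "'a::euclidean_space \<Rightarrow> ereal"
  assumes V: "econvex V" and prob: "prob_space (density std_gaussian (\<lambda>x. eexp (V x)))"
  obtains f where "\<And>x. V x = ereal (f x)" "convex_on UNIV f"
proof -
  define v where "v x = enn2real (eexp (- V x))" for x
  have v_lc: "log_concave v" using econvex_log_concave[OF V] by (simp add: v_def[abs_def])
  have nm: "V x \<noteq> - \<infinity>" for x using V by (simp add: econvex_def)
  have eV: "eexp (V x) = inverse (ennreal (v x))" for x
    using nm[of x] by (cases "V x") (simp_all add: v_def inverse_ennreal exp_minus)
  have total: "emeasure (density std_gaussian g) UNIV = (\<integral>\<^sup>+x. g x \<partial>std_gaussian)"
    if "g \<in> borel_measurable borel" for g :: "'a \<Rightarrow> ennreal"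
    using that by (subst emeasure_density) auto
  have one: "(\<integral>\<^sup>+x. g x \<partial>std_gaussian) = 1"
    if "g \<in> borel_measurable borel" "AE x in std_gaussian. eexp (V x) = g x" for g :: "'a \<Rightarrow> ennreal"
    using prob_space.emeasure_space_1[OF prob] total[OF that(1)] by (simp add: density_cong_AE[OF that(2)])
  have nz: "\<not> (AE x in lborel. v x = 0)"
  proof
    assume "AE x in lborel. v x = 0"
    then have "AE x in std_gaussian. eexp (V x) = \<infinity>"
      unfolding AE_std_gaussian_iff by eventually_elim (simp add: eV)
    from one[OF _ this] have "(\<integral>\<^sup>+x. \<infinity> \<partial>(std_gaussian :: 'a measure)) = 1" by simp
    then show False
      using prob_space.emeasure_space_1[OF prob_space_std_gaussian[where 'a = 'a]] by simp
  qed
  obtain v' where v': "log_concave v'" and [measurable]: "v' \<in> borel_measurable borel" and vv': "AE x in lborel. v x = v' x"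
    by (rule log_concave_AE_eq_borel[OF v_lc nz])
  have "AE x in std_gaussian. eexp (V x) = inverse (ennreal (v' x))"
    unfolding AE_std_gaussian_iff using vv' by eventually_elim (simp add: eV)
  from one[OF _ this] have "(\<integral>\<^sup>+x. inverse (ennreal (v' x)) \<partial>std_gaussian) = 1" by simp
  then have "AE x in std_gaussian. inverse (ennreal (v' x)) \<noteq> \<infinity>"
    by (intro nn_integral_PInf_AE) auto
  then have "AE x in lborel. x \<in> {x. 0 < v x}"
    unfolding AE_std_gaussian_iff using vv'
    by eventually_elim (use log_concave_nonneg[OF v'] in \<open>auto simp: less_le\<close>)
  from convex_conull_eq_UNIV[OF log_concave_support_convex[OF v_lc] this] have pos: "0 < v x" for x by auto
  define f where "f x = real_of_ereal (V x)" for x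
  have Vf: "V x = ereal (f x)" for x
    using pos[of x] nm[of x] by (cases "V x") (auto simp: v_def f_def)
  moreover have "convex_on UNIV f"
  proof (rule convex_onI)
    fix t :: real and x y :: 'a assume t: "0 < t" "t < 1"
    have "V ((1 - t) *\<^sub>R x + t *\<^sub>R y) \<le> ereal (1 - t) * V x + ereal t * V y"
      using V t by (auto simp: econvex_def)
    then show "f ((1 - t) *\<^sub>R x + t *\<^sub>R y) \<le> (1 - t) * f x + t * f y" by (simp add: Vf)
  qed simp
  ultimately show ?thesis by (rule that)
qed

text \<open>The density may be changed on the frontier of the domain of \<open>W\<close>, which is a null set.\<close>

lemma econvex_neg_density_borel:
  fixes W :: "'a::euclidean_space \<Rightarrow> ereal"
  assumes W: "econvex W" and prob: "prob_space (density std_gaussian (\<lambda>x. eexp (- W x)))"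
  obtains w where "log_concave w" "w \<in> borel_measurable borel"
    "density std_gaussian (\<lambda>x. eexp (- W x)) = density std_gaussian (\<lambda>x. ennreal (w x))"
proof -
  define v where "v x = enn2real (eexp (- W x))" for x
  have v_lc: "log_concave v" using econvex_log_concave[OF W] by (simp add: v_def[abs_def])
  have nm: "W x \<noteq> - \<infinity>" for x using W by (simp add: econvex_def)
  have eW: "eexp (- W x) = ennreal (v x)" for x
    using nm[of x] by (cases "W x") (simp_all add: v_def)
  have nz: "\<not> (AE x in lborel. v x = 0)"
  proof
    assume "AE x in lborel. v x = 0"
    then have "AE x in std_gaussian. eexp (- W x) = 0"
      unfolding AE_std_gaussian_iff by eventually_elim (simp add: eW)
    then have "density std_gaussian (\<lambda>x. eexp (- W x)) = density std_gaussian (\<lambda>x::'a. 0)"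
      by (rule density_cong_AE)
    then show False
      using prob_space.emeasure_space_1[OF prob] by (simp add: emeasure_density)
  qed
  obtain w where w: "log_concave w" "w \<in> borel_measurable borel" and vw: "AE x in lborel. v x = w x"
    by (rule log_concave_AE_eq_borel[OF v_lc nz])
  have "AE x in std_gaussian. eexp (- W x) = ennreal (w x)"
    unfolding AE_std_gaussian_iff using vw by eventually_elim (simp add: eW)
  then show ?thesis using w by (intro that[of w] density_cong_AE)
qed

theorem theorem6:
  fixes V W :: "real ^ 'd \<Rightarrow> ereal"
    and \<mu> \<nu> \<eta> :: "(real ^ 'd) measure"
  assumes "econvex V" and "econvex W"
    and "\<mu> = density std_gaussian (\<lambda>x. eexp (V x))" and "prob_space \<mu>"
    and "\<nu> = density std_gaussian (\<lambda>x. eexp (- W x))" and "prob_space \<nu>"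
    and "integrable \<mu> (\<lambda>x. (norm x)\<^sup>2)"
    and "\<exists>K. compact K \<and> (AE x in \<nu>. x \<in> K)"
    and "\<exists>c::real. \<forall>x. ereal c \<le> V x"
    and "borel_prob \<eta>" and "\<eta> \<le>\<^sub>c \<nu>"
  shows "\<forall>\<epsilon>>0. entropic_cost \<epsilon> \<mu> \<eta> \<ge> entropic_cost \<epsilon> \<mu> \<nu>"
proof (intro allI impI)
  fix \<epsilon> :: real assume e: "0 < \<epsilon>"
  obtain f where f: "\<And>x. V x = ereal (f x)" "convex_on UNIV f"
    using econvex_density_finite[OF assms(1)] assms(3,4) by metis
  obtain w where w: "log_concave w" "w \<in> borel_measurable borel"
    and \<nu>: "\<nu> = density std_gaussian (\<lambda>x. ennreal (w x))"
    using econvex_neg_density_borel[OF assms(2)] assms(5,6) by metis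
  have \<mu>: "\<mu> = density std_gaussian (\<lambda>x. ennreal (exp (f x)))" by (simp add: assms(3) f(1))
  obtain K where K: "compact K" "AE x in \<nu>. x \<in> K" using assms(8) by auto
  obtain r where r: "0 \<le> r" "\<And>x. x \<in> K \<Longrightarrow> norm x \<le> r"
    using compact_imp_bounded[OF K(1)] by (metis bounded_pos less_imp_le)
  obtain c where c: "\<And>x. c \<le> f x" using assms(9) by (auto simp: f(1))
  interpret schroedinger "exp (- \<epsilon> / 2)" r f w \<mu> \<nu>
  proof (rule schroedinger.intro)
    show "0 < exp (- \<epsilon> / 2)" "exp (- \<epsilon> / 2) < 1" using e by simp_all
    show "AE y in \<nu>. norm y \<le> r" using K(2) by eventually_elim (rule r(2))
  qed (fact r(1) f(2) w \<mu> \<nu> assms(4,6,7))+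
  show "entropic_cost \<epsilon> \<mu> \<nu> \<le> entropic_cost \<epsilon> \<mu> \<eta>"
    by (rule entropic_cost_convex_order[OF e refl assms(11) c])
qed

end
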